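(* Let $\mathcal G=\mathcal T$ or $\mathcal G=\mathcal T_o$, let $p\in(2,6)$, and define $$\mu^*_{\mathcal G}:=\max\left\{\mu\ge0:\ \mathcal L_{\mathcal G}(\mu)=\tfrac12\lambda_1\mu\right\},$$ so that $\mathcal L_{\mathcal G}(\mu)=\frac12\lambda_1\mu$ if $\mu\in[0,\mu^*_{\mathcal G}]$ and $\mathcal L_{\mathcal G}(\mu)<\frac12\lambda_1\mu$ if $\mu>\mu^*_{\mathcal G}$. Then ground states of mass $\mu$ on $\mathcal G$ exist if $\mu>\mu^*_{\mathcal G}$, whereas they do not exist if $\mu\in(0,\mu^*_{\mathcal G})$. Moreover: (i) if $p\in[4,6)$ then $\mu^*_{\mathcal G}>0$ (so that at $\mu=\mu^*_{\mathcal G}$ there is a genuine transition from nonexistence to existence of ground states); (ii) if $p\in(4,6)$, then ground states exist also when $\mu=\mu^*_{\mathcal G}$.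
   Context: $\mathcal T$ (unrooted binary tree) is the infinite metric tree with all edges of length $1$ in which every vertex has degree $3$. $\mathcal T_o$ (rooted binary tree) is the infinite metric tree with all edges of length $1$ in which every vertex has degree $3$, except one vertex $o$ (the root), which has degree $1$. For $\mathcal G\in\{\mathcal T,\mathcal T_o\}$, $H^1(\mathcal G)$ is the space of continuous real-valued functions on $\mathcal G$ whose restriction to each edge is $H^1$ and such that $\int_{\mathcal G}(|u'|^2+|u|^2)\,dx<\infty$; all integrals and $L^p$ norms are with respect to the length measure. For $\mu\ge0$, $H^1_\mu(\mathcal G):=\{u\in H^1(\mathcal G):\int_{\mathcal G}|u|^2dx=\mu\}$. The NLS energy is $E(u,\mathcal G):=\frac12\int_{\mathcal G}|u'|^2dx-\frac1p\int_{\mathcal G}|u|^pdx$, and $\mathcal L_{\mathcal G}(\mu):=\inf_{u\in H^1_\mu(\mathcal G)}E(u,\mathcal G)$ for $\mu\ge0$. A ground state of mass $\mu$ (on $\mathcal G$) is a function $u\in H^1_\mu(\mathcal G)$ with $E(u,\mathcal G)=\mathcal L_{\mathcal G}(\mu)$. The constant $\lambda_1$ is $\lambda_1:=\inf_{0\not\equiv u\in H^1(\mathcal T)}\frac{\int_{\mathcal T}|u'|^2dx}{\int_{\mathcal T}|u|^2dx}=\inf_{0\not\equiv u\in H^1(\mathcal T_o)}\frac{\int_{\mathcal T_o}|u'|^2dx}{\int_{\mathcal T_o}|u|^2dx}>0$ (it is known that the two infima coincide and are positive). *)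

theory Defs
  imports "HOL-Analysis.Analysis"
begin

section \<open>Metric graphs with edges of length one\<close>

text \<open>
  A graph is a set of edges, each listed once as a pair of its endpoints. The point on the edge
  \<open>(v, w)\<close> at distance \<open>t\<close> from \<open>v\<close> is \<open>((v, w), t)\<close> with \<open>0 \<le> t \<le> 1\<close>; the order of the
  endpoints only fixes this coordinate. A vertex is represented once for every edge incident with it,
  and a function on the metric graph has to take the same value at all these representatives
  (see \<open>cont_on_graph\<close> below). Values at pairs that are not points of the graph are irrelevant.
\<close>

type_synonym 'v mgraph = "('v \<times> 'v) set"
type_synonym 'v point = "('v \<times> 'v) \<times> real"

definition length_measure :: "'v mgraph \<Rightarrow> 'v point measure" where
  "length_measure G = count_space G \<Otimes>\<^sub>M lebesgue_on {0..1}"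

text \<open>
  Every edge has length one and the graphs below are locally finite, so a function is continuous on
  the metric graph iff it is continuous along each (closed) edge and well defined at the vertices.
\<close>

definition cont_on_graph :: "'v mgraph \<Rightarrow> ('v point \<Rightarrow> real) \<Rightarrow> bool" where
  "cont_on_graph G u \<longleftrightarrow>
     (\<forall>e\<in>G. continuous_on {0..1} (\<lambda>t. u (e, t))) \<and>
     (\<exists>f. \<forall>(v, w)\<in>G. u ((v, w), 0) = f v \<and> u ((v, w), 1) = f w)"


section \<open>The Sobolev space \<open>H\<^sup>1\<close>\<close>

definition L2_edge :: "(real \<Rightarrow> real) \<Rightarrow> bool" where
  "L2_edge f \<longleftrightarrow> f \<in> borel_measurable (lebesgue_on {0..1}) \<and>
     integrable (lebesgue_on {0..1}) (\<lambda>x. (f x)\<^sup>2)"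

text \<open>Continuously differentiable functions with compact support in the open interval \<open>(0, 1)\<close>;
  \<open>\<phi>'\<close> is the derivative of \<open>\<phi>\<close>.\<close>

definition test_function :: "(real \<Rightarrow> real) \<Rightarrow> (real \<Rightarrow> real) \<Rightarrow> bool" where
  "test_function \<phi> \<phi>' \<longleftrightarrow>
     (\<forall>x. (\<phi> has_real_derivative \<phi>' x) (at x)) \<and> continuous_on UNIV \<phi>' \<and>
     (\<exists>a b. 0 < a \<and> b < 1 \<and> (\<forall>x. x \<notin> {a..b} \<longrightarrow> \<phi> x = 0))"

definition has_weak_deriv :: "(real \<Rightarrow> real) \<Rightarrow> (real \<Rightarrow> real) \<Rightarrow> bool" where
  "has_weak_deriv u g \<longleftrightarrow> L2_edge g \<and>
     (\<forall>\<phi> \<phi>'. test_function \<phi> \<phi>' \<longrightarrow>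
        integral\<^sup>L (lebesgue_on {0..1}) (\<lambda>x. u x * \<phi>' x) =
        - integral\<^sup>L (lebesgue_on {0..1}) (\<lambda>x. g x * \<phi> x))"

definition H1_edge :: "(real \<Rightarrow> real) \<Rightarrow> bool" where
  "H1_edge u \<longleftrightarrow> L2_edge u \<and> (\<exists>g. has_weak_deriv u g)"

text \<open>Weak derivatives are unique almost everywhere on \<open>[0, 1]\<close>, so the choice below does not affect
  any integral.\<close>

definition weak_deriv :: "(real \<Rightarrow> real) \<Rightarrow> real \<Rightarrow> real" where
  "weak_deriv u = (SOME g. has_weak_deriv u g)"

definition graph_deriv :: "('v point \<Rightarrow> real) \<Rightarrow> 'v point \<Rightarrow> real" where
  "graph_deriv u = (\<lambda>(e, t). weak_deriv (\<lambda>s. u (e, s)) t)"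

definition H1 :: "'v mgraph \<Rightarrow> ('v point \<Rightarrow> real) set" where
  "H1 G = {u. cont_on_graph G u \<and> (\<forall>e\<in>G. H1_edge (\<lambda>t. u (e, t))) \<and>
     integrable (length_measure G) (\<lambda>z. (graph_deriv u z)\<^sup>2 + (u z)\<^sup>2)}"


section \<open>Energy and ground states\<close>

definition mass :: "'v mgraph \<Rightarrow> ('v point \<Rightarrow> real) \<Rightarrow> real" where
  "mass G u = integral\<^sup>L (length_measure G) (\<lambda>z. \<bar>u z\<bar>\<^sup>2)"

definition dirichlet :: "'v mgraph \<Rightarrow> ('v point \<Rightarrow> real) \<Rightarrow> real" where
  "dirichlet G u = integral\<^sup>L (length_measure G) (\<lambda>z. \<bar>graph_deriv u z\<bar>\<^sup>2)"

definition H1_mass :: "'v mgraph \<Rightarrow> real \<Rightarrow> ('v point \<Rightarrow> real) set" where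
  "H1_mass G \<mu> = {u \<in> H1 G. mass G u = \<mu>}"

definition energy :: "real \<Rightarrow> 'v mgraph \<Rightarrow> ('v point \<Rightarrow> real) \<Rightarrow> real" where
  "energy p G u = 1 / 2 * dirichlet G u
     - 1 / p * integral\<^sup>L (length_measure G) (\<lambda>z. \<bar>u z\<bar> powr p)"

definition ground_level :: "real \<Rightarrow> 'v mgraph \<Rightarrow> real \<Rightarrow> ereal" where
  "ground_level p G \<mu> = (INF u\<in>H1_mass G \<mu>. ereal (energy p G u))"

definition ground_state :: "real \<Rightarrow> 'v mgraph \<Rightarrow> real \<Rightarrow> ('v point \<Rightarrow> real) \<Rightarrow> bool" where
  "ground_state p G \<mu> u \<longleftrightarrow> u \<in> H1_mass G \<mu> \<and> ereal (energy p G u) = ground_level p G \<mu>"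


section \<open>The two binary trees\<close>

text \<open>
  Vertices of the unrooted tree are the words over the alphabet \<open>{0, 1, 2}\<close> without two equal
  consecutive letters; each nonempty word \<open>a # w\<close> is joined to \<open>w\<close>. The rooted tree is the branch
  at the vertex \<open>[]\<close> that starts with the edge \<open>([], [0])\<close>, with root \<open>[]\<close>.
\<close>

definition unrooted_tree :: "nat list mgraph" where
  "unrooted_tree = {(w, a # w) | w a. set (a # w) \<subseteq> {0, 1, 2} \<and> distinct_adj (a # w)}"

definition rooted_tree :: "nat list mgraph" where
  "rooted_tree = {(v, w) \<in> unrooted_tree. last w = 0}"

text \<open>The bottom of the spectrum. The infimum over \<open>rooted_tree\<close> has the same value.\<close>

definition lambda1 :: real where
  "lambda1 = Inf {dirichlet unrooted_tree u / mass unrooted_tree u | u.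
     u \<in> H1 unrooted_tree \<and> (\<exists>e\<in>unrooted_tree. \<exists>t\<in>{0..1}. u (e, t) \<noteq> 0)}"

definition critical_mass :: "real \<Rightarrow> 'v mgraph \<Rightarrow> real \<Rightarrow> bool" where
  "critical_mass p G \<mu> \<longleftrightarrow> 0 \<le> \<mu> \<and> ground_level p G \<mu> = ereal (1 / 2 * lambda1 * \<mu>)"

text \<open>\<open>Greatest\<close> is only meaningful if the maximum exists.\<close>

definition mu_star :: "real \<Rightarrow> 'v mgraph \<Rightarrow> real" where
  "mu_star p G = (GREATEST \<mu>. critical_mass p G \<mu>)"


subsection \<open>The graphs above are trees with the required degrees\<close>

definition vertex_degree :: "'v mgraph \<Rightarrow> 'v \<Rightarrow> nat" where
  "vertex_degree G v = card {e \<in> G. fst e = v \<or> snd e = v}"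

text \<open>A tree is a connected graph in which every edge is a bridge.\<close>

definition is_tree :: "'v mgraph \<Rightarrow> bool" where
  "is_tree G \<longleftrightarrow>
     (\<forall>v\<in>Field G. \<forall>w\<in>Field G. (v, w) \<in> (G \<union> G\<inverse>)\<^sup>*) \<and>
     (\<forall>(v, w)\<in>G. (v, w) \<notin> ((G - {(v, w)}) \<union> (G - {(v, w)})\<inverse>)\<^sup>*)"

lemma is_treeI:
  assumes edges: "\<And>v w. (v, w) \<in> G \<Longrightarrow> \<exists>a. w = a # v"
    and closed: "\<And>a v. (v, a # v) \<in> G \<Longrightarrow> v \<noteq> [] \<Longrightarrow> (tl v, v) \<in> G"
  shows "is_tree G"
proof -
  have root: "(v, a # v) \<in> G \<Longrightarrow> ([], a # v) \<in> (G \<union> G\<inverse>)\<^sup>*" for a v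
  proof (induction v arbitrary: a)
    case Nil
    then show ?case by auto
  next
    case (Cons b v)
    from closed[OF Cons.prems] have "(v, b # v) \<in> G" by simp
    from Cons.IH[OF this] Cons.prems show ?case
      by (meson UnI1 rtrancl.rtrancl_into_rtrancl)
  qed
  have root': "([], v) \<in> (G \<union> G\<inverse>)\<^sup>*" if v: "v \<in> Field G" for v
  proof -
    from v consider w where "(v, w) \<in> G" | w where "(w, v) \<in> G" by (auto simp: Field_def)
    then show ?thesis
    proof cases
      case 1
      then obtain a where w: "w = a # v" using edges by blast
      show ?thesis
      proof (cases v)
        case (Cons b u)
        then show ?thesis using closed[of v a] root[of u b] 1 w by auto
      qed simp
    next
      case 2
      then show ?thesis using edges root by blast
    qed
  qed
  have sym: "sym ((G \<union> G\<inverse>)\<^sup>*)" by (simp add: sym_Un_converse sym_rtrancl)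
  have bridge: False
    if e: "(v, w) \<in> G" and p: "(v, w) \<in> ((G - {(v, w)}) \<union> (G - {(v, w)})\<inverse>)\<^sup>*" for v w
  proof -
    obtain a where w: "w = a # v" using edges[OF e] by blast
    define D where "D x \<longleftrightarrow> (\<exists>us. x = us @ w)" for x
    have step: "D x = D y" if xy: "(x, y) \<in> G - {(v, w)}" for x y
    proof -
      obtain b where y: "y = b # x" using edges xy by blast
      have "y \<noteq> w" using xy y w by auto
      then show ?thesis unfolding D_def y
        by (metis append_eq_Cons_conv)
    qed
    from p have "D v = D w"
      by (induction rule: rtrancl_induct) (use step in auto)
    moreover have "D w" "\<not> D v" by (auto simp: D_def w)
    ultimately show False by blast
  qed
  show ?thesis unfolding is_tree_def
  proof safe
    fix v w assume "v \<in> Field G" "w \<in> Field G"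
    then show "(v, w) \<in> (G \<union> G\<inverse>)\<^sup>*"
      using root' sym by (meson rtrancl_trans symD)
  qed (use bridge in blast)
qed

lemma Collect_singletonI:
  "p \<in> A \<Longrightarrow> P p \<Longrightarrow> (\<And>e. e \<in> A \<Longrightarrow> P e \<Longrightarrow> e = p) \<Longrightarrow> {e \<in> A. P e} = {p}"
  by blast

lemma unrooted_tree_iff:
  "(v, w) \<in> unrooted_tree \<longleftrightarrow> (\<exists>a. w = a # v \<and> set w \<subseteq> {0, 1, 2} \<and> distinct_adj w)"
  by (auto simp only: unrooted_tree_def mem_Collect_eq prod.inject)

lemma unrooted_treeE:
  assumes "(v, w) \<in> unrooted_tree"
  obtains a where "w = a # v"
  using assms that unfolding unrooted_tree_iff by (elim exE conjE)

lemma rooted_tree_iff: "(v, w) \<in> rooted_tree \<longleftrightarrow> (v, w) \<in> unrooted_tree \<and> last w = 0"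
  by (simp add: rooted_tree_def)

lemma is_tree_unrooted_tree: "is_tree unrooted_tree"
proof (rule is_treeI)
  show "\<exists>a. w = a # v" if "(v, w) \<in> unrooted_tree" for v w
    using that unfolding unrooted_tree_iff by blast
  show "(tl v, v) \<in> unrooted_tree" if e: "(v, a # v) \<in> unrooted_tree" and "v \<noteq> []" for a v
  proof -
    from \<open>v \<noteq> []\<close> obtain b u where v: "v = b # u" by (cases v) auto
    have "set v \<subseteq> {0, 1, 2}" "distinct_adj v"
      using e unfolding unrooted_tree_iff by (simp_all add: distinct_adj_Cons v)
    then show ?thesis unfolding unrooted_tree_iff v by simp
  qed
qed

lemma is_tree_rooted_tree: "is_tree rooted_tree"
proof (rule is_treeI)
  show "\<exists>a. w = a # v" if "(v, w) \<in> rooted_tree" for v w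
    using that by (auto simp: rooted_tree_iff dest: unrooted_tree_iff[THEN iffD1])
  show "(tl v, v) \<in> rooted_tree" if e: "(v, a # v) \<in> rooted_tree" and "v \<noteq> []" for a v
  proof -
    from \<open>v \<noteq> []\<close> obtain b u where v: "v = b # u" by (cases v) auto
    have "set v \<subseteq> {0, 1, 2}" "distinct_adj v" "last v = 0"
      using e unfolding rooted_tree_iff unrooted_tree_iff by (simp_all add: distinct_adj_Cons v)
    then show ?thesis unfolding rooted_tree_iff unrooted_tree_iff v by simp
  qed
qed

lemma unrooted_tree_Cons_iff:
  "(v, a # v) \<in> unrooted_tree \<longleftrightarrow>
     a \<in> {0, 1, 2} - set (take 1 v) \<and> set v \<subseteq> {0, 1, 2} \<and> distinct_adj v"
  unfolding unrooted_tree_iff by (cases v) auto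

lemma unrooted_tree_edges_from:
  assumes "set v \<subseteq> {0, 1, 2}" "distinct_adj v"
  shows "{e \<in> unrooted_tree. fst e = v} = (\<lambda>a. (v, a # v)) ` ({0, 1, 2} - set (take 1 v))"
    (is "?L = ?R")
proof (intro subset_antisym subsetI)
  fix e assume e: "e \<in> ?L"
  then obtain w where w: "e = (v, w)" "(v, w) \<in> unrooted_tree" by (cases e) simp
  from w(2) obtain a where a: "w = a # v" by (rule unrooted_treeE)
  with w have "a \<in> {0, 1, 2} - set (take 1 v)" by (simp only: unrooted_tree_Cons_iff)
  then show "e \<in> ?R" unfolding w(1) a by (rule imageI)
next
  fix e assume "e \<in> ?R"
  then obtain a where a: "e = (v, a # v)" "a \<in> {0, 1, 2} - set (take 1 v)"
    by (elim imageE)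
  then have "(v, a # v) \<in> unrooted_tree" unfolding unrooted_tree_Cons_iff using assms by simp
  with a show "e \<in> ?L" by simp
qed

lemma edges_at: "{e \<in> G. fst e = v \<or> snd e = v} = {e \<in> G. fst e = v} \<union> {e \<in> G. snd e = v}"
  by blast

lemma unrooted_tree_edges_to_Nil: "{e \<in> unrooted_tree. snd e = []} = {}"
  using unrooted_tree_iff by fastforce

lemma vertex_degree_unrooted_tree:
  assumes "v \<in> Field unrooted_tree"
  shows "vertex_degree unrooted_tree v = 3"
proof -
  from assms obtain x where "(v, x) \<in> unrooted_tree \<or> (x, v) \<in> unrooted_tree"
    unfolding Field_def by blast
  then have "set v \<subseteq> {0, 1, 2} \<and> distinct_adj v"
  proof
    assume e: "(v, x) \<in> unrooted_tree"
    then obtain a where x: "x = a # v" by (rule unrooted_treeE)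
    from e show ?thesis unfolding x unrooted_tree_Cons_iff by (rule conjunct2)
  next
    assume "(x, v) \<in> unrooted_tree"
    then show ?thesis unfolding unrooted_tree_iff by (elim exE) (rule conjunct2)
  qed
  then have v: "set v \<subseteq> {0, 1, 2}" "distinct_adj v" by simp_all
  have inj: "inj_on (\<lambda>a. (v, a # v)) A" for A by (simp add: inj_on_def)
  have out: "card {e \<in> unrooted_tree. fst e = v} = card ({0, 1, 2} - set (take 1 v))"
    unfolding unrooted_tree_edges_from[OF v] by (rule card_image[OF inj])
  have fin: "finite {e \<in> unrooted_tree. fst e = v}"
    unfolding unrooted_tree_edges_from[OF v] by simp
  show ?thesis
  proof (cases v)
    case Nil
    then show ?thesis
      using out unfolding vertex_degree_def edges_at by (simp add: unrooted_tree_edges_to_Nil)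
  next
    case (Cons b u)
    have edge: "(u, v) \<in> unrooted_tree" using v by (simp add: unrooted_tree_iff Cons)
    have *: "e = (u, v)" if "e \<in> unrooted_tree" "snd e = v" for e
      using that unfolding Cons by (cases e) (simp add: unrooted_tree_iff)
    from edge _ * have "{e \<in> unrooted_tree. snd e = v} = {(u, v)}"
      by (rule Collect_singletonI) simp
    moreover have "card ({0, 1, 2} - {b}) = 2"
      using v unfolding Cons by (subst card_Diff_singleton) auto
    ultimately show ?thesis
      using out fin unfolding vertex_degree_def edges_at by (simp add: Cons)
  qed
qed

lemma vertex_degree_rooted_tree_root: "vertex_degree rooted_tree [] = 1"
proof -
  have *: "e = ([], [0])" if e: "e \<in> rooted_tree" "fst e = [] \<or> snd e = []" for e
  proof (cases e)
    case (Pair x y)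
    then have xy: "(x, y) \<in> unrooted_tree" "last y = 0" using e by (simp_all add: rooted_tree_iff)
    from xy(1) obtain a where y: "y = a # x" by (rule unrooted_treeE)
    from e(2) have "x = []" unfolding Pair y by simp
    from this xy(2) show ?thesis unfolding Pair y by simp
  qed
  have "([], [0]) \<in> rooted_tree" by (simp add: rooted_tree_iff unrooted_tree_iff)
  from this _ * have "{e \<in> rooted_tree. fst e = [] \<or> snd e = []} = {([], [0])}"
    by (rule Collect_singletonI) simp
  then show ?thesis by (simp add: vertex_degree_def)
qed

lemma vertex_degree_rooted_tree:
  assumes "v \<in> Field rooted_tree" "v \<noteq> []"
  shows "vertex_degree rooted_tree v = 3"
proof -
  have child: "last x = last v" if "(v, x) \<in> unrooted_tree" for x
    using that assms(2) unfolding unrooted_tree_iff by auto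
  have v: "v \<in> Field unrooted_tree"
    using assms(1) mono_Field[of rooted_tree unrooted_tree] by (auto simp: rooted_tree_def)
  have last: "last v = 0"
  proof -
    from assms(1) obtain x where "(v, x) \<in> rooted_tree \<or> (x, v) \<in> rooted_tree"
      unfolding Field_def by blast
    then show ?thesis unfolding rooted_tree_iff using child[of x] by argo
  qed
  have "(x, y) \<in> rooted_tree \<longleftrightarrow> (x, y) \<in> unrooted_tree" if "x = v \<or> y = v" for x y
    using that last child[of y] unfolding rooted_tree_iff by metis
  then have "{e \<in> rooted_tree. fst e = v \<or> snd e = v} = {e \<in> unrooted_tree. fst e = v \<or> snd e = v}"
    by (intro Collect_cong) auto
  with vertex_degree_unrooted_tree[OF v] show ?thesis by (simp add: vertex_degree_def)
qed

end

theory Submission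
  imports Defs "HOL-Complex_Analysis.Great_Picard"
begin

text \<open>
  Write \<open>gap\<close> for the Dirichlet integral minus \<open>\<lambda>\<^sub>1\<close> times the mass, and \<open>excess\<close> for the energy minus \<open>\<lambda>\<^sub>1 / 2\<close>
  times the mass, that is, half the gap minus \<open>1 / p\<close> times the integral of \<open>\<bar>u\<bar> powr p\<close>. The theorem is about the sign
  of the infimum of the excess at given mass, and about whether the infimum is attained.

  The spectral gap. Let \<open>\<omega> = arctan (\<surd>2 / 4)\<close>. On each edge take the solution \<open>profile\<close> of \<open>u'' = - \<omega>\<^sup>2 u\<close> and
  multiply it by \<open>1 / \<surd>2\<close> from each generation to the next: this is a positive eigenfunction on the tree, except at
  the root. Completing the square against it (\<open>edge_inequality\<close>) and summing over the edges shows that the gap,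
  taken with \<open>\<omega>\<^sup>2\<close>, is a multiple of the squared value at the root plus a sum of nonnegative defects
  (\<open>tree_gap_identity\<close>). Truncations of the eigenfunction show that this is sharp (\<open>small_gap_exists\<close>), so
  \<open>\<lambda>\<^sub>1 = \<omega>\<^sup>2\<close>, for both trees, and the infimum of the excess is never positive. The defects also
  control how much a function grows along a path beyond the decay of the eigenfunction; this yields a bound for the squared
  supremum by the gap (\<open>gap_controls_sup\<close>).

  Scaling. A function of negative excess keeps it when it is multiplied by a larger factor, or by a factor slightly
  less than \<open>1\<close>. So the masses at which the excess takes negative values form an open half-line
  (\<open>negative_excess_iff\<close>), and its end point is the critical mass. A ground state of smaller positive mass could be scaled up
  to negative excess at the critical mass, so there is none. If \<open>4 \<le> p\<close>, the supremum bound makes the power integral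
  small compared with the gap when the mass is small, so the critical mass is positive.

  Existence. For \<open>\<mu>\<close> above the critical mass let \<open>- \<kappa> \<mu>\<close> be the infimum of the excess. The functional
  \<open>penalized\<close>, the excess plus \<open>\<kappa>\<close> times the mass, is additive over the edges, nonnegative on all functions of mass
  at most \<open>\<mu>\<close>, and tends to \<open>0\<close> along a minimizing sequence. Suppose that the sequence does not vanish on the root
  edges. Cutting off the branches behind a late generation costs little, hence a limit along a subsequence
  has nonpositive functional (\<open>limit_theorem\<close>). Functions of smaller mass have a strictly positive functional
  (\<open>penalized_gain\<close>), so the limit has mass \<open>\<mu>\<close> and is a ground state. A minimizing sequence that runs off to
  infinity is brought back: in the unrooted tree by automorphisms (\<open>recentre\<close>), in the rooted tree by repeatedly
  discarding the root edge and the lighter of the two branches behind it (\<open>rooted_recentre\<close>). The same argument with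
  \<open>\<kappa> = 0\<close> applies at the critical mass if \<open>4 < p\<close>: functions of negative excess whose masses decrease to the critical mass
  do not vanish, again because the gap controls the supremum.
\<close>

section \<open>Primitives on the unit interval\<close>

abbreviation unit_interval :: "real measure" ("\<II>") where
  "\<II> \<equiv> lebesgue_on {0..1}"

lemma finite_measure_unit: "finite_measure \<II>"
  by (intro finite_measure_lebesgue_on) simp

lemma sigma_finite_unit: "sigma_finite_measure \<II>"
  using finite_measure_unit finite_measure.axioms(1) by blast

lemma measure_unit: "measure \<II> {0..1} = 1"
  by (simp add: measure_restrict_space)

lemma borel_measurable_unit: "f \<in> borel_measurable borel \<Longrightarrow> f \<in> borel_measurable \<II>"
  by (simp add: measurable_completion measurable_restrict_space1)

lemma ident_measurable_unit [measurable]: "(\<lambda>x. x) \<in> borel_measurable \<II>"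
  by (rule borel_measurable_unit) simp

lemma integrable_unit_const [simp]: "integrable \<II> (\<lambda>x. c::real)"
  using finite_measure.integrable_const[OF finite_measure_unit] by blast

lemma continuous_imp_measurable_unit:
  "continuous_on {0..1} f \<Longrightarrow> f \<in> borel_measurable \<II>" for f :: "real \<Rightarrow> real"
  by (intro continuous_imp_measurable_on_sets_lebesgue) auto

lemma continuous_imp_integrable_unit:
  "continuous_on {0..1} f \<Longrightarrow> integrable \<II> f" for f :: "real \<Rightarrow> real"
  using absolutely_integrable_continuous_real[of 0 1 f]
  by (simp add: integrable_restrict_space set_integrable_def)

lemma null_unit: "AE s in \<II>. s \<noteq> (t::real)"
proof -
  have "emeasure \<II> {t} = 0" if "t \<in> {0..1}"
    using that by (simp add: emeasure_restrict_space)
  moreover have "{t} \<in> sets \<II>" if "t \<in> {0..1}" using that by (auto simp: sets_restrict_space)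
  ultimately show ?thesis
    by (cases "t \<in> {0..1}") (blast intro: AE_I[where N="{t}"], rule AE_I2, auto)
qed

text \<open>
  The primitive is an integral over the whole interval against an indicator, so that Fubini and
  dominated convergence apply to it without restricting the measure.
\<close>

definition prim :: "(real \<Rightarrow> real) \<Rightarrow> real \<Rightarrow> real" where
  "prim g t = (\<integral>s. indicator {0..t} s * g s \<partial>\<II>)"

lemma prim_1: "prim g 1 = integral\<^sup>L \<II> g"
  unfolding prim_def by (rule Bochner_Integration.integral_cong) auto

lemma prim_0 [simp]: "prim g 0 = 0"
  unfolding prim_def by (rule integral_eq_zero_AE) (use null_unit[of 0] in eventually_elim, auto simp: indicator_def)

lemma integrable_indicator_mult:
  fixes g :: "real \<Rightarrow> real"
  assumes "integrable \<II> g" shows "integrable \<II> (\<lambda>s. indicator {a..b::real} s * g s)"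
proof -
  have "(\<lambda>s. indicat_real {a..b} s) \<in> borel_measurable \<II>" by measurable
  then show ?thesis
    by (intro Bochner_Integration.integrable_bound[OF assms]) (use assms in \<open>auto simp: indicator_def\<close>)
qed

text \<open>
  Integration by parts for integrands that are merely integrable: the product of the two integrals is
  an integral over the unit square, and Fubini on the two triangles below and above the diagonal gives
  the two summands. The diagonal is a null set, section by section.
\<close>

lemma prim_by_parts_base:
  assumes a: "integrable \<II> a" and b: "integrable \<II> b"
  shows "integrable \<II> (\<lambda>t. a t * prim b t)" "integrable \<II> (\<lambda>t. prim a t * b t)"
    "integral\<^sup>L \<II> a * integral\<^sup>L \<II> b = (\<integral>t. a t * prim b t + prim a t * b t \<partial>\<II>)"
proof -
  interpret pair_sigma_finite \<II> \<II> unfolding pair_sigma_finite_def using sigma_finite_unit by blast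
  have am[measurable]: "a \<in> borel_measurable \<II>" and bm[measurable]: "b \<in> borel_measurable \<II>"
    using a b by auto
  have ab: "integrable (\<II> \<Otimes>\<^sub>M \<II>) (\<lambda>(s, t). a s * b t)"
  proof (rule Fubini_integrable)
    show "integrable \<II> (\<lambda>x. \<integral>y. norm (case (x, y) of (s, t) \<Rightarrow> a s * b t) \<partial>\<II>)"
      using a by (simp add: abs_mult)
  qed (use b in auto)
  define k1 where "k1 = (\<lambda>(s, t). indicator {0..s} t * (a s * b t) :: real)"
  define k2 where "k2 = (\<lambda>(s, t). indicator {0..t} s * (a s * b t) :: real)"
  have k1m[measurable]: "k1 \<in> borel_measurable (\<II> \<Otimes>\<^sub>M \<II>)"
    unfolding k1_def indicator_def atLeastAtMost_iff by measurable
  have k2m[measurable]: "k2 \<in> borel_measurable (\<II> \<Otimes>\<^sub>M \<II>)"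
    unfolding k2_def indicator_def atLeastAtMost_iff by measurable
  have k1: "integrable (\<II> \<Otimes>\<^sub>M \<II>) k1"
    by (rule Bochner_Integration.integrable_bound[OF ab]) (auto simp: k1_def indicator_def)
  have k2: "integrable (\<II> \<Otimes>\<^sub>M \<II>) k2"
    by (rule Bochner_Integration.integrable_bound[OF ab]) (auto simp: k2_def indicator_def)
  have e1: "(\<integral>t. k1 (s, t) \<partial>\<II>) = a s * prim b s" for s
    unfolding k1_def prim_def
    by (simp add: mult.left_commute flip: Bochner_Integration.integral_mult_right_zero)
  have e2: "(\<integral>s. k2 (s, t) \<partial>\<II>) = prim a t * b t" for t
    unfolding k2_def prim_def
    by (simp add: mult.assoc flip: Bochner_Integration.integral_mult_left_zero)
  from integrable_fst'[OF k1] show i1: "integrable \<II> (\<lambda>t. a t * prim b t)"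
    unfolding e1 .
  have k2': "integrable (\<II> \<Otimes>\<^sub>M \<II>) (\<lambda>(s, t). k2 (s, t))" using k2 by simp
  from integrable_snd[OF k2'] show i2: "integrable \<II> (\<lambda>t. prim a t * b t)"
    unfolding e2 .
  have "integral\<^sup>L \<II> a * integral\<^sup>L \<II> b = (\<integral>s. (\<integral>t. a s * b t \<partial>\<II>) \<partial>\<II>)"
    by simp
  also have "\<dots> = (\<integral>s. (\<integral>t. k1 (s, t) + k2 (s, t) \<partial>\<II>) \<partial>\<II>)"
  proof (rule Bochner_Integration.integral_cong[OF refl])
    fix s :: real assume "s \<in> space \<II>"
    then have s: "0 \<le> s" by simp
    show "(\<integral>t. a s * b t \<partial>\<II>) = (\<integral>t. k1 (s, t) + k2 (s, t) \<partial>\<II>)"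
    proof (intro integral_cong_AE)
      show "AE t in \<II>. a s * b t = k1 (s, t) + k2 (s, t)"
      proof -
        have "AE t in \<II>. t \<in> {0..1}" by (rule AE_I2) simp
        with null_unit[of s] show ?thesis
          by eventually_elim (use s in \<open>auto simp: k1_def k2_def indicator_def\<close>)
      qed
    qed (use \<open>s \<in> space \<II>\<close> in \<open>auto intro!: borel_measurable_add measurable_Pair2[OF k1m] measurable_Pair2[OF k2m]\<close>)
  qed
  also have "\<dots> = integral\<^sup>L (\<II> \<Otimes>\<^sub>M \<II>) (\<lambda>z. k1 z + k2 z)"
    by (rule integral_fst'[OF Bochner_Integration.integrable_add[OF k1 k2]])
  also have "\<dots> = integral\<^sup>L (\<II> \<Otimes>\<^sub>M \<II>) k1 + integral\<^sup>L (\<II> \<Otimes>\<^sub>M \<II>) k2"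
    by (rule Bochner_Integration.integral_add[OF k1 k2])
  also have "integral\<^sup>L (\<II> \<Otimes>\<^sub>M \<II>) k1 = (\<integral>t. a t * prim b t \<partial>\<II>)"
    using integral_fst'[OF k1] e1 by simp
  also have "integral\<^sup>L (\<II> \<Otimes>\<^sub>M \<II>) k2 = (\<integral>t. prim a t * b t \<partial>\<II>)"
    using integral_snd[OF k2'] e2 by simp
  finally show "integral\<^sup>L \<II> a * integral\<^sup>L \<II> b = (\<integral>t. a t * prim b t + prim a t * b t \<partial>\<II>)"
    using Bochner_Integration.integral_add[OF i1 i2] by simp
qed

text \<open>
  Cut both integrands off at \<open>t\<close>; up to \<open>t\<close> this does not change their primitives.
\<close>

lemma prim_by_parts:
  assumes a: "integrable \<II> a" and b: "integrable \<II> b" and t: "t \<in> {0..1}"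
  shows "prim a t * prim b t = prim (\<lambda>s. a s * prim b s + prim a s * b s) t"
proof -
  let ?i = "indicator {0..t} :: real \<Rightarrow> real"
  have p: "prim (\<lambda>s. ?i s * h s) s = prim h s" if "s \<in> {0..t}" for s h
    unfolding prim_def by (intro Bochner_Integration.integral_cong) (use that in \<open>auto simp: indicator_def\<close>)
  have "prim a t * prim b t = integral\<^sup>L \<II> (\<lambda>s. ?i s * a s) * integral\<^sup>L \<II> (\<lambda>s. ?i s * b s)"
    by (simp add: prim_def)
  also have "\<dots> = (\<integral>s. ?i s * a s * prim (\<lambda>s. ?i s * b s) s + prim (\<lambda>s. ?i s * a s) s * (?i s * b s) \<partial>\<II>)"
    by (rule prim_by_parts_base(3)) (intro integrable_indicator_mult a b)+
  also have "\<dots> = prim (\<lambda>s. a s * prim b s + prim a s * b s) t"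
    unfolding prim_def[of _ t]
  proof (intro Bochner_Integration.integral_cong refl)
    fix s :: real
    show "?i s * a s * prim (\<lambda>s. ?i s * b s) s + prim (\<lambda>s. ?i s * a s) s * (?i s * b s) =
      ?i s * (a s * prim b s + prim a s * b s)"
      using p[of s] by (cases "s \<in> {0..t}") (auto simp: algebra_simps)
  qed
  finally show ?thesis .
qed

lemma prim_eq_integral:
  assumes "integrable \<II> g" "t \<in> {0..1}"
  shows "prim g t = integral {0..t} g"
proof -
  have "prim g t = integral {0..1} (\<lambda>s. indicator {0..t} s * g s)"
    unfolding prim_def
    by (rule lebesgue_integral_eq_integral[OF integrable_indicator_mult[OF assms(1)]]) simp
  also have "\<dots> = integral {0..1} (\<lambda>s. if s \<in> {0..t} then g s else 0)"
    by (rule arg_cong[of _ _ "integral {0..1}"]) (auto simp: indicator_def)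
  also have "\<dots> = integral {0..t} g"
    using assms(2) by (subst integral_restrict_Int) (simp add: Int_absorb2)
  finally show ?thesis .
qed

lemma prim_deriv:
  assumes "\<And>x. x \<in> {0..1} \<Longrightarrow> (f has_real_derivative f' x) (at x within {0..1})"
    and "continuous_on {0..1} f'" and "t \<in> {0..1}"
  shows "prim f' t = f t - f 0"
proof -
  have "(f' has_integral (f t - f 0)) {0..t}"
  proof (rule fundamental_theorem_of_calculus)
    fix x assume "x \<in> {0..t}"
    then show "(f has_vector_derivative f' x) (at x within {0..t})"
      using assms by (intro has_vector_derivative_within_subset[of f "f' x" x "{0..1}" "{0..t}"])
        (auto simp: has_real_derivative_iff_has_vector_derivative)
  qed (use assms in auto)
  then show ?thesis
    using prim_eq_integral[OF continuous_imp_integrable_unit[OF assms(2)] assms(3)]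
    by (simp add: integral_unique)
qed

text \<open>
  The positive and the negative part of \<open>k\<close> define finite measures that agree on all half-lines,
  hence on all Borel sets.
\<close>

lemma integral_subset_borel_zero:
  assumes k: "integrable \<II> k" and zero: "\<And>t. t \<in> {0..1} \<Longrightarrow> prim k t = 0"
    and B: "B \<in> sets borel"
  shows "(\<integral>x. indicator B x * k x \<partial>\<II>) = 0"
proof -
  have bor: "(\<lambda>x. x) \<in> measurable \<II> borel" by (rule ident_measurable_unit)
  have km[measurable]: "k \<in> borel_measurable \<II>" using k by auto
  have ind[measurable]: "indicat_real C \<in> borel_measurable \<II>" if "C \<in> sets borel" for C
    using that by (intro borel_measurable_unit) simp
  have ii: "integrable \<II> (\<lambda>x. indicator C x * k x)" if "C \<in> sets borel" for C :: "real set"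
    by (rule Bochner_Integration.integrable_bound[OF k borel_measurable_times[OF ind[OF that] km]])
      (auto simp: indicator_def)
  define M where "M = distr (density \<II> (\<lambda>x. ennreal (k x))) borel (\<lambda>x. x)"
  define N where "N = distr (density \<II> (\<lambda>x. ennreal (- k x))) borel (\<lambda>x. x)"
  have emM: "emeasure M C = (\<integral>\<^sup>+x. ennreal (indicator C x * k x) \<partial>\<II>)" if C: "C \<in> sets borel" for C
  proof -
    have "emeasure M C = emeasure (density \<II> (\<lambda>x. ennreal (k x))) (C \<inter> {0..1})"
      unfolding M_def using C by (subst emeasure_distr) (auto intro: bor)
    also have "\<dots> = (\<integral>\<^sup>+x. ennreal (k x) * indicator (C \<inter> {0..1}) x \<partial>\<II>)"
      using measurable_sets[OF bor C] by (intro emeasure_density) auto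
    also have "\<dots> = (\<integral>\<^sup>+x. ennreal (indicator C x * k x) \<partial>\<II>)"
      by (intro nn_integral_cong) (auto simp: indicator_def)
    finally show ?thesis .
  qed
  have emN: "emeasure N C = (\<integral>\<^sup>+x. ennreal (- (indicator C x * k x)) \<partial>\<II>)" if C: "C \<in> sets borel" for C
  proof -
    have "emeasure N C = emeasure (density \<II> (\<lambda>x. ennreal (- k x))) (C \<inter> {0..1})"
      unfolding N_def using C by (subst emeasure_distr) (auto intro: bor)
    also have "\<dots> = (\<integral>\<^sup>+x. ennreal (- k x) * indicator (C \<inter> {0..1}) x \<partial>\<II>)"
      using measurable_sets[OF bor C] by (intro emeasure_density) auto
    also have "\<dots> = (\<integral>\<^sup>+x. ennreal (- (indicator C x * k x)) \<partial>\<II>)"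
      by (intro nn_integral_cong) (auto simp: indicator_def)
    finally show ?thesis .
  qed
  have diff: "(\<integral>x. indicator C x * k x \<partial>\<II>) = enn2real (emeasure M C) - enn2real (emeasure N C)"
    if "C \<in> sets borel" for C
    unfolding emM[OF that] emN[OF that] using ii[OF that] by (rule real_lebesgue_integral_def)
  have fin: "emeasure M C < \<infinity>" "emeasure N C < \<infinity>" if "C \<in> sets borel" for C
    unfolding emM[OF that] emN[OF that] using ii[OF that] by (auto simp: real_integrable_def top.not_eq_extremum)
  have "M = N"
  proof (rule measure_eqI_lessThan)
    fix x :: real
    have "(\<integral>s. indicator {x<..} s * k s \<partial>\<II>) = (\<integral>s. k s - indicator {0..x} s * k s \<partial>\<II>)"
      by (intro Bochner_Integration.integral_cong) (auto simp: indicator_def)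
    also have "\<dots> = prim k 1 - prim k x"
      unfolding prim_1 prim_def[of _ x]
      by (rule Bochner_Integration.integral_diff[OF k integrable_indicator_mult[OF k]])
    also have "prim k x = 0"
    proof (cases "x \<in> {0..1}")
      case False
      then consider "x < 0" | "x > 1" by force
      then show ?thesis
      proof cases
        case 2
        then have "prim k x = prim k 1"
          unfolding prim_def by (intro Bochner_Integration.integral_cong) (auto simp: indicator_def)
        then show ?thesis using zero[of 1] by simp
      qed (simp add: prim_def)
    qed (rule zero)
    finally have "enn2real (emeasure M {x<..}) = enn2real (emeasure N {x<..})"
      using diff[of "{x<..}"] zero[of 1] by simp
    then show "emeasure M {x<..} = emeasure N {x<..}"
      using fin[of "{x<..}"] by (metis borel_open ennreal_enn2real open_greaterThan infinity_ennreal_def)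
  qed (use fin in \<open>auto simp: M_def N_def\<close>)
  then show ?thesis using diff[OF B] by simp
qed

lemma prim_zero_AE:
  assumes k: "integrable \<II> k" and zero: "\<And>t. t \<in> {0..1} \<Longrightarrow> prim k t = 0"
  shows "AE x in \<II>. k x = 0"
proof (rule sigma_finite_measure.density_zero[OF sigma_finite_unit k])
  fix A assume "A \<in> sets \<II>"
  then obtain S where S: "S \<in> sets lebesgue" "A = S \<inter> {0..1}"
    by (auto simp: sets_restrict_space)
  from S(1) obtain B N N' where BN: "S = B \<union> N" "N \<subseteq> N'" "N' \<in> null_sets lborel" "B \<in> sets lborel"
    by (rule sets_completionE)
  have km: "k \<in> borel_measurable \<II>" using k by auto
  have indB: "indicat_real B \<in> borel_measurable \<II>"
    using BN(4) by (intro borel_measurable_unit) simp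
  have "N' \<in> null_sets lebesgue" using BN(3) by (rule null_sets_completionI)
  then have "AE x in lebesgue. x \<notin> N'" by (rule AE_not_in)
  then have "AE x in \<II>. x \<notin> N'"
    by (subst AE_restrict_space_iff) auto
  moreover have "AE x in \<II>. x \<in> {0..1}" by (rule AE_I2) simp
  ultimately have "AE x in \<II>. indicator A x * k x = indicator B x * k x"
    by eventually_elim (use BN S(2) in \<open>auto simp: indicator_def\<close>)
  then have ae: "AE x in \<II>. indicator A x * k x = indicator B x * k x" .
  show "set_lebesgue_integral \<II> A k = 0"
  proof -
    have "set_lebesgue_integral \<II> A k = (\<integral>x. indicator B x * k x \<partial>\<II>)"
      unfolding set_lebesgue_integral_def real_scaleR_def
      using ae by (intro integral_cong_AE borel_measurable_times borel_measurable_indicator km indB \<open>A \<in> sets \<II>\<close>)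
    also have "\<dots> = 0" using integral_subset_borel_zero[OF k zero] BN(4) by simp
    finally show ?thesis .
  qed
qed

section \<open>Functions with a square integrable derivative\<close>

lemma L2_edge_integrable: assumes "L2_edge f" shows "integrable \<II> f"
proof -
  have "integrable \<II> (\<lambda>x. 1 + (f x)\<^sup>2)" using assms by (simp add: L2_edge_def)
  moreover have "\<bar>f x\<bar> \<le> 1 + (f x)\<^sup>2" for x
    using zero_le_power2[of "\<bar>f x\<bar> - 1"] zero_le_power2[of "f x"] by (simp add: power2_eq_square algebra_simps)
  ultimately show ?thesis
    using assms by (auto intro!: Bochner_Integration.integrable_bound[of \<II> "\<lambda>x. 1 + (f x)\<^sup>2" f] simp: L2_edge_def)
qed

lemma L2_edge_mult_integrable:
  assumes "L2_edge f" "L2_edge g" shows "integrable \<II> (\<lambda>x. f x * g x)"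
proof (rule Bochner_Integration.integrable_bound)
  show "integrable \<II> (\<lambda>x. (f x)\<^sup>2 + (g x)\<^sup>2)" using assms by (simp add: L2_edge_def)
  show "(\<lambda>x. f x * g x) \<in> borel_measurable \<II>"
    using assms by (intro borel_measurable_times) (simp_all add: L2_edge_def)
  have "\<bar>f x * g x\<bar> \<le> (f x)\<^sup>2 + (g x)\<^sup>2" for x
  proof -
    have "0 \<le> (\<bar>f x\<bar> - \<bar>g x\<bar>)\<^sup>2 + (f x)\<^sup>2 + (g x)\<^sup>2" by simp
    also have "\<dots> = 2 * ((f x)\<^sup>2 + (g x)\<^sup>2 - \<bar>f x * g x\<bar>)"
      by (simp add: power2_diff abs_mult)
    finally show ?thesis by simp
  qed
  then show "AE x in \<II>. norm (f x * g x) \<le> norm ((f x)\<^sup>2 + (g x)\<^sup>2)" by simp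
qed

lemma L2_edge_add: assumes "L2_edge f" "L2_edge g" shows "L2_edge (\<lambda>x. f x + g x)"
  using assms L2_edge_mult_integrable[OF assms] unfolding L2_edge_def power2_sum
  by (auto simp: mult.assoc)

lemma L2_edge_continuous_mult:
  assumes "continuous_on {0..1} c" "L2_edge f" shows "L2_edge (\<lambda>x. c x * f x)"
proof -
  have cm: "c \<in> borel_measurable \<II>" by (rule continuous_imp_measurable_unit[OF assms(1)])
  obtain B where B: "\<And>x. x \<in> {0..1} \<Longrightarrow> \<bar>c x\<bar> \<le> B"
    using compact_imp_bounded[OF compact_continuous_image[OF assms(1) compact_Icc]]
    unfolding bounded_iff by (metis imageI real_norm_def)
  have fm: "f \<in> borel_measurable \<II>" and f2: "integrable \<II> (\<lambda>x. B\<^sup>2 * (f x)\<^sup>2)"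
    using assms(2) by (auto simp: L2_edge_def)
  have "AE x in \<II>. norm ((c x * f x)\<^sup>2) \<le> norm (B\<^sup>2 * (f x)\<^sup>2)"
  proof (rule AE_I2)
    fix x assume "x \<in> space \<II>"
    then have "(c x)\<^sup>2 \<le> B\<^sup>2" using B[of x] by (simp add: abs_le_square_iff[symmetric])
    then show "norm ((c x * f x)\<^sup>2) \<le> norm (B\<^sup>2 * (f x)\<^sup>2)"
      by (simp add: power_mult_distrib mult_right_mono)
  qed
  then show ?thesis unfolding L2_edge_def
    using cm fm by (auto intro!: Bochner_Integration.integrable_bound[OF f2])
qed

lemma L2_edge_const: "L2_edge (\<lambda>_. c)" unfolding L2_edge_def by simp

lemma L2_edge_continuous: "continuous_on {0..1} c \<Longrightarrow> L2_edge c"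
  using L2_edge_continuous_mult[OF _ L2_edge_const[of 1], of c] by simp

lemma L2_edge_cmult: "L2_edge f \<Longrightarrow> L2_edge (\<lambda>x. c * f x)"
  using L2_edge_continuous_mult[of "\<lambda>_. c"] by simp

lemma L2_edge_diff: "L2_edge f \<Longrightarrow> L2_edge g \<Longrightarrow> L2_edge (\<lambda>x. f x - g x)"
  using L2_edge_add[of f "\<lambda>x. - 1 * g x"] L2_edge_cmult[of g "-1"] by simp

lemma L2_edge_indicator:
  assumes "L2_edge f" shows "L2_edge (\<lambda>x. indicator {a..b::real} x * f x)"
proof -
  have "indicat_real {a..b} \<in> borel_measurable \<II>" by (intro borel_measurable_unit) simp
  then have "(\<lambda>x. indicat_real {a..b} x * f x) \<in> borel_measurable \<II>"
    using assms unfolding L2_edge_def by (intro borel_measurable_times) auto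
  moreover have "(\<lambda>x. (indicat_real {a..b} x * f x)\<^sup>2) = (\<lambda>x. indicator {a..b} x * (f x)\<^sup>2)"
    by (auto simp: indicator_def)
  ultimately show ?thesis
    using assms integrable_indicator_mult[of "\<lambda>x. (f x)\<^sup>2" a b] unfolding L2_edge_def by simp
qed

text \<open>
  The discriminant of the nonnegative quadratic \<open>s \<mapsto> \<integral> (s f + g)\<^sup>2\<close> is not positive.
\<close>

lemma L2_edge_Cauchy_Schwarz:
  assumes "L2_edge f" "L2_edge g"
  shows "(\<integral>x. f x * g x \<partial>\<II>)\<^sup>2 \<le> (\<integral>x. (f x)\<^sup>2 \<partial>\<II>) * (\<integral>x. (g x)\<^sup>2 \<partial>\<II>)"
proof -
  define A B C where "A = (\<integral>x. (f x)\<^sup>2 \<partial>\<II>)" and "B = (\<integral>x. f x * g x \<partial>\<II>)" and "C = (\<integral>x. (g x)\<^sup>2 \<partial>\<II>)"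
  have i: "integrable \<II> (\<lambda>x. (f x)\<^sup>2)" "integrable \<II> (\<lambda>x. (g x)\<^sup>2)" "integrable \<II> (\<lambda>x. f x * g x)"
    using assms L2_edge_mult_integrable[OF assms] by (auto simp: L2_edge_def)
  have q: "0 \<le> A * s\<^sup>2 + 2 * B * s + C" for s
  proof -
    have "0 \<le> (\<integral>x. (s * f x + g x)\<^sup>2 \<partial>\<II>)" by simp
    also have "\<dots> = (\<integral>x. s\<^sup>2 * (f x)\<^sup>2 + (2 * s) * (f x * g x) + (g x)\<^sup>2 \<partial>\<II>)"
      by (simp add: power2_eq_square algebra_simps)
    also have "\<dots> = A * s\<^sup>2 + 2 * B * s + C"
      using i by (simp add: A_def B_def C_def)
    finally show ?thesis .
  qed
  have "A \<ge> 0" unfolding A_def by simp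
  show ?thesis unfolding A_def[symmetric] B_def[symmetric] C_def[symmetric]
  proof (cases "A = 0")
    case True
    have "B = 0"
    proof (rule ccontr)
      assume "B \<noteq> 0"
      then show False using q[of "- (C + 1) / (2 * B)"] True by simp
    qed
    then show "B\<^sup>2 \<le> A * C" using True by simp
  next
    case False
    with \<open>A \<ge> 0\<close> have "A > 0" by simp
    have "A * (A * (- B / A)\<^sup>2 + 2 * B * (- B / A) + C) = A * C - B\<^sup>2"
      using False by (simp add: field_simps power2_eq_square)
    then show "B\<^sup>2 \<le> A * C"
      using mult_nonneg_nonneg[OF \<open>A \<ge> 0\<close> q[of "- B / A"]] by simp
  qed
qed

lemma L2_edge_abs: "L2_edge f \<Longrightarrow> L2_edge (\<lambda>x. \<bar>f x\<bar>)"
  by (auto simp: L2_edge_def)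

lemma L2_edge_integral_abs_le:
  assumes "L2_edge f" shows "(\<integral>x. \<bar>f x\<bar> \<partial>\<II>) \<le> sqrt (\<integral>x. (f x)\<^sup>2 \<partial>\<II>)"
  using L2_edge_Cauchy_Schwarz[OF L2_edge_abs[OF assms] L2_edge_const[of 1]]
  by (simp add: measure_unit real_le_rsqrt)

text \<open>
  Absolutely continuous functions with square integrable derivative. By the lemma \<open>weak_imp_has_L2_deriv\<close>
  below these are the continuous functions with a weak derivative, and this form has a workable calculus.
\<close>

definition has_L2_deriv :: "(real \<Rightarrow> real) \<Rightarrow> (real \<Rightarrow> real) \<Rightarrow> bool" where
  "has_L2_deriv u g \<longleftrightarrow> L2_edge g \<and> (\<forall>t\<in>{0..1}. u t = u 0 + prim g t)"

lemma has_L2_derivD: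
  assumes "has_L2_deriv u g" shows "L2_edge g" "t \<in> {0..1} \<Longrightarrow> u t = u 0 + prim g t"
  using assms unfolding has_L2_deriv_def by blast+

lemma prim_diff_eq:
  assumes "integrable \<II> g" "s \<in> {0..t}"
  shows "prim g t - prim g s = (\<integral>x. (indicator {0..t} x - indicator {0..s} x) * g x \<partial>\<II>)"
  unfolding prim_def left_diff_distrib
  by (rule Bochner_Integration.integral_diff[symmetric]) (intro integrable_indicator_mult assms)+

lemma measure_unit_Icc: "0 \<le> t \<Longrightarrow> t \<le> 1 \<Longrightarrow> (\<integral>x. indicator {0..t::real} x \<partial>\<II>) = t"
  using prim_deriv[of "\<lambda>x. x" "\<lambda>x. 1" t] by (simp add: prim_def)

lemma has_L2_deriv_Hoelder:
  assumes u: "has_L2_deriv u g" and s: "s \<in> {0..1}" and t: "t \<in> {0..1}"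
  shows "(u t - u s)\<^sup>2 \<le> \<bar>t - s\<bar> * (\<integral>x. (g x)\<^sup>2 \<partial>\<II>)"
proof -
  have *: "(u t - u s)\<^sup>2 \<le> (t - s) * (\<integral>x. (g x)\<^sup>2 \<partial>\<II>)" if st: "0 \<le> s" "s \<le> t" "t \<le> 1" for s t
  proof -
    let ?d = "\<lambda>x. indicator {0..t} x - indicator {0..s} x :: real"
    have ind: "L2_edge (\<lambda>x. indicator {0..c::real} x)" for c
      using L2_edge_indicator[OF L2_edge_const[of 1], of 0 c] by simp
    have d: "L2_edge ?d" by (intro L2_edge_diff ind)
    have g: "L2_edge g" using u by (simp add: has_L2_deriv_def)
    have "u t - u s = prim g t - prim g s"
      using has_L2_derivD(2)[OF u, of t] has_L2_derivD(2)[OF u, of s] st by simp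
    also have "\<dots> = (\<integral>x. ?d x * g x \<partial>\<II>)"
      by (rule prim_diff_eq[OF L2_edge_integrable[OF g]]) (use st in auto)
    finally have "(u t - u s)\<^sup>2 \<le> (\<integral>x. (?d x)\<^sup>2 \<partial>\<II>) * (\<integral>x. (g x)\<^sup>2 \<partial>\<II>)"
      using L2_edge_Cauchy_Schwarz[OF d g] by simp
    also have "(\<integral>x. (?d x)\<^sup>2 \<partial>\<II>) = (\<integral>x. ?d x \<partial>\<II>)"
      by (intro Bochner_Integration.integral_cong refl) (use st in \<open>auto simp: indicator_def\<close>)
    also have "\<dots> = t - s"
      using L2_edge_integrable[OF ind] measure_unit_Icc[of t] measure_unit_Icc[of s] st by simp
    finally show ?thesis .
  qed
  show ?thesis
    using *[of s t] *[of t s] s t by (cases "s \<le> t") (auto simp: power2_commute[of "u t" "u s"])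
qed

lemma has_L2_deriv_continuous:
  assumes u: "has_L2_deriv u g" shows "continuous_on {0..1} u"
  unfolding continuous_on_iff
proof (intro ballI allI impI)
  fix x e :: real assume x: "x \<in> {0..1}" and e: "0 < e"
  define C where "C = (\<integral>x. (g x)\<^sup>2 \<partial>\<II>) + 1"
  have C: "C > 0" unfolding C_def by (simp add: add_nonneg_pos)
  show "\<exists>d>0. \<forall>x'\<in>{0..1}. dist x' x < d \<longrightarrow> dist (u x') (u x) < e"
  proof (intro exI conjI ballI impI)
    show "e\<^sup>2 / C > 0" using e C by simp
    fix y assume y: "y \<in> {0..1}" and d: "dist y x < e\<^sup>2 / C"
    have "(u y - u x)\<^sup>2 \<le> \<bar>y - x\<bar> * C"
      using has_L2_deriv_Hoelder[OF u x y] unfolding C_def by (simp add: distrib_left)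
    also have "\<dots> < e\<^sup>2" using d C by (simp add: dist_real_def pos_less_divide_eq)
    finally show "dist (u y) (u x) < e"
      using e abs_le_square_iff[of e "u y - u x"] by (simp add: dist_real_def not_le[symmetric])
  qed
qed

lemma prim_linear:
  assumes "integrable \<II> f" "integrable \<II> g"
  shows "prim (\<lambda>t. a * f t + b * g t) t = a * prim f t + b * prim g t"
proof -
  have "prim (\<lambda>t. a * f t + b * g t) t =
    (\<integral>s. a * (indicator {0..t} s * f s) + b * (indicator {0..t} s * g s) \<partial>\<II>)"
    unfolding prim_def by (rule Bochner_Integration.integral_cong) (auto simp: algebra_simps)
  also have "\<dots> = a * prim f t + b * prim g t"
    unfolding prim_def using assms[THEN integrable_indicator_mult, of 0 t]
    by (subst Bochner_Integration.integral_add) auto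
  finally show ?thesis .
qed

lemma has_L2_deriv_mult:
  assumes u: "has_L2_deriv u g" and v: "has_L2_deriv v k"
  shows "has_L2_deriv (\<lambda>t. u t * v t) (\<lambda>t. g t * v t + u t * k t)"
proof -
  have g: "L2_edge g" and k: "L2_edge k" using u v by (auto simp: has_L2_deriv_def)
  note gi = L2_edge_integrable[OF g] and ki = L2_edge_integrable[OF k]
  have "L2_edge (\<lambda>t. v t * g t + u t * k t)"
    by (intro L2_edge_add L2_edge_continuous_mult has_L2_deriv_continuous[OF u]
        has_L2_deriv_continuous[OF v] g k)
  moreover have "u t * v t = u 0 * v 0 + prim (\<lambda>t. g t * v t + u t * k t) t" if t: "t \<in> {0..1}" for t
  proof -
    let ?h = "\<lambda>t. g t * prim k t + prim g t * k t"
    have hi: "integrable \<II> ?h"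
      using prim_by_parts_base(1)[OF gi ki] prim_by_parts_base(2)[OF gi ki] by simp
    have "prim (\<lambda>t. g t * v t + u t * k t) t =
      prim (\<lambda>t. 1 * (v 0 * g t + u 0 * k t) + 1 * ?h t) t"
      unfolding prim_def[of _ t]
    proof (intro Bochner_Integration.integral_cong refl)
      fix x assume "x \<in> space \<II>"
      then have "u x = u 0 + prim g x" "v x = v 0 + prim k x"
        using has_L2_derivD(2)[OF u, of x] has_L2_derivD(2)[OF v, of x] by simp_all
      then show "indicator {0..t} x * (g x * v x + u x * k x) =
        indicator {0..t} x * (1 * (v 0 * g x + u 0 * k x) + 1 * ?h x)"
        by (simp add: algebra_simps)
    qed
    also have "\<dots> = v 0 * prim g t + u 0 * prim k t + prim ?h t"
      using gi ki hi by (subst prim_linear) (auto simp: prim_linear)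
    also have "prim (\<lambda>t. g t * prim k t + prim g t * k t) t = prim g t * prim k t"
      by (rule prim_by_parts[OF gi ki t, symmetric])
    finally show ?thesis
      unfolding has_L2_derivD(2)[OF u t] has_L2_derivD(2)[OF v t] by (simp add: algebra_simps)
  qed
  moreover have "(\<lambda>t. v t * g t + u t * k t) = (\<lambda>t. g t * v t + u t * k t)" by (simp add: mult.commute)
  ultimately show ?thesis unfolding has_L2_deriv_def by metis
qed

lemma has_L2_deriv_C1:
  assumes "\<And>x. x \<in> {0..1} \<Longrightarrow> (f has_real_derivative f' x) (at x within {0..1})"
    and "continuous_on {0..1} f'"
  shows "has_L2_deriv f f'"
proof -
  have "f t = f 0 + prim f' t" if "t \<in> {0..1}" for t
    using prim_deriv[OF assms that] by simp
  then show ?thesis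
    unfolding has_L2_deriv_def using L2_edge_continuous[OF assms(2)] by blast
qed

lemma has_L2_deriv_linear:
  assumes "has_L2_deriv u g" "has_L2_deriv v k"
  shows "has_L2_deriv (\<lambda>t. a * u t + b * v t) (\<lambda>t. a * g t + b * k t)"
proof -
  have g: "L2_edge g" and k: "L2_edge k" using assms by (auto simp: has_L2_deriv_def)
  note gi = L2_edge_integrable[OF g] and ki = L2_edge_integrable[OF k]
  have "prim (\<lambda>t. a * g t + b * k t) t = a * prim g t + b * prim k t" for t
    by (rule prim_linear[OF gi ki])
  then have "a * u t + b * v t = a * u 0 + b * v 0 + prim (\<lambda>t. a * g t + b * k t) t" if "t \<in> {0..1}" for t
    unfolding has_L2_derivD(2)[OF assms(1) that] has_L2_derivD(2)[OF assms(2) that]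
    by (simp add: algebra_simps)
  then show ?thesis unfolding has_L2_deriv_def
    using L2_edge_add[OF L2_edge_cmult[OF g] L2_edge_cmult[OF k]] by blast
qed

lemma has_L2_deriv_scale: "has_L2_deriv u g \<Longrightarrow> has_L2_deriv (\<lambda>t. a * u t) (\<lambda>t. a * g t)"
  using has_L2_deriv_linear[of u g u g a 0] by simp

lemma has_L2_deriv_integral: "has_L2_deriv u g \<Longrightarrow> (\<integral>x. g x \<partial>\<II>) = u 1 - u 0"
  using has_L2_derivD(2)[of u g 1] by (simp add: prim_1)

lemma has_L2_deriv_cong:
  assumes "\<And>t. t \<in> {0..1} \<Longrightarrow> u t = v t" shows "has_L2_deriv u g \<longleftrightarrow> has_L2_deriv v g"
  unfolding has_L2_deriv_def using assms assms[of 0] by simp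

lemma has_L2_deriv_unique:
  assumes "has_L2_deriv u g" "has_L2_deriv u k" shows "AE x in \<II>. g x = k x"
proof -
  have "has_L2_deriv (\<lambda>t. 0) (\<lambda>t. g t - k t)"
    using has_L2_deriv_linear[OF assms, of 1 "-1"] by simp
  then have "AE x in \<II>. g x - k x = 0"
    unfolding has_L2_deriv_def by (intro prim_zero_AE) (simp_all add: L2_edge_integrable)
  then show ?thesis by simp
qed

lemma has_L2_deriv_square_unique:
  assumes "has_L2_deriv u g" "has_L2_deriv u k" shows "(\<integral>x. (g x)\<^sup>2 \<partial>\<II>) = (\<integral>x. (k x)\<^sup>2 \<partial>\<II>)"
proof (rule integral_cong_AE)
  show "AE x in \<II>. (g x)\<^sup>2 = (k x)\<^sup>2"
    using has_L2_deriv_unique[OF assms] by eventually_elim simp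
qed (use assms[THEN has_L2_derivD(1)] in \<open>auto simp: L2_edge_def\<close>)

section \<open>Weak derivatives on an edge\<close>

text \<open>
  Integration by parts; the boundary terms vanish with the test function.
\<close>

lemma has_L2_deriv_imp_weak:
  assumes u: "has_L2_deriv u g" shows "has_weak_deriv u g"
  unfolding has_weak_deriv_def
proof (intro conjI allI impI)
  show g: "L2_edge g" by (rule has_L2_derivD[OF u])
  fix \<phi> \<phi>' assume tf: "test_function \<phi> \<phi>'"
  then have d: "(\<phi> has_real_derivative \<phi>' x) (at x)" and c: "continuous_on UNIV \<phi>'" for x
    unfolding test_function_def by auto
  have \<phi>: "has_L2_deriv \<phi> \<phi>'"
    by (rule has_L2_deriv_C1) (use d c in \<open>auto intro: DERIV_subset continuous_on_subset\<close>)
  have end0: "\<phi> 0 = 0" "\<phi> 1 = 0" using tf unfolding test_function_def by force+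
  have "integrable \<II> (\<lambda>t. g t * \<phi> t)" "integrable \<II> (\<lambda>t. u t * \<phi>' t)"
    by (rule L2_edge_mult_integrable; use g has_L2_deriv_continuous[OF u] has_L2_deriv_continuous[OF \<phi>]
        has_L2_derivD(1)[OF \<phi>] L2_edge_continuous in blast)+
  then show "(\<integral>x. u x * \<phi>' x \<partial>\<II>) = - (\<integral>x. g x * \<phi> x \<partial>\<II>)"
    using has_L2_deriv_integral[OF has_L2_deriv_mult[OF u \<phi>]] end0 by simp
qed

lemma integral_continuous_zero:
  fixes f :: "real \<Rightarrow> real"
  assumes "continuous_on {0..1} f" "\<And>x. x \<in> {0..1} \<Longrightarrow> 0 \<le> f x" "integral\<^sup>L \<II> f = 0" "x \<in> {0..1}"
  shows "f x = 0"
proof -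
  have "integral {0..1} f = 0"
    using lebesgue_integral_eq_integral[OF continuous_imp_integrable_unit[OF assms(1)]] assms(3) by simp
  then show ?thesis using integral_eq_0_iff[of 0 1 f] assms by auto
qed

text \<open>
  The lemma of du Bois-Reymond. Instead of mollifying, a single test function is used: the primitive of
  \<open>\<eta> (v - c)\<close>, where the hat \<open>\<eta>\<close> is positive exactly on \<open>(a, b)\<close> and \<open>c\<close> is the \<open>\<eta>\<close>-mean of \<open>v\<close>. The choice of
  \<open>c\<close> makes the primitive vanish beyond \<open>b\<close>, and testing with it gives \<open>\<integral> \<eta> (v - c)\<^sup>2 = 0\<close>.
\<close>

lemma test_integral_zero_imp_const:
  fixes v :: "real \<Rightarrow> real"
  assumes cont: "continuous_on UNIV v" and ab: "0 < a" "a < b" "b < 1"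
    and orth: "\<And>\<phi> \<phi>'. test_function \<phi> \<phi>' \<Longrightarrow> (\<integral>x. v x * \<phi>' x \<partial>\<II>) = 0"
  shows "\<exists>c. \<forall>x\<in>{a<..<b}. v x = c"
proof -
  define \<eta> :: "real \<Rightarrow> real" where "\<eta> = (\<lambda>t. max 0 ((t - a) * (b - t)))"
  have \<eta>c: "continuous_on A \<eta>" for A unfolding \<eta>_def by (intro continuous_intros)
  have \<eta>_pos: "\<eta> t > 0" if "t \<in> {a<..<b}" for t using that unfolding \<eta>_def by (auto simp: less_max_iff_disj)
  have \<eta>0: "\<eta> t \<ge> 0" for t unfolding \<eta>_def by simp
  have \<eta>_out: "\<eta> t = 0" if "t \<le> a \<or> b \<le> t" for t
  proof -
    have "(t - a) * (b - t) \<le> 0" using that ab by (auto simp: mult_le_0_iff)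
    then show ?thesis unfolding \<eta>_def by simp
  qed
  have vc: "continuous_on A v" for A using cont continuous_on_subset by blast
  have "(\<integral>x. \<eta> x \<partial>\<II>) \<noteq> 0"
  proof
    assume "(\<integral>x. \<eta> x \<partial>\<II>) = 0"
    from integral_continuous_zero[OF \<eta>c \<eta>0 this, of "(a + b) / 2"] \<eta>_pos[of "(a + b) / 2"] ab
    show False by simp
  qed
  define c where "c = (\<integral>x. \<eta> x * v x \<partial>\<II>) / (\<integral>x. \<eta> x \<partial>\<II>)"
  define \<psi> where "\<psi> = (\<lambda>t. \<eta> t * (v t - c))"
  have \<psi>c: "continuous_on A \<psi>" for A unfolding \<psi>_def by (intro continuous_intros \<eta>c vc)
  have i\<eta>v: "integrable \<II> (\<lambda>x. \<eta> x * v x)" and i\<eta>: "integrable \<II> \<eta>"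
    by (intro continuous_imp_integrable_unit continuous_intros \<eta>c vc)+
  have \<psi>0: "(\<integral>x. \<psi> x \<partial>\<II>) = 0"
  proof -
    have "(\<integral>x. \<psi> x \<partial>\<II>) = (\<integral>x. \<eta> x * v x \<partial>\<II>) - (\<integral>x. c * \<eta> x \<partial>\<II>)"
      unfolding \<psi>_def using i\<eta>v i\<eta>
      by (subst Bochner_Integration.integral_diff[symmetric]) (auto simp: algebra_simps)
    then show ?thesis using \<open>(\<integral>x. \<eta> x \<partial>\<II>) \<noteq> 0\<close> by (simp add: c_def)
  qed
  have "isCont \<psi> x" for x using \<psi>c[of UNIV] by (simp add: continuous_on_eq_continuous_at)
  then obtain F where F: "\<And>x. (F has_real_derivative \<psi> x) (at x)"
    using einterval_antiderivative[of "-\<infinity>" \<infinity> \<psi>] by (auto simp: has_real_derivative_iff_has_vector_derivative)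
  have const: "\<exists>d. \<forall>x\<in>s. F x = d" if "convex s" "\<And>x. x \<in> s \<Longrightarrow> x \<le> a \<or> b \<le> x" for s
  proof (rule has_field_derivative_zero_constant[OF that(1)])
    fix x assume "x \<in> s"
    then have "\<psi> x = 0" using that(2) \<eta>_out unfolding \<psi>_def by simp
    then show "(F has_real_derivative 0) (at x within s)"
      using DERIV_subset[OF F[of x] subset_UNIV] by simp
  qed
  have F01: "F 1 = F 0"
  proof -
    have "prim \<psi> 1 = F 1 - F 0"
      by (rule prim_deriv[OF DERIV_subset[OF F subset_UNIV] \<psi>c]) simp
    then show ?thesis using \<psi>0 by (simp add: prim_1)
  qed
  have Fl: "F x = F 0" if "x \<le> a" for x using const[of "{..a}"] that ab by (metis atMost_iff convex_real_interval(2) less_imp_le)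
  have Fr: "F x = F 0" if "b \<le> x" for x using const[of "{b..}"] that ab F01 by (metis atLeast_iff convex_real_interval(1) less_imp_le)
  define \<phi> where "\<phi> = (\<lambda>t. F t - F 0)"
  have tf: "test_function \<phi> \<psi>"
    unfolding test_function_def
  proof (intro conjI allI exI impI)
    show "(\<phi> has_real_derivative \<psi> x) (at x)" for x
      unfolding \<phi>_def using F[of x] by (auto intro!: derivative_eq_intros)
    show "\<phi> x = 0" if "x \<notin> {a..b}" for x
      using that Fl[of x] Fr[of x] unfolding \<phi>_def by (cases "x \<le> a") auto
  qed (use ab \<psi>c in auto)
  have "(\<integral>x. \<eta> x * (v x - c)\<^sup>2 \<partial>\<II>) = (\<integral>x. v x * \<psi> x \<partial>\<II>) - (\<integral>x. c * \<psi> x \<partial>\<II>)"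
  proof -
    have "integrable \<II> (\<lambda>x. v x * \<psi> x)" "integrable \<II> (\<lambda>x. c * \<psi> x)"
      by (intro continuous_imp_integrable_unit continuous_intros \<psi>c vc)+
    then show ?thesis
      by (subst Bochner_Integration.integral_diff[symmetric])
         (auto simp: \<psi>_def algebra_simps power2_eq_square)
  qed
  also have "\<dots> = 0" using orth[OF tf] \<psi>0 by simp
  finally have z: "(\<integral>x. \<eta> x * (v x - c)\<^sup>2 \<partial>\<II>) = 0" .
  have "v x = c" if "x \<in> {a<..<b}" for x
  proof -
    have "\<eta> x * (v x - c)\<^sup>2 = 0"
      by (rule integral_continuous_zero[OF _ _ z]) (use that ab \<eta>0 in \<open>auto intro!: continuous_intros \<eta>c vc\<close>)
    then show ?thesis using \<eta>_pos[OF that] by auto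
  qed
  then show ?thesis by blast
qed

text \<open>
  The difference of \<open>u\<close> and the primitive of its weak derivative is continuous and has weak derivative zero.
\<close>

lemma weak_imp_has_L2_deriv:
  assumes u: "continuous_on {0..1} u" and w: "has_weak_deriv u g"
  shows "has_L2_deriv u g"
proof -
  have g: "L2_edge g" using w by (simp add: has_weak_deriv_def)
  have pg: "has_L2_deriv (prim g) g" unfolding has_L2_deriv_def using g by simp
  have pc: "continuous_on {0..1} (prim g)" by (rule has_L2_deriv_continuous[OF pg])
  define v where "v = (\<lambda>t. u t - prim g t)"
  have vc: "continuous_on {0..1} v" unfolding v_def by (intro continuous_intros u pc)
  \<comment> \<open>continuous extension to the whole line\<close>
  define V where "V = (\<lambda>t. v (max 0 (min 1 t)))"
  have Vc: "continuous_on UNIV V" unfolding V_def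
    by (intro continuous_on_compose2[OF vc] continuous_intros) auto
  have orth: "(\<integral>x. V x * \<phi>' x \<partial>\<II>) = 0" if tf: "test_function \<phi> \<phi>'" for \<phi> \<phi>'
  proof -
    have c: "continuous_on {0..1} \<phi>'" using tf continuous_on_subset unfolding test_function_def by blast
    have "(\<integral>x. V x * \<phi>' x \<partial>\<II>) = (\<integral>x. u x * \<phi>' x - prim g x * \<phi>' x \<partial>\<II>)"
      by (rule Bochner_Integration.integral_cong) (auto simp: V_def v_def algebra_simps)
    also have "\<dots> = (\<integral>x. u x * \<phi>' x \<partial>\<II>) - (\<integral>x. prim g x * \<phi>' x \<partial>\<II>)"
      by (intro Bochner_Integration.integral_diff continuous_imp_integrable_unit continuous_intros u c pc)
    also have "\<dots> = 0"
      using w has_L2_deriv_imp_weak[OF pg] tf unfolding has_weak_deriv_def by simp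
    finally show ?thesis .
  qed
  have V_eq: "V t = V (1 / 2)" if "t \<in> {0<..<1}" for t
  proof -
    define a b where "a = min t (1 / 2) / 2" and "b = (max t (1 / 2) + 1) / 2"
    have ab: "0 < a" "a < b" "b < 1" "t \<in> {a<..<b}" "1 / 2 \<in> {a<..<b}"
      using that unfolding a_def b_def by (auto simp: min_def max_def)
    obtain c where "\<forall>x\<in>{a<..<b}. V x = c"
      using test_integral_zero_imp_const[OF Vc ab(1-3)] orth by blast
    then show ?thesis using ab(4,5) by metis
  qed
  have vV: "v t = V (1 / 2)" if "t \<in> {0..1}" for t
  proof (rule continuous_constant_on_closure[of "{0<..<1}" v "V (1 / 2)" t])
    show "continuous_on (closure {0<..<1}) v" using vc by simp
    show "v x = V (1 / 2)" if "x \<in> {0<..<1}" for x using V_eq[OF that] that by (simp add: V_def)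
  qed (use that in simp)
  have "u t = u 0 + prim g t" if "t \<in> {0..1}" for t
    using vV[of 0] vV[OF that] unfolding v_def by simp
  then show ?thesis unfolding has_L2_deriv_def using g by blast
qed

definition sobolev :: "(real \<Rightarrow> real) \<Rightarrow> bool" where "sobolev u \<longleftrightarrow> (\<exists>g. has_L2_deriv u g)"

lemma sobolev_continuous: "sobolev u \<Longrightarrow> continuous_on {0..1} u"
  unfolding sobolev_def using has_L2_deriv_continuous by blast

lemma sobolev_iff: "sobolev u \<longleftrightarrow> continuous_on {0..1} u \<and> H1_edge u"
  unfolding H1_edge_def
  using weak_imp_has_L2_deriv has_L2_deriv_imp_weak L2_edge_continuous sobolev_continuous
  unfolding sobolev_def by blast

lemma sobolev_weak_deriv: "sobolev u \<Longrightarrow> has_L2_deriv u (weak_deriv u)"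
  unfolding weak_deriv_def
  by (metis sobolev_continuous sobolev_def has_L2_deriv_imp_weak weak_imp_has_L2_deriv someI_ex)

definition edge_dirichlet :: "(real \<Rightarrow> real) \<Rightarrow> real" where "edge_dirichlet u = (\<integral>x. (weak_deriv u x)\<^sup>2 \<partial>\<II>)"
definition edge_mass :: "(real \<Rightarrow> real) \<Rightarrow> real" where "edge_mass u = (\<integral>x. (u x)\<^sup>2 \<partial>\<II>)"
definition edge_power :: "real \<Rightarrow> (real \<Rightarrow> real) \<Rightarrow> real" where "edge_power p u = (\<integral>x. \<bar>u x\<bar> powr p \<partial>\<II>)"

lemma edge_dirichlet_eq: "has_L2_deriv u g \<Longrightarrow> edge_dirichlet u = (\<integral>x. (g x)\<^sup>2 \<partial>\<II>)"
  unfolding edge_dirichlet_def by (rule has_L2_deriv_square_unique[OF sobolev_weak_deriv]) (auto simp: sobolev_def)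

lemma edge_dirichlet_nonneg: "edge_dirichlet u \<ge> 0" and edge_mass_nonneg: "edge_mass u \<ge> 0" and edge_power_nonneg: "edge_power p u \<ge> 0"
  unfolding edge_dirichlet_def edge_mass_def edge_power_def by simp_all

lemma sobolev_cong:
  assumes "\<And>t. t \<in> {0..1} \<Longrightarrow> u t = v t"
  shows "sobolev u = sobolev v" "sobolev v \<Longrightarrow> edge_dirichlet u = edge_dirichlet v" "edge_mass u = edge_mass v" "edge_power p u = edge_power p v"
proof -
  have c: "has_L2_deriv u g = has_L2_deriv v g" for g by (rule has_L2_deriv_cong[OF assms])
  then show "sobolev u = sobolev v" by (simp add: sobolev_def)
  show "edge_dirichlet u = edge_dirichlet v" if "sobolev v" using that c edge_dirichlet_eq unfolding sobolev_def by metis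
  show "edge_mass u = edge_mass v" unfolding edge_mass_def by (rule Bochner_Integration.integral_cong) (use assms in auto)
  show "edge_power p u = edge_power p v" unfolding edge_power_def by (rule Bochner_Integration.integral_cong) (use assms in auto)
qed

lemma sobolev_scale:
  assumes "sobolev u"
  shows "sobolev (\<lambda>t. a * u t)" "edge_dirichlet (\<lambda>t. a * u t) = a\<^sup>2 * edge_dirichlet u" "edge_mass (\<lambda>t. a * u t) = a\<^sup>2 * edge_mass u"
    "edge_power p (\<lambda>t. a * u t) = \<bar>a\<bar> powr p * edge_power p u"
proof -
  from assms obtain g where g: "has_L2_deriv u g" unfolding sobolev_def by blast
  from has_L2_deriv_scale[OF g] show "sobolev (\<lambda>t. a * u t)" unfolding sobolev_def by blast
  show "edge_dirichlet (\<lambda>t. a * u t) = a\<^sup>2 * edge_dirichlet u"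
    unfolding edge_dirichlet_eq[OF g] edge_dirichlet_eq[OF has_L2_deriv_scale[OF g]] by (simp add: power_mult_distrib)
qed (simp_all add: edge_mass_def edge_power_def power_mult_distrib abs_mult powr_mult)

lemma edge_power_integrable:
  assumes "sobolev u" "p > 0" shows "integrable \<II> (\<lambda>x. \<bar>u x\<bar> powr p)"
  using assms by (intro continuous_imp_integrable_unit continuous_on_powr' continuous_intros sobolev_continuous) auto

lemma edge_mass_integrable:
  assumes "sobolev u" shows "integrable \<II> (\<lambda>x. (u x)\<^sup>2)"
  using assms by (intro continuous_imp_integrable_unit continuous_intros sobolev_continuous)

text \<open>
  Interpolation: one takes out the power \<open>p - 2\<close> of the supremum.
\<close>

lemma edge_power_le:
  assumes u: "sobolev u" and p: "2 < p" and S: "\<And>t. t \<in> {0..1} \<Longrightarrow> \<bar>u t\<bar> \<le> S"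
  shows "edge_power p u \<le> S powr (p - 2) * edge_mass u"
proof -
  have "edge_power p u \<le> (\<integral>x. S powr (p - 2) * (u x)\<^sup>2 \<partial>\<II>)"
    unfolding edge_power_def
  proof (rule integral_mono)
    fix x assume "x \<in> space \<II>"
    then have "\<bar>u x\<bar> \<le> S" using S by simp
    have "\<bar>u x\<bar> powr p = \<bar>u x\<bar> powr (p - 2) * (u x)\<^sup>2"
      by (cases "u x = 0") (auto simp: powr_diff powr_numeral)
    also have "\<dots> \<le> S powr (p - 2) * (u x)\<^sup>2"
      using \<open>\<bar>u x\<bar> \<le> S\<close> p by (intro mult_right_mono powr_mono2) auto
    finally show "\<bar>u x\<bar> powr p \<le> S powr (p - 2) * (u x)\<^sup>2" .
  qed (use edge_power_integrable[OF u] edge_mass_integrable[OF u] p in auto)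
  then show ?thesis by (simp add: edge_mass_def)
qed

text \<open>
  The square has derivative \<open>2 u u'\<close>, so its oscillation is at most twice the geometric mean of mass and
  Dirichlet integral; one compares with the mean value of \<open>u\<^sup>2\<close>.
\<close>

lemma sobolev_square_le:
  assumes u: "sobolev u" and t: "t \<in> {0..1}"
  shows "(u t)\<^sup>2 \<le> edge_mass u + 2 * sqrt (edge_mass u * edge_dirichlet u)"
proof -
  define g where "g = weak_deriv u"
  have g: "has_L2_deriv u g" unfolding g_def by (rule sobolev_weak_deriv[OF u])
  have gL: "L2_edge g" by (rule has_L2_derivD[OF g])
  have uL: "L2_edge u" by (rule L2_edge_continuous[OF sobolev_continuous[OF u]])
  have d: "has_L2_deriv (\<lambda>t. u t * u t) (\<lambda>t. g t * u t + u t * g t)" by (rule has_L2_deriv_mult[OF g g])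
  have i: "integrable \<II> (\<lambda>x. g x * u x + u x * g x)"
    by (rule L2_edge_integrable[OF has_L2_derivD(1)[OF d]])
  define K where "K = (\<integral>x. \<bar>g x * u x + u x * g x\<bar> \<partial>\<II>)"
  have K: "K \<le> 2 * sqrt (edge_mass u * edge_dirichlet u)"
  proof -
    have "K = 2 * (\<integral>x. \<bar>u x\<bar> * \<bar>g x\<bar> \<partial>\<II>)"
      unfolding K_def by (subst Bochner_Integration.integral_mult_right_zero[symmetric])
        (rule Bochner_Integration.integral_cong, auto simp: abs_mult mult.commute)
    also have "(\<integral>x. \<bar>u x\<bar> * \<bar>g x\<bar> \<partial>\<II>) \<le> sqrt (edge_mass u * edge_dirichlet u)"
      using L2_edge_Cauchy_Schwarz[OF L2_edge_abs[OF uL] L2_edge_abs[OF gL]]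
      unfolding edge_mass_def edge_dirichlet_def g_def[symmetric] by (intro real_le_rsqrt) simp
    finally show ?thesis by simp
  qed
  have le: "(u t)\<^sup>2 \<le> (u s)\<^sup>2 + K" if s: "s \<in> {0..1}" for s
  proof -
    let ?h = "\<lambda>x. g x * u x + u x * g x"
    have *: "\<bar>prim ?h b - prim ?h a\<bar> \<le> K" if "a \<in> {0..b}" for a b
    proof -
      have "\<bar>prim ?h b - prim ?h a\<bar> = \<bar>\<integral>x. (indicator {0..b} x - indicator {0..a} x) * ?h x \<partial>\<II>\<bar>"
        by (simp only: prim_diff_eq[OF i that])
      also have "\<dots> \<le> (\<integral>x. \<bar>(indicator {0..b} x - indicator {0..a} x) * ?h x\<bar> \<partial>\<II>)"
        by (rule integral_abs_bound)
      also have "\<dots> \<le> K" unfolding K_def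
      proof (rule integral_mono)
        have "integrable \<II> (\<lambda>x. indicator {0..b} x * ?h x - indicator {0..a} x * ?h x)"
          by (intro Bochner_Integration.integrable_diff integrable_indicator_mult i)
        then show "integrable \<II> (\<lambda>x. \<bar>(indicator {0..b} x - indicator {0..a} x) * ?h x\<bar>)"
          unfolding left_diff_distrib[symmetric] by (rule integrable_abs)
      qed (use i in \<open>auto simp: indicator_def\<close>)
      finally show ?thesis .
    qed
    have "\<bar>prim ?h t - prim ?h s\<bar> \<le> K"
      using *[of s t] *[of t s] s t by (cases "s \<le> t") (auto simp: abs_minus_commute)
    then show ?thesis
      using has_L2_derivD(2)[OF d t] has_L2_derivD(2)[OF d s] by (simp add: power2_eq_square)
  qed
  have "(u t)\<^sup>2 = (\<integral>s. (u t)\<^sup>2 \<partial>\<II>)" by (simp add: measure_unit)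
  also have "\<dots> \<le> (\<integral>s. (u s)\<^sup>2 + K \<partial>\<II>)"
    by (rule integral_mono) (use le edge_mass_integrable[OF u] in auto)
  also have "\<dots> = edge_mass u + K" using edge_mass_integrable[OF u] by (simp add: edge_mass_def measure_unit)
  finally show ?thesis using K by simp
qed

lemma unit_reflect:
  fixes f :: "real \<Rightarrow> real"
  assumes f: "f \<in> borel_measurable \<II>"
  shows "(\<lambda>x. f (1 - x)) \<in> borel_measurable \<II>" "(\<integral>x. f (1 - x) \<partial>\<II>) = (\<integral>x. f x \<partial>\<II>)"
    "integrable \<II> f \<Longrightarrow> integrable \<II> (\<lambda>x. f (1 - x))"
proof -
  let ?F = "\<lambda>x. indicator {0..1} x *\<^sub>R f x"
  have F: "?F \<in> borel_measurable lebesgue"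
    using f borel_measurable_restrict_space_iff[of "{0..1}" lebesgue f] by simp
  have T: "(\<lambda>x. 1 - x :: real) \<in> lebesgue \<rightarrow>\<^sub>M lebesgue"
    using lebesgue_affine_measurable[of "\<lambda>_::real. -1" 1] by simp
  have D: "distr lebesgue lebesgue (\<lambda>x. 1 - x :: real) = lebesgue"
    using lebesgue_real_affine[of "-1" 1] by (simp add: density_1)
  have r: "indicator {0..1} x *\<^sub>R f (1 - x) = ?F (1 - x)" for x by (auto simp: indicator_def)
  have "(\<lambda>x. ?F (1 - x)) \<in> borel_measurable lebesgue"
    using measurable_compose[OF T F] by simp
  then show "(\<lambda>x. f (1 - x)) \<in> borel_measurable \<II>"
    unfolding r[symmetric] using borel_measurable_restrict_space_iff[of "{0..1}" lebesgue "\<lambda>x. f (1 - x)"] by simp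
  have "(\<integral>x. ?F (1 - x) \<partial>lebesgue) = (\<integral>x. ?F x \<partial>distr lebesgue lebesgue (\<lambda>x. 1 - x))"
    by (rule integral_distr[OF T F, symmetric])
  then show "(\<integral>x. f (1 - x) \<partial>\<II>) = (\<integral>x. f x \<partial>\<II>)"
    unfolding D r[symmetric] by (simp add: integral_restrict_space)
  show "integrable \<II> (\<lambda>x. f (1 - x))" if "integrable \<II> f"
  proof -
    have "integrable lebesgue ?F" using that by (simp add: integrable_restrict_space)
    then have "integrable lebesgue (\<lambda>x. ?F (1 - x))"
      using integrable_distr_eq[OF T F] unfolding D by simp
    then show ?thesis unfolding r[symmetric] by (simp add: integrable_restrict_space)
  qed
qed

lemma has_L2_deriv_reflect:
  assumes u: "has_L2_deriv u g"
  shows "has_L2_deriv (\<lambda>t. u (1 - t)) (\<lambda>t. - g (1 - t))"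
proof -
  have g: "L2_edge g" by (rule has_L2_derivD[OF u])
  have gm: "g \<in> borel_measurable \<II>" using g by (simp add: L2_edge_def)
  have gi: "integrable \<II> g" by (rule L2_edge_integrable[OF g])
  have "L2_edge (\<lambda>t. g (1 - t))"
    using g unit_reflect(1)[OF gm] unit_reflect(3)[of "\<lambda>x. (g x)\<^sup>2"] by (auto simp: L2_edge_def)
  then have L: "L2_edge (\<lambda>t. - g (1 - t))" using L2_edge_cmult[of "\<lambda>t. g (1 - t)" "-1"] by simp
  have "u (1 - t) = u (1 - 0) + prim (\<lambda>t. - g (1 - t)) t" if t: "t \<in> {0..1}" for t
  proof -
    have "prim (\<lambda>t. - g (1 - t)) t = (\<integral>s. (\<lambda>s. - (indicator {0..t} (1 - s) * g s)) (1 - s) \<partial>\<II>)"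
      unfolding prim_def by (rule Bochner_Integration.integral_cong) auto
    also have "\<dots> = (\<integral>s. - (indicator {0..t} (1 - s) * g s) \<partial>\<II>)"
    proof (rule unit_reflect(2))
      have "(\<lambda>s. indicat_real {1 - t..1} s * g s) \<in> borel_measurable \<II>"
        using integrable_indicator_mult[OF gi] by blast
      moreover have "indicat_real {1 - t..1} s = indicator {0..t} (1 - s)" for s by (auto simp: indicator_def)
      ultimately show "(\<lambda>s. - (indicator {0..t} (1 - s) * g s)) \<in> borel_measurable \<II>" by simp
    qed
    also have "\<dots> = (\<integral>s. - ((indicator {0..1} s - indicator {0..1 - t} s) * g s) \<partial>\<II>)"
    proof (rule integral_cong_AE)
      have "AE s in \<II>. s \<in> {0..1}" by (rule AE_I2) simp
      with null_unit[of "1 - t"]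
      show "AE s in \<II>. - (indicator {0..t} (1 - s) * g s) = - ((indicator {0..1} s - indicator {0..1 - t} s) * g s)"
        by eventually_elim (use t in \<open>auto simp: indicator_def\<close>)
      have "(\<lambda>s. indicat_real {1 - t..1} s * g s) \<in> borel_measurable \<II>"
        using integrable_indicator_mult[OF gi] by blast
      moreover have "indicat_real {1 - t..1} s = indicator {0..t} (1 - s)" for s by (auto simp: indicator_def)
      ultimately show "(\<lambda>s. - (indicator {0..t} (1 - s) * g s)) \<in> borel_measurable \<II>" by simp
      have "(\<lambda>s. indicator {0..1 - t} s * g s - indicator {0..1} s * g s) \<in> borel_measurable \<II>"
        using integrable_indicator_mult[OF gi] by (intro borel_measurable_diff) blast+
      then show "(\<lambda>s. - ((indicator {0..1} s - indicator {0..1 - t} s) * g s)) \<in> borel_measurable \<II>"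
        by (simp add: left_diff_distrib)
    qed
    also have "\<dots> = - (prim g 1 - prim g (1 - t))"
      using t by (subst prim_diff_eq[OF gi]) auto
    finally show ?thesis
      using has_L2_derivD(2)[OF u, of 1] has_L2_derivD(2)[OF u, of "1 - t"] t by simp
  qed
  then show ?thesis unfolding has_L2_deriv_def using L by blast
qed

lemma sobolev_reflect:
  assumes u: "sobolev u"
  shows "sobolev (\<lambda>t. u (1 - t))" "edge_dirichlet (\<lambda>t. u (1 - t)) = edge_dirichlet u" "edge_mass (\<lambda>t. u (1 - t)) = edge_mass u"
    "0 < p \<Longrightarrow> edge_power p (\<lambda>t. u (1 - t)) = edge_power p u"
proof -
  obtain g where g: "has_L2_deriv u g" using u unfolding sobolev_def by blast
  from has_L2_deriv_reflect[OF g] show "sobolev (\<lambda>t. u (1 - t))" unfolding sobolev_def by blast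
  have "(\<lambda>x. (g x)\<^sup>2) \<in> borel_measurable \<II>" using has_L2_derivD(1)[OF g] by (auto simp: L2_edge_def)
  from unit_reflect(2)[OF this] show "edge_dirichlet (\<lambda>t. u (1 - t)) = edge_dirichlet u"
    unfolding edge_dirichlet_eq[OF g] edge_dirichlet_eq[OF has_L2_deriv_reflect[OF g]] by simp
  show "edge_mass (\<lambda>t. u (1 - t)) = edge_mass u"
    unfolding edge_mass_def by (rule unit_reflect(2)) (use edge_mass_integrable[OF u] in blast)
  show "edge_power p (\<lambda>t. u (1 - t)) = edge_power p u" if "0 < p"
    unfolding edge_power_def by (rule unit_reflect(2)[of "\<lambda>x. \<bar>u x\<bar> powr p"]) (use edge_power_integrable[OF u that] in blast)
qed

section \<open>Concentration and lower semicontinuity on an edge\<close>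

lemma sobolev_square_le_H1:
  assumes "sobolev u" "t \<in> {0..1}" shows "(u t)\<^sup>2 \<le> 2 * (edge_mass u + edge_dirichlet u)"
proof -
  have "sqrt (edge_mass u * edge_dirichlet u) \<le> (edge_mass u + edge_dirichlet u) / 2"
    using arith_geo_mean_sqrt[of "edge_mass u" "edge_dirichlet u"] edge_mass_nonneg edge_dirichlet_nonneg by simp
  then show ?thesis using sobolev_square_le[OF assms] edge_dirichlet_nonneg[of u] by simp
qed

text \<open>
  By the Hoelder estimate a function that reaches \<open>c\<close> stays above \<open>c / 2\<close> on an interval whose length depends
  on \<open>c\<close> and \<open>B\<close> only.
\<close>

lemma sobolev_not_concentrated:
  assumes c: "0 < c" and B: "0 < B" and p: "0 < p"
  shows "\<exists>\<delta>>0. \<forall>u. sobolev u \<and> edge_dirichlet u \<le> B \<and> (\<exists>t\<in>{0..1}. c \<le> \<bar>u t\<bar>) \<longrightarrow> \<delta> \<le> edge_power p u \<and> \<delta> \<le> edge_mass u"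
proof -
  define l where "l = min (1 / 2) (c\<^sup>2 / (4 * B))"
  have l: "0 < l" "l \<le> 1 / 2" "l * B \<le> c\<^sup>2 / 4"
  proof -
    show "0 < l" "l \<le> 1 / 2" using c B by (auto simp: l_def)
    have "l * B \<le> c\<^sup>2 / (4 * B) * B" using B by (intro mult_right_mono) (auto simp: l_def)
    then show "l * B \<le> c\<^sup>2 / 4" using B by simp
  qed
  have main: "(c / 2) powr p * l \<le> edge_power p u \<and> (c / 2)\<^sup>2 * l \<le> edge_mass u"
    if u: "sobolev u" and D: "edge_dirichlet u \<le> B" and x: "x \<in> {0..1}" "c \<le> \<bar>u x\<bar>" for u x
  proof -
    define a where "a = (if x \<le> 1 / 2 then x else x - l)"
    have a: "0 \<le> a" "a + l \<le> 1" "x \<in> {a..a + l}" using l x by (auto simp: a_def)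
    have low: "c / 2 \<le> \<bar>u t\<bar>" if t: "t \<in> {a..a + l}" for t
    proof -
      have t01: "t \<in> {0..1}" using t a by auto
      have "(u t - u x)\<^sup>2 \<le> \<bar>t - x\<bar> * edge_dirichlet u"
        using has_L2_deriv_Hoelder[OF sobolev_weak_deriv[OF u] x(1) t01] by (simp add: edge_dirichlet_def)
      also have "\<dots> \<le> l * B" using t a D B l edge_dirichlet_nonneg by (intro mult_mono) auto
      also have "\<dots> \<le> (c / 2)\<^sup>2" using l by (simp add: power2_eq_square)
      finally have "\<bar>u t - u x\<bar> \<le> c / 2" using c abs_le_square_iff[of "u t - u x" "c / 2"] by simp
      then show ?thesis using x by linarith
    qed
    have J: "(\<integral>x. indicator {a..a + l} x \<partial>\<II>) = l"
      using a l by (simp add: measure_restrict_space Int_absorb2)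
    have ind: "integrable \<II> (\<lambda>x. indicat_real {a..a + l} x)"
      using integrable_indicator_mult[OF integrable_unit_const[of 1], of a "a + l"] by simp
    have "(\<integral>x. (c / 2) powr p * indicator {a..a + l} x \<partial>\<II>) \<le> edge_power p u"
      unfolding edge_power_def
    proof (rule integral_mono)
      fix t show "(c / 2) powr p * indicator {a..a + l} t \<le> \<bar>u t\<bar> powr p"
        using low[of t] c p by (cases "t \<in> {a..a + l}") (auto intro: powr_mono2)
    qed (use ind edge_power_integrable[OF u p] in auto)
    moreover have "(\<integral>x. (c / 2)\<^sup>2 * indicator {a..a + l} x \<partial>\<II>) \<le> edge_mass u"
      unfolding edge_mass_def
    proof (rule integral_mono)
      fix t show "(c / 2)\<^sup>2 * indicator {a..a + l} t \<le> (u t)\<^sup>2"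
        using low[of t] c abs_le_square_iff[of "c / 2" "u t"] by (cases "t \<in> {a..a + l}") auto
    qed (use ind edge_mass_integrable[OF u] in auto)
    ultimately show ?thesis using J by simp
  qed
  define \<delta> where "\<delta> = min ((c / 2) powr p * l) ((c / 2)\<^sup>2 * l)"
  have "\<delta> > 0" using c l by (simp add: \<delta>_def)
  moreover have "\<delta> \<le> edge_power p u \<and> \<delta> \<le> edge_mass u"
    if "sobolev u \<and> edge_dirichlet u \<le> B \<and> (\<exists>t\<in>{0..1}. c \<le> \<bar>u t\<bar>)" for u
    using main[of u] that unfolding \<delta>_def by fastforce
  ultimately show ?thesis by blast
qed

text \<open>
  Completeness of \<open>L\<^sup>2\<close> along fast Cauchy sequences. The increments are summable in \<open>L\<^sup>1\<close>, so the telescoping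
  series converges almost everywhere and may be integrated term by term; Fatou bounds the limit.
\<close>

lemma L2_edge_fast_Cauchy:
  assumes k: "\<And>j. L2_edge (k j)"
    and fast: "\<And>j. (\<integral>x. (k (Suc j) x - k j x)\<^sup>2 \<partial>\<II>) \<le> (1 / 4) ^ j"
    and B: "\<And>j. (\<integral>x. (k j x)\<^sup>2 \<partial>\<II>) \<le> B j" and lim: "B \<longlonglongrightarrow> b"
  shows "\<exists>g. L2_edge g \<and> (\<integral>x. (g x)\<^sup>2 \<partial>\<II>) \<le> b \<and> (\<forall>t. (\<lambda>j. prim (k j) t) \<longlonglongrightarrow> prim g t)"
proof -
  define f where "f = (\<lambda>j x. k (Suc j) x - k j x)"
  have fL: "L2_edge (f j)" for j unfolding f_def by (intro L2_edge_diff k)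
  have fi: "integrable \<II> (f j)" for j by (rule L2_edge_integrable[OF fL])
  have f1: "(\<integral>x. \<bar>f j x\<bar> \<partial>\<II>) \<le> (1 / 2) ^ j" for j
  proof -
    have "(\<integral>x. \<bar>f j x\<bar> \<partial>\<II>) \<le> sqrt (\<integral>x. (f j x)\<^sup>2 \<partial>\<II>)" by (rule L2_edge_integral_abs_le[OF fL])
    also have "\<dots> \<le> sqrt ((1 / 4) ^ j)" using fast[of j] by (simp add: f_def)
    also have "(1 / 4 :: real) ^ j = ((1 / 2) ^ j)\<^sup>2" by (simp add: power2_eq_square flip: power_mult_distrib)
    finally show ?thesis by simp
  qed
  have sumI: "summable (\<lambda>j. \<integral>x. \<bar>f j x\<bar> \<partial>\<II>)"
    by (rule summable_comparison_test'[of "\<lambda>j. (1 / 2) ^ j"]) (use f1 in \<open>auto simp: summable_geometric\<close>)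
  have AEs: "AE x in \<II>. summable (\<lambda>j. \<bar>f j x\<bar>)"
  proof -
    have m: "(\<lambda>x. ennreal \<bar>f j x\<bar>) \<in> borel_measurable \<II>" for j using fi[of j] by auto
    have "(\<integral>\<^sup>+x. (\<Sum>j. ennreal \<bar>f j x\<bar>) \<partial>\<II>) = (\<Sum>j. \<integral>\<^sup>+x. ennreal \<bar>f j x\<bar> \<partial>\<II>)"
      by (rule nn_integral_suminf[OF m])
    also have "\<dots> = (\<Sum>j. ennreal (\<integral>x. \<bar>f j x\<bar> \<partial>\<II>))"
      by (intro arg_cong[where f=suminf] ext nn_integral_eq_integral) (use fi in auto)
    also have "\<dots> \<noteq> top" by (rule ennreal_suminf_neq_top[OF sumI]) simp
    finally have "AE x in \<II>. (\<Sum>j. ennreal \<bar>f j x\<bar>) \<noteq> \<infinity>"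
      by (intro nn_integral_PInf_AE borel_measurable_suminf_order m) simp
    then show ?thesis
      by eventually_elim (auto intro: summable_suminf_not_top)
  qed
  define g where "g = (\<lambda>x. k 0 x + (\<Sum>j. f j x))"
  have tel: "k n x = k 0 x + (\<Sum>j<n. f j x)" for n x unfolding f_def by (simp add: sum_lessThan_telescope[of "\<lambda>j. k j x"])
  have AEg: "AE x in \<II>. (\<lambda>j. k j x) \<longlonglongrightarrow> g x"
    using AEs
  proof eventually_elim
    case (elim x)
    then have "summable (\<lambda>j. f j x)" by (rule summable_rabs_cancel)
    then have "(\<lambda>n. k 0 x + (\<Sum>j<n. f j x)) \<longlonglongrightarrow> g x"
      unfolding g_def by (intro tendsto_intros summable_LIMSEQ)
    then show ?case by (simp only: tel[symmetric])
  qed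
  have km[measurable]: "k j \<in> borel_measurable \<II>" for j using k[of j] by (simp add: L2_edge_def)
  have gm[measurable]: "g \<in> borel_measurable \<II>"
    unfolding g_def
    by (intro borel_measurable_add borel_measurable_suminf km borel_measurable_integrable[OF fi])
  have nn: "(\<integral>\<^sup>+x. ennreal ((g x)\<^sup>2) \<partial>\<II>) \<le> ennreal b"
  proof -
    have "(\<integral>\<^sup>+x. ennreal ((g x)\<^sup>2) \<partial>\<II>) = (\<integral>\<^sup>+x. liminf (\<lambda>j. ennreal ((k j x)\<^sup>2)) \<partial>\<II>)"
    proof (rule nn_integral_cong_AE)
      show "AE x in \<II>. ennreal ((g x)\<^sup>2) = liminf (\<lambda>j. ennreal ((k j x)\<^sup>2))"
        using AEg
      proof eventually_elim
        case (elim x)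
        then have "(\<lambda>j. ennreal ((k j x)\<^sup>2)) \<longlonglongrightarrow> ennreal ((g x)\<^sup>2)" by (intro tendsto_intros)
        then show ?case using lim_imp_Liminf[OF sequentially_bot] by metis
      qed
    qed
    also have "\<dots> \<le> liminf (\<lambda>j. \<integral>\<^sup>+x. ennreal ((k j x)\<^sup>2) \<partial>\<II>)"
      by (rule nn_integral_liminf) measurable
    also have "\<dots> \<le> liminf (\<lambda>j. ennreal (B j))"
    proof (rule Liminf_mono, rule always_eventually, rule allI)
      fix j
      have "(\<integral>\<^sup>+x. ennreal ((k j x)\<^sup>2) \<partial>\<II>) = ennreal (\<integral>x. (k j x)\<^sup>2 \<partial>\<II>)"
        using k[of j] by (intro nn_integral_eq_integral) (auto simp: L2_edge_def)
      then show "(\<integral>\<^sup>+x. ennreal ((k j x)\<^sup>2) \<partial>\<II>) \<le> ennreal (B j)" using B[of j] by (simp add: ennreal_leI)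
    qed
    also have "\<dots> = ennreal b" using lim by (intro lim_imp_Liminf tendsto_intros) auto
    finally show ?thesis .
  qed
  have b: "0 \<le> b"
    by (rule LIMSEQ_le_const[OF lim]) (use B order_trans[OF _ B] in \<open>auto intro!: exI[of _ 0] integral_nonneg\<close>)
  have gi2: "integrable \<II> (\<lambda>x. (g x)\<^sup>2)"
    by (rule integrableI_bounded) (use nn in \<open>auto simp: top.not_eq_extremum intro: le_less_trans\<close>)
  have "(\<integral>x. (g x)\<^sup>2 \<partial>\<II>) \<le> b"
    using nn b nn_integral_eq_integral[OF gi2] by (simp add: ennreal_le_iff)
  moreover have gL: "L2_edge g" unfolding L2_edge_def using gm gi2 by simp
  moreover have "(\<lambda>j. prim (k j) t) \<longlonglongrightarrow> prim g t" for t
  proof -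
    let ?i = "indicator {0..t} :: real \<Rightarrow> real"
    have si: "(\<lambda>j. \<integral>x. ?i x * f j x \<partial>\<II>) sums (\<integral>x. (\<Sum>j. ?i x * f j x) \<partial>\<II>)"
    proof (rule sums_integral)
      show "integrable \<II> (\<lambda>x. ?i x * f j x)" for j by (rule integrable_indicator_mult[OF fi])
      show "AE x in \<II>. summable (\<lambda>j. norm (?i x * f j x))"
        using AEs by eventually_elim (auto simp: indicator_def)
      show "summable (\<lambda>j. \<integral>x. norm (?i x * f j x) \<partial>\<II>)"
      proof (rule summable_comparison_test'[OF sumI])
        fix j
        have "(\<integral>x. norm (?i x * f j x) \<partial>\<II>) \<le> (\<integral>x. \<bar>f j x\<bar> \<partial>\<II>)"
          by (rule integral_mono) (use integrable_indicator_mult[OF fi] fi in \<open>auto simp: indicator_def\<close>)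
        then show "norm (\<integral>x. norm (?i x * f j x) \<partial>\<II>) \<le> (\<integral>x. \<bar>f j x\<bar> \<partial>\<II>)"
          by (simp add: integral_nonneg)
      qed
    qed
    have "(\<integral>x. (\<Sum>j. ?i x * f j x) \<partial>\<II>) = (\<integral>x. ?i x * g x - ?i x * k 0 x \<partial>\<II>)"
    proof (rule Bochner_Integration.integral_cong[OF refl])
      fix x show "(\<Sum>j. ?i x * f j x) = ?i x * g x - ?i x * k 0 x"
        by (auto simp: indicator_def g_def)
    qed
    also have "\<dots> = prim g t - prim (k 0) t"
      unfolding prim_def
      by (intro Bochner_Integration.integral_diff integrable_indicator_mult L2_edge_integrable gL k)
    finally have "(\<lambda>n. \<Sum>j<n. prim (f j) t) \<longlonglongrightarrow> prim g t - prim (k 0) t"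
      using si unfolding sums_def prim_def by simp
    moreover have "(\<Sum>j<n. prim (f j) t) = prim (k n) t - prim (k 0) t" for n
    proof -
      have "prim (f j) t = prim (k (Suc j)) t - prim (k j) t" for j
        using prim_linear[OF L2_edge_integrable[OF k] L2_edge_integrable[OF k], of 1 "Suc j" "-1" j t]
        unfolding f_def by simp
      then show ?thesis by (simp add: sum_lessThan_telescope[of "\<lambda>j. prim (k j) t"])
    qed
    ultimately have "(\<lambda>n. prim (k n) t - prim (k 0) t) \<longlonglongrightarrow> prim g t - prim (k 0) t" by simp
    from tendsto_add[OF this tendsto_const[of "prim (k 0) t"]]
    show ?thesis by simp
  qed
  ultimately show ?thesis by blast
qed

text \<open>
  Lower semicontinuity of the Dirichlet integral without weak compactness. Let \<open>d e\<close> be the infimum of the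
  Dirichlet integral over the functions that are uniformly \<open>e\<close>-close to \<open>u\<close>; it increases to some
  \<open>dS \<le> A\<close> as \<open>e\<close> decreases to \<open>0\<close>. Almost minimizers for \<open>e\<close> have midpoints that compete as well, so by the
  parallelogram identity their derivatives form a Cauchy sequence, whose limit is the derivative of \<open>u\<close>.
\<close>

lemma sobolev_limit:
  assumes v: "\<And>n. sobolev (v n)" and unif: "uniform_limit {0..1} v u sequentially"
    and D: "(\<lambda>n. edge_dirichlet (v n)) \<longlonglongrightarrow> A"
  shows "sobolev u \<and> edge_dirichlet u \<le> A"
proof -
  define K where "K = (\<lambda>e::real. {edge_dirichlet w | w. sobolev w \<and> (\<forall>t\<in>{0..1}. \<bar>w t - u t\<bar> \<le> e)})"
  define d where "d = (\<lambda>e. Inf (K e))"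
  have inK: "\<forall>\<^sub>F n in sequentially. edge_dirichlet (v n) \<in> K e" if "e > 0" for e
    using uniform_limitD[OF unif that] unfolding K_def
    by eventually_elim (use v in \<open>auto simp: dist_real_def intro!: exI less_imp_le\<close>)
  have Kne: "K e \<noteq> {}" if "e > 0" for e
    using eventually_happens[OF inK[OF that]] by auto
  have Kbdd: "bdd_below (K e)" for e unfolding K_def by (rule bdd_belowI[of _ 0]) (auto intro: edge_dirichlet_nonneg)
  have dA: "d e \<le> A" if "e > 0" for e
  proof (rule tendsto_lowerbound[OF D])
    show "\<forall>\<^sub>F n in sequentially. d e \<le> edge_dirichlet (v n)"
      using inK[OF that] by eventually_elim (auto simp: d_def intro: cInf_lower Kbdd)
  qed simp
  have dmono: "d e' \<le> d e" if "0 < e" "e \<le> e'" for e e'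
    unfolding d_def by (rule cInf_superset_mono[OF Kne Kbdd]) (use that in \<open>force simp: K_def\<close>)+
  define dS where "dS = Sup (d ` {0<..})"
  have bddS: "bdd_above (d ` {0<..})" using dA by (intro bdd_aboveI2[of _ _ A]) auto
  have dS: "d e \<le> dS" if "e > 0" for e unfolding dS_def by (rule cSup_upper) (use that bddS in auto)
  have dSA: "dS \<le> A" unfolding dS_def by (rule cSup_least) (use dA in auto)
  define \<delta> where "\<delta> = (\<lambda>j::nat. (1 / 4 :: real) ^ j / 8)"
  have \<delta>: "\<delta> j > 0" for j by (simp add: \<delta>_def)
  have "\<exists>e>0. d e > dS - \<delta> j" for j
  proof -
    have "dS - \<delta> j < Sup (d ` {0<..})" unfolding dS_def[symmetric] using \<delta>[of j] by simp
    then show ?thesis using less_cSup_iff[OF _ bddS, of "dS - \<delta> j"] by auto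
  qed
  then obtain e0 where e0: "\<And>j. e0 j > 0" "\<And>j. d (e0 j) > dS - \<delta> j" by metis
  define e where "e = (\<lambda>j. min (1 / real (Suc j)) (Min (e0 ` {..j})))"
  have epos: "e j > 0" for j unfolding e_def using e0 by auto
  have ele: "e j \<le> e0 j" for j unfolding e_def by (auto intro: min.coboundedI2)
  have e_dec: "e (Suc j) \<le> e j" for j
  proof -
    have "Min (e0 ` {..Suc j}) \<le> Min (e0 ` {..j})" by (rule Min_antimono) auto
    moreover have "1 / real (Suc (Suc j)) \<le> 1 / real (Suc j)" by (intro divide_left_mono) auto
    ultimately show ?thesis unfolding e_def by (rule min.mono[rotated])
  qed
  have e0lim: "e \<longlonglongrightarrow> 0"
  proof (rule tendsto_sandwich)
    show "\<forall>\<^sub>F j in sequentially. 0 \<le> e j" using less_imp_le[OF epos] by simp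
    show "\<forall>\<^sub>F j in sequentially. e j \<le> 1 / real (Suc j)" by (auto simp: e_def)
    show "(\<lambda>j. 1 / real (Suc j)) \<longlonglongrightarrow> 0" by (rule LIMSEQ_inverse_real_of_nat[unfolded inverse_eq_divide])
  qed simp
  have dlow: "d (e j) > dS - \<delta> j" for j
    using e0(2)[of j] dmono[OF epos ele] by (meson less_le_trans)
  have "\<exists>w. sobolev w \<and> (\<forall>t\<in>{0..1}. \<bar>w t - u t\<bar> \<le> e j) \<and> edge_dirichlet w < dS + \<delta> j" for j
  proof -
    have "Inf (K (e j)) < dS + \<delta> j" using dS[OF epos[of j]] \<delta>[of j] unfolding d_def by linarith
    then obtain y where "y \<in> K (e j)" "y < dS + \<delta> j" using cInf_lessD[OF Kne[OF epos]] by blast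
    then show ?thesis unfolding K_def by blast
  qed
  then obtain w where w: "\<And>j. sobolev (w j)" "\<And>j t. t \<in> {0..1} \<Longrightarrow> \<bar>w j t - u t\<bar> \<le> e j" "\<And>j. edge_dirichlet (w j) < dS + \<delta> j"
    by metis
  define k where "k = (\<lambda>j. weak_deriv (w j))"
  have k: "has_L2_deriv (w j) (k j)" for j unfolding k_def by (rule sobolev_weak_deriv[OF w(1)])
  have kL: "L2_edge (k j)" for j by (rule has_L2_derivD[OF k])
  have k2: "(\<integral>x. (k j x)\<^sup>2 \<partial>\<II>) = edge_dirichlet (w j)" for j by (simp add: edge_dirichlet_def k_def)
  have fast: "(\<integral>x. (k (Suc j) x - k j x)\<^sup>2 \<partial>\<II>) \<le> (1 / 4) ^ j" for j
  proof -
    have mid: "has_L2_deriv (\<lambda>t. 1 / 2 * w (Suc j) t + 1 / 2 * w j t) (\<lambda>t. 1 / 2 * k (Suc j) t + 1 / 2 * k j t)"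
      by (rule has_L2_deriv_linear[OF k k])
    have "edge_dirichlet (\<lambda>t. 1 / 2 * w (Suc j) t + 1 / 2 * w j t) \<in> K (e j)"
      unfolding K_def
    proof (intro CollectI exI conjI ballI)
      show "edge_dirichlet (\<lambda>t. 1 / 2 * w (Suc j) t + 1 / 2 * w j t) = edge_dirichlet (\<lambda>t. 1 / 2 * w (Suc j) t + 1 / 2 * w j t)" ..
      show "sobolev (\<lambda>t. 1 / 2 * w (Suc j) t + 1 / 2 * w j t)" using mid unfolding sobolev_def by blast
      fix t :: real assume t: "t \<in> {0..1}"
      show "\<bar>1 / 2 * w (Suc j) t + 1 / 2 * w j t - u t\<bar> \<le> e j"
        using w(2)[OF t, of j] w(2)[OF t, of "Suc j"] e_dec[of j] by (simp add: abs_le_iff)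
    qed
    then have *: "d (e j) \<le> edge_dirichlet (\<lambda>t. 1 / 2 * w (Suc j) t + 1 / 2 * w j t)"
      unfolding d_def by (rule cInf_lower[OF _ Kbdd])
    define m where "m = (\<integral>x. (1 / 2 * k (Suc j) x + 1 / 2 * k j x)\<^sup>2 \<partial>\<II>)"
    have low: "dS - \<delta> j < m"
      unfolding m_def edge_dirichlet_eq[OF mid, symmetric] by (rule less_le_trans[OF dlow *])
    have i: "integrable \<II> (\<lambda>x. (1 / 2 * k (Suc j) x + 1 / 2 * k j x)\<^sup>2)" "integrable \<II> (\<lambda>x. (k (Suc j) x)\<^sup>2)" "integrable \<II> (\<lambda>x. (k j x)\<^sup>2)"
      using has_L2_derivD(1)[OF mid] kL by (auto simp: L2_edge_def)
    have "(\<integral>x. (k (Suc j) x - k j x)\<^sup>2 \<partial>\<II>) =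
      (\<integral>x. 2 * (k (Suc j) x)\<^sup>2 + 2 * (k j x)\<^sup>2 - 4 * (1 / 2 * k (Suc j) x + 1 / 2 * k j x)\<^sup>2 \<partial>\<II>)"
      by (rule Bochner_Integration.integral_cong) (auto simp: power2_eq_square algebra_simps)
    also have "\<dots> = 2 * edge_dirichlet (w (Suc j)) + 2 * edge_dirichlet (w j) - 4 * m"
      unfolding m_def k2[symmetric] using i
      by (subst Bochner_Integration.integral_diff; (subst Bochner_Integration.integral_add)?; simp)
    also have "\<dots> \<le> 2 * (dS + \<delta> (Suc j)) + 2 * (dS + \<delta> j) - 4 * (dS - \<delta> j)"
      using w(3)[of j] w(3)[of "Suc j"] low by argo
    also have "\<dots> \<le> (1 / 4) ^ j" by (simp add: \<delta>_def)
    finally show ?thesis .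
  qed
  have "\<exists>g. L2_edge g \<and> (\<integral>x. (g x)\<^sup>2 \<partial>\<II>) \<le> dS \<and> (\<forall>t. (\<lambda>j. prim (k j) t) \<longlonglongrightarrow> prim g t)"
  proof (rule L2_edge_fast_Cauchy[OF kL fast])
    show "(\<integral>x. (k j x)\<^sup>2 \<partial>\<II>) \<le> dS + \<delta> j" for j using w(3)[of j] k2 by simp
    have "(\<lambda>j. dS + (1 / 4 :: real) ^ j / 8) \<longlonglongrightarrow> dS + 0 / 8"
      by (intro tendsto_intros LIMSEQ_realpow_zero) auto
    then show "(\<lambda>j. dS + \<delta> j) \<longlonglongrightarrow> dS" by (simp add: \<delta>_def)
  qed
  then obtain g where g: "L2_edge g" "(\<integral>x. (g x)\<^sup>2 \<partial>\<II>) \<le> dS" "\<And>t. (\<lambda>j. prim (k j) t) \<longlonglongrightarrow> prim g t" by blast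
  have wlim: "(\<lambda>j. w j t) \<longlonglongrightarrow> u t" if "t \<in> {0..1}" for t
  proof (rule LIM_zero_cancel, rule Lim_null_comparison[OF _ e0lim])
    show "\<forall>\<^sub>F j in sequentially. norm (w j t - u t) \<le> e j" using w(2)[OF that] by simp
  qed
  have "u t = u 0 + prim g t" if t: "t \<in> {0..1}" for t
  proof (rule LIMSEQ_unique[OF wlim[OF t]])
    have "(\<lambda>j. w j 0 + prim (k j) t) \<longlonglongrightarrow> u 0 + prim g t"
      by (intro tendsto_add wlim g) simp
    then show "(\<lambda>j. w j t) \<longlonglongrightarrow> u 0 + prim g t"
      by (simp only: has_L2_derivD(2)[OF k t, symmetric])
  qed
  with g(1) have ug: "has_L2_deriv u g" unfolding has_L2_deriv_def by blast
  have "sobolev u" unfolding sobolev_def by (rule exI[of _ g]) (rule ug)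
  moreover have "edge_dirichlet u \<le> A" unfolding edge_dirichlet_eq[OF ug] using g(2) dSA by (rule order_trans)
  ultimately show ?thesis ..
qed

section \<open>Sobolev functions on a metric graph\<close>

abbreviation slice :: "('v point \<Rightarrow> real) \<Rightarrow> 'v \<times> 'v \<Rightarrow> real \<Rightarrow> real" where
  "slice u e \<equiv> \<lambda>t. u (e, t)"

text \<open>
  Tonelli: integrals over the metric graph are sums over the edges.
\<close>

lemma length_measure_nonneg_integral:
  fixes f :: "'v point \<Rightarrow> real"
  assumes G: "countable G" and nonneg: "\<And>z. 0 \<le> f z" and int: "\<And>e. e \<in> G \<Longrightarrow> integrable \<II> (\<lambda>t. f (e, t))"
  shows "integrable (length_measure G) f \<longleftrightarrow> (\<lambda>e. \<integral>t. f (e, t) \<partial>\<II>) summable_on G"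
    and "(\<lambda>e. \<integral>t. f (e, t) \<partial>\<II>) summable_on G \<Longrightarrow>
      integral\<^sup>L (length_measure G) f = (\<Sum>\<^sub>\<infinity>e\<in>G. \<integral>t. f (e, t) \<partial>\<II>)"
proof -
  define s where "s = (\<lambda>e. \<integral>t. f (e, t) \<partial>\<II>)"
  have s0: "0 \<le> s e" for e unfolding s_def using nonneg by (simp add: integral_nonneg)
  have fm: "f \<in> borel_measurable (length_measure G)"
    unfolding length_measure_def
    by (rule measurable_pair_measure_countable1[OF G]) (use int in blast)
  have nn: "(\<integral>\<^sup>+z. ennreal (f z) \<partial>length_measure G) = (\<integral>\<^sup>+e. ennreal (s e) \<partial>count_space G)"
  proof -
    have "(\<integral>\<^sup>+z. ennreal (f z) \<partial>length_measure G) = (\<integral>\<^sup>+e. \<integral>\<^sup>+t. ennreal (f (e, t)) \<partial>\<II> \<partial>count_space G)"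
      unfolding length_measure_def
      by (rule sigma_finite_measure.nn_integral_fst[OF sigma_finite_unit, symmetric])
        (use fm[unfolded length_measure_def] in measurable)
    also have "\<dots> = (\<integral>\<^sup>+e. ennreal (s e) \<partial>count_space G)"
    proof (rule nn_integral_cong)
      fix e assume "e \<in> space (count_space G)"
      then show "(\<integral>\<^sup>+t. ennreal (f (e, t)) \<partial>\<II>) = ennreal (s e)"
        unfolding s_def using int nonneg by (intro nn_integral_eq_integral) auto
    qed
    finally show ?thesis .
  qed
  have summ: "s summable_on G \<longleftrightarrow> integrable (count_space G) s"
  proof -
    have "s summable_on G \<longleftrightarrow> Infinite_Sum.abs_summable_on s G" using s0 by simp
    also have "\<dots> \<longleftrightarrow> integrable (count_space G) s"
      unfolding abs_summable_equivalent abs_summable_on_def ..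
    finally show ?thesis .
  qed
  have i1: "integrable (length_measure G) f \<longleftrightarrow> integrable (count_space G) s"
    unfolding integrable_iff_bounded using fm nn nonneg s0 by simp
  then show "integrable (length_measure G) f \<longleftrightarrow> (\<lambda>e. \<integral>t. f (e, t) \<partial>\<II>) summable_on G"
    using summ unfolding s_def by simp
  assume "(\<lambda>e. \<integral>t. f (e, t) \<partial>\<II>) summable_on G"
  then have i2: "integrable (count_space G) s" "s summable_on G" using summ unfolding s_def by auto
  have "ennreal (integral\<^sup>L (length_measure G) f) = ennreal (integral\<^sup>L (count_space G) s)"
    using nn nn_integral_eq_integral[of "length_measure G" f] nn_integral_eq_integral[OF i2(1)] i1 i2 nonneg s0 by simp
  then have "integral\<^sup>L (length_measure G) f = integral\<^sup>L (count_space G) s"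
    using nonneg s0 by (simp add: integral_nonneg)
  also have "\<dots> = infsetsum s G" by (simp add: infsetsum_def)
  also have "\<dots> = infsum s G"
    by (rule infsetsum_infsum) (use i2 in \<open>simp add: abs_summable_on_def\<close>)
  finally show "integral\<^sup>L (length_measure G) f = (\<Sum>\<^sub>\<infinity>e\<in>G. \<integral>t. f (e, t) \<partial>\<II>)" unfolding s_def .
qed

lemma cont_on_graph_slice:
  "cont_on_graph G u \<Longrightarrow> e \<in> G \<Longrightarrow> continuous_on {0..1} (slice u e)"
  unfolding cont_on_graph_def by blast

lemma graph_deriv_slice: "graph_deriv u (e, t) = weak_deriv (slice u e) t"
  by (simp add: graph_deriv_def)

lemma H1_iff:
  assumes G: "countable G"
  shows "u \<in> H1 G \<longleftrightarrow> cont_on_graph G u \<and> (\<forall>e\<in>G. sobolev (slice u e)) \<and>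
    (\<lambda>e. edge_dirichlet (slice u e) + edge_mass (slice u e)) summable_on G"
proof -
  have "integrable (length_measure G) (\<lambda>z. (graph_deriv u z)\<^sup>2 + (u z)\<^sup>2) \<longleftrightarrow>
      (\<lambda>e. edge_dirichlet (slice u e) + edge_mass (slice u e)) summable_on G" if s: "\<forall>e\<in>G. sobolev (slice u e)"
  proof -
    have i: "integrable \<II> (\<lambda>t. (graph_deriv u (e, t))\<^sup>2)" "integrable \<II> (\<lambda>t. (u (e, t))\<^sup>2)" if "e \<in> G" for e
      using s that has_L2_derivD(1)[OF sobolev_weak_deriv, of "slice u e"] edge_mass_integrable[of "slice u e"]
      by (auto simp: graph_deriv_slice L2_edge_def)
    have "integrable (length_measure G) (\<lambda>z. (graph_deriv u z)\<^sup>2 + (u z)\<^sup>2) \<longleftrightarrow>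
      (\<lambda>e. \<integral>t. (graph_deriv u (e, t))\<^sup>2 + (u (e, t))\<^sup>2 \<partial>\<II>) summable_on G"
      by (rule length_measure_nonneg_integral(1)[OF G]) (use i in auto)
    also have "\<dots> \<longleftrightarrow> (\<lambda>e. edge_dirichlet (slice u e) + edge_mass (slice u e)) summable_on G"
      by (rule summable_on_cong) (use i in \<open>auto simp: edge_dirichlet_def edge_mass_def graph_deriv_slice\<close>)
    finally show ?thesis .
  qed
  moreover have "(\<forall>e\<in>G. sobolev (slice u e)) \<longleftrightarrow> (\<forall>e\<in>G. H1_edge (slice u e))" if "cont_on_graph G u"
    unfolding sobolev_iff using cont_on_graph_slice[OF that] by blast
  ultimately show ?thesis unfolding H1_def mem_Collect_eq by blast
qed

lemma H1_cont: "u \<in> H1 G \<Longrightarrow> cont_on_graph G u"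
  unfolding H1_def by simp

lemma H1_sobolev: "u \<in> H1 G \<Longrightarrow> e \<in> G \<Longrightarrow> sobolev (slice u e)"
  using cont_on_graph_slice[of G u e] by (simp add: H1_def sobolev_iff)

lemma H1_summable:
  assumes G: "countable G" and u: "u \<in> H1 G"
  shows "(\<lambda>e. edge_dirichlet (slice u e)) summable_on G" "(\<lambda>e. edge_mass (slice u e)) summable_on G"
proof -
  have s: "(\<lambda>e. edge_dirichlet (slice u e) + edge_mass (slice u e)) summable_on G" using u H1_iff[OF G] by blast
  show "(\<lambda>e. edge_dirichlet (slice u e)) summable_on G"
    by (rule summable_on_comparison_test[OF s]) (auto intro: edge_dirichlet_nonneg edge_mass_nonneg)
  show "(\<lambda>e. edge_mass (slice u e)) summable_on G"
    by (rule summable_on_comparison_test[OF s]) (auto intro: edge_dirichlet_nonneg edge_mass_nonneg)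
qed

lemma dirichlet_eq:
  assumes G: "countable G" and u: "u \<in> H1 G"
  shows "dirichlet G u = (\<Sum>\<^sub>\<infinity>e\<in>G. edge_dirichlet (slice u e))"
proof -
  have i: "integrable \<II> (\<lambda>t. \<bar>graph_deriv u (e, t)\<bar>\<^sup>2)" if "e \<in> G" for e
    using has_L2_derivD(1)[OF sobolev_weak_deriv[OF H1_sobolev[OF u that]]]
    by (simp add: graph_deriv_slice L2_edge_def)
  show ?thesis unfolding dirichlet_def
    using length_measure_nonneg_integral(2)[OF G _ i] H1_summable(1)[OF G u]
    by (simp add: graph_deriv_slice edge_dirichlet_def)
qed

lemma mass_eq:
  assumes G: "countable G" and u: "u \<in> H1 G"
  shows "mass G u = (\<Sum>\<^sub>\<infinity>e\<in>G. edge_mass (slice u e))"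
proof -
  have i: "integrable \<II> (\<lambda>t. \<bar>u (e, t)\<bar>\<^sup>2)" if "e \<in> G" for e
    using edge_mass_integrable[OF H1_sobolev[OF u that]] by simp
  show ?thesis unfolding mass_def
    using length_measure_nonneg_integral(2)[OF G _ i] H1_summable(2)[OF G u] by (simp add: edge_mass_def)
qed

lemma dirichlet_nonneg: "dirichlet G u \<ge> 0" and mass_nonneg: "mass G u \<ge> 0"
  unfolding dirichlet_def mass_def by simp_all

lemma H1_term_le:
  assumes G: "countable G" and u: "u \<in> H1 G" and e: "e \<in> G"
  shows "edge_dirichlet (slice u e) \<le> dirichlet G u" "edge_mass (slice u e) \<le> mass G u"
  using finite_sum_le_infsum[OF H1_summable(1)[OF G u], of "{e}"] finite_sum_le_infsum[OF H1_summable(2)[OF G u], of "{e}"] e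
  by (auto simp: dirichlet_eq[OF G u] mass_eq[OF G u] edge_dirichlet_nonneg edge_mass_nonneg)

lemma H1_bounded:
  assumes G: "countable G" and u: "u \<in> H1 G" and e: "e \<in> G" and t: "t \<in> {0..1}"
  shows "(u (e, t))\<^sup>2 \<le> mass G u + 2 * sqrt (mass G u * dirichlet G u)"
proof -
  have "(u (e, t))\<^sup>2 \<le> edge_mass (slice u e) + 2 * sqrt (edge_mass (slice u e) * edge_dirichlet (slice u e))"
    by (rule sobolev_square_le[OF H1_sobolev[OF u e] t])
  also have "\<dots> \<le> mass G u + 2 * sqrt (mass G u * dirichlet G u)"
    using H1_term_le[OF G u e] edge_mass_nonneg edge_dirichlet_nonneg mass_nonneg dirichlet_nonneg
    by (intro add_mono mult_left_mono real_sqrt_le_mono mult_mono) auto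
  finally show ?thesis .
qed

definition power_integral :: "real \<Rightarrow> 'v mgraph \<Rightarrow> ('v point \<Rightarrow> real) \<Rightarrow> real" where
  "power_integral p G u = (\<Sum>\<^sub>\<infinity>e\<in>G. edge_power p (slice u e))"

lemma power_bound:
  assumes G: "countable G" and u: "u \<in> H1 G" and p: "2 < p"
    and S: "\<And>e t. e \<in> G \<Longrightarrow> t \<in> {0..1} \<Longrightarrow> \<bar>u (e, t)\<bar> \<le> S"
  shows "(\<lambda>e. edge_power p (slice u e)) summable_on G"
    "power_integral p G u \<le> S powr (p - 2) * mass G u"
proof -
  have le: "edge_power p (slice u e) \<le> S powr (p - 2) * edge_mass (slice u e)" if "e \<in> G" for e
    by (rule edge_power_le[OF H1_sobolev[OF u that] p]) (use S that in auto)
  have sm: "(\<lambda>e. S powr (p - 2) * edge_mass (slice u e)) summable_on G"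
    by (rule summable_on_cmult_right) (rule H1_summable[OF G u])
  show s: "(\<lambda>e. edge_power p (slice u e)) summable_on G"
    by (rule summable_on_comparison_test[OF sm]) (use le edge_power_nonneg in auto)
  have "power_integral p G u \<le> (\<Sum>\<^sub>\<infinity>e\<in>G. S powr (p - 2) * edge_mass (slice u e))"
    unfolding power_integral_def by (rule infsum_mono[OF s sm le])
  also have "\<dots> = S powr (p - 2) * mass G u"
    unfolding mass_eq[OF G u] by (rule infsum_cmult_right) (rule H1_summable[OF G u])
  finally show "power_integral p G u \<le> S powr (p - 2) * mass G u" .
qed

lemma power_summable:
  assumes G: "countable G" and u: "u \<in> H1 G" and p: "2 < p"
  shows "(\<lambda>e. edge_power p (slice u e)) summable_on G"
  by (rule power_bound(1)[OF G u p, of "sqrt (mass G u + 2 * sqrt (mass G u * dirichlet G u))"])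
     (use H1_bounded[OF G u] in \<open>auto intro!: real_le_rsqrt simp: power2_abs\<close>)

lemma power_integral_nonneg: "power_integral p G u \<ge> 0"
  unfolding power_integral_def by (intro infsum_nonneg edge_power_nonneg)

lemma energy_eq:
  assumes G: "countable G" and u: "u \<in> H1 G" and p: "2 < p"
  shows "energy p G u = 1 / 2 * dirichlet G u - power_integral p G u / p"
proof -
  have i: "integrable \<II> (\<lambda>t. \<bar>u (e, t)\<bar> powr p)" if "e \<in> G" for e
    using edge_power_integrable[OF H1_sobolev[OF u that]] p by simp
  have "integral\<^sup>L (length_measure G) (\<lambda>z. \<bar>u z\<bar> powr p) = power_integral p G u"
    using length_measure_nonneg_integral(2)[OF G _ i] power_summable[OF G u p] by (simp add: edge_power_def power_integral_def)
  then show ?thesis unfolding energy_def by simp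
qed

lemma H1_subset:
  assumes G: "countable G" and S: "S \<subseteq> G" and u: "u \<in> H1 G"
  shows "u \<in> H1 S"
proof -
  have c: "countable S" using S G countable_subset by blast
  have "cont_on_graph S u" using H1_cont[OF u] S unfolding cont_on_graph_def by blast
  moreover have "(\<lambda>e. edge_dirichlet (slice u e) + edge_mass (slice u e)) summable_on S"
    using u S summable_on_subset_banach unfolding H1_iff[OF G] by blast
  ultimately show ?thesis unfolding H1_iff[OF c] using H1_sobolev[OF u] S by blast
qed

lemma H1_scale:
  assumes G: "countable G" and u: "u \<in> H1 G" and p: "2 < p"
  shows "(\<lambda>z. a * u z) \<in> H1 G" "dirichlet G (\<lambda>z. a * u z) = a\<^sup>2 * dirichlet G u"
    "mass G (\<lambda>z. a * u z) = a\<^sup>2 * mass G u" "power_integral p G (\<lambda>z. a * u z) = \<bar>a\<bar> powr p * power_integral p G u"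
proof -
  have sc: "edge_dirichlet (\<lambda>t. a * u (e, t)) = a\<^sup>2 * edge_dirichlet (slice u e)" "edge_mass (\<lambda>t. a * u (e, t)) = a\<^sup>2 * edge_mass (slice u e)"
    "edge_power p (\<lambda>t. a * u (e, t)) = \<bar>a\<bar> powr p * edge_power p (slice u e)" if "e \<in> G" for e
    using sobolev_scale[OF H1_sobolev[OF u that]] by auto
  have "(\<lambda>e. a\<^sup>2 * (edge_dirichlet (slice u e) + edge_mass (slice u e))) summable_on G"
    using u H1_iff[OF G] by (intro summable_on_cmult_right) blast
  then have s: "(\<lambda>e. edge_dirichlet (\<lambda>t. a * u (e, t)) + edge_mass (\<lambda>t. a * u (e, t))) summable_on G"
    by (rule summable_on_cong[THEN iffD1, rotated]) (simp add: sc algebra_simps)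
  obtain f where f: "\<forall>(v, w)\<in>G. u ((v, w), 0) = f v \<and> u ((v, w), 1) = f w"
    using H1_cont[OF u] unfolding cont_on_graph_def by blast
  have "cont_on_graph G (\<lambda>z. a * u z)"
    unfolding cont_on_graph_def
  proof (intro conjI ballI exI)
    show "continuous_on {0..1} (\<lambda>t. a * u (e, t))" if "e \<in> G" for e
      by (intro continuous_intros cont_on_graph_slice[OF H1_cont[OF u] that])
    show "case e of (v, w) \<Rightarrow> a * u ((v, w), 0) = a * f v \<and> a * u ((v, w), 1) = a * f w" if "e \<in> G" for e
      using f that by auto
  qed
  then show H: "(\<lambda>z. a * u z) \<in> H1 G"
    unfolding H1_iff[OF G] using s sobolev_scale(1)[OF H1_sobolev[OF u]] by blast
  show "dirichlet G (\<lambda>z. a * u z) = a\<^sup>2 * dirichlet G u"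
    unfolding dirichlet_eq[OF G H] dirichlet_eq[OF G u] infsum_cmult_right'[symmetric]
    by (rule infsum_cong) (simp add: sc)
  show "mass G (\<lambda>z. a * u z) = a\<^sup>2 * mass G u"
    unfolding mass_eq[OF G H] mass_eq[OF G u] infsum_cmult_right'[symmetric]
    by (rule infsum_cong) (simp add: sc)
  show "power_integral p G (\<lambda>z. a * u z) = \<bar>a\<bar> powr p * power_integral p G u"
    unfolding power_integral_def infsum_cmult_right'[symmetric]
    by (rule infsum_cong) (simp add: sc)
qed

text \<open>
  The isomorphism has to preserve the orientation of the edges, since the orientation fixes the coordinate; an edge can be turned around with the next lemma.
\<close>

lemma H1_isomorphism:
  assumes b: "bij_betw (map_prod j j) S G" and G: "countable G" and u: "u \<in> H1 G"
  defines "v \<equiv> \<lambda>(e, t). u (map_prod j j e, t)"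
  shows "v \<in> H1 S" "\<And>F. (\<Sum>\<^sub>\<infinity>e\<in>S. F (slice v e)) = (\<Sum>\<^sub>\<infinity>e\<in>G. F (slice u e) :: real)"
proof -
  have S: "countable S" using b G countable_image_inj_eq[of "map_prod j j" S] by (auto simp: bij_betw_def)
  have sl: "slice v e = slice u (map_prod j j e)" for e by (simp add: v_def)
  have in_G: "map_prod j j e \<in> G" if "e \<in> S" for e using b that by (auto simp: bij_betw_def)
  obtain f where f: "\<forall>(v, w)\<in>G. u ((v, w), 0) = f v \<and> u ((v, w), 1) = f w"
    using H1_cont[OF u] unfolding cont_on_graph_def by blast
  have "cont_on_graph S v"
    unfolding cont_on_graph_def
  proof (intro conjI ballI exI)
    show "continuous_on {0..1} (slice v e)" if "e \<in> S" for e
      unfolding sl by (rule cont_on_graph_slice[OF H1_cont[OF u] in_G[OF that]])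
    show "case e of (x, y) \<Rightarrow> v ((x, y), 0) = f (j x) \<and> v ((x, y), 1) = f (j y)" if "e \<in> S" for e
      using f in_G[OF that] by (cases e) (auto simp: v_def)
  qed
  moreover have "(\<lambda>e. edge_dirichlet (slice v e) + edge_mass (slice v e)) summable_on S"
    unfolding sl using summable_on_reindex_bij_betw[OF b, of "\<lambda>e. edge_dirichlet (slice u e) + edge_mass (slice u e)"] u H1_iff[OF G]
    by blast
  ultimately show "v \<in> H1 S"
    unfolding H1_iff[OF S] sl using H1_sobolev[OF u in_G] by blast
  show "(\<Sum>\<^sub>\<infinity>e\<in>S. F (slice v e)) = (\<Sum>\<^sub>\<infinity>e\<in>G. F (slice u e) :: real)" for F
    unfolding sl by (rule infsum_reindex_bij_betw[OF b])
qed

lemma H1_flip: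
  assumes G: "countable G" and u: "u \<in> H1 G" and e: "(x, y) \<in> G" "(y, x) \<notin> G"
  defines "S \<equiv> insert (y, x) (G - {(x, y)})"
    and "v \<equiv> \<lambda>(e, t). if e = (y, x) then u ((x, y), 1 - t) else u (e, t)"
  shows "v \<in> H1 S"
    "\<And>F. F (\<lambda>t. u ((x, y), 1 - t)) = F (slice u (x, y)) \<Longrightarrow>
      (\<Sum>\<^sub>\<infinity>e\<in>S. F (slice v e)) = (\<Sum>\<^sub>\<infinity>e\<in>G. F (slice u e) :: real)"
proof -
  define h where "h = (\<lambda>e. if e = (y, x) then (x, y) else e)"
  have b: "bij_betw h S G"
    unfolding bij_betw_def inj_on_def S_def h_def using e by (auto split: if_splits)
  have S: "countable S" using G by (simp add: S_def)
  have ext: "F (slice v e) = F (slice u (h e))" if "F (\<lambda>t. u ((x, y), 1 - t)) = F (slice u (x, y))" for F :: "_ \<Rightarrow> real" and e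
    using that by (auto simp: v_def h_def)
  have in_G: "h e \<in> G" if "e \<in> S" for e using b that by (auto simp: bij_betw_def)
  have sxy: "sobolev (slice u (x, y))" by (rule H1_sobolev[OF u e(1)])
  have sob: "sobolev (slice v e)" if "e \<in> S" for e
    using H1_sobolev[OF u in_G[OF that]] sobolev_reflect(1)[OF sxy] by (auto simp: v_def h_def split: if_splits)
  obtain f where f: "\<forall>(v, w)\<in>G. u ((v, w), 0) = f v \<and> u ((v, w), 1) = f w"
    using H1_cont[OF u] unfolding cont_on_graph_def by blast
  have "cont_on_graph S v"
    unfolding cont_on_graph_def
  proof (intro conjI ballI exI)
    show "continuous_on {0..1} (slice v e)" if "e \<in> S" for e
      by (rule sobolev_continuous[OF sob[OF that]])
    show "case e of (x, y) \<Rightarrow> v ((x, y), 0) = f x \<and> v ((x, y), 1) = f y" if "e \<in> S" for e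
      using f e that by (auto simp: v_def S_def)
  qed
  moreover have "(\<lambda>e. edge_dirichlet (slice v e) + edge_mass (slice v e)) summable_on S"
  proof -
    have "(\<lambda>e. edge_dirichlet (slice u (h e)) + edge_mass (slice u (h e))) summable_on S"
      using summable_on_reindex_bij_betw[OF b, of "\<lambda>e. edge_dirichlet (slice u e) + edge_mass (slice u e)"] u H1_iff[OF G] by blast
    then show ?thesis using ext[of edge_dirichlet] ext[of edge_mass] sobolev_reflect(2,3)[OF sxy] by simp
  qed
  ultimately show "v \<in> H1 S" unfolding H1_iff[OF S] using sob by blast
  show "(\<Sum>\<^sub>\<infinity>e\<in>S. F (slice v e)) = (\<Sum>\<^sub>\<infinity>e\<in>G. F (slice u e) :: real)"
    if "F (\<lambda>t. u ((x, y), 1 - t)) = F (slice u (x, y))" for F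
    using ext[of F, OF that] infsum_reindex_bij_betw[OF b, of "\<lambda>e. F (slice u e)"] by simp
qed

section \<open>The sharp inequality on an edge\<close>

text \<open>
  The angle by which the phase of the optimal solution turns along an edge. Along an edge \<open>u'' = - \<lambda> u\<close> with
  \<open>\<lambda> = \<omega>\<^sup>2\<close> turns \<open>arctan (- u' / (\<omega> u))\<close> by \<open>\<omega>\<close>, and at a vertex with two children \<open>u' / u\<close> is halved. The
  largest angle that \<open>arctan (2 \<tau>) - arctan \<tau>\<close> attains is \<open>arctan (\<surd>2 / 4)\<close>, at \<open>\<tau> = 1 / \<surd>2\<close>.
\<close>

definition omega :: real ("\<omega>") where "\<omega> = arctan (sqrt 2 / 4)"

lemma omega_pos: "0 < \<omega>" by (simp add: omega_def)

lemma omega_le: "\<omega> \<le> sqrt 2 / 4"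
proof -
  have "tan \<omega> = sqrt 2 / 4" by (simp add: omega_def tan_arctan)
  moreover have "\<omega> \<le> tan \<omega>"
    using arctan_le_self[of "sqrt 2 / 4"] by (simp add: omega_def tan_arctan)
  ultimately show ?thesis by simp
qed

lemma omega_lt: "\<omega> < pi / 2" unfolding omega_def by (rule arctan_ubound)

lemma cos_omega: "cos \<omega> = 2 * sqrt 2 / 3" and sin_omega: "sin \<omega> = 1 / 3"
proof -
  have *: "sqrt (1 + (sqrt 2 / 4)\<^sup>2) = 3 / (2 * sqrt 2)"
    by (rule real_sqrt_unique) (auto simp: power2_eq_square field_simps)
  show "cos \<omega> = 2 * sqrt 2 / 3" unfolding omega_def cos_arctan * by simp
  show "sin \<omega> = 1 / 3" unfolding omega_def sin_arctan * by simp
qed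

text \<open>
  The solution of \<open>u'' = - \<omega>\<^sup>2 u\<close> that starts with value \<open>1\<close> and slope \<open>- \<omega> / \<surd>2\<close>. Its logarithmic derivative
  at \<open>1\<close> is twice the one at \<open>0\<close>, so copies of it, multiplied by \<open>1 / \<surd>2\<close> from each generation to the next,
  fit together to a positive eigenfunction of the tree.
\<close>

definition profile :: "real \<Rightarrow> real" where "profile t = cos (\<omega> * t) - sin (\<omega> * t) / sqrt 2"
definition profile' :: "real \<Rightarrow> real" where "profile' t = - \<omega> * (sin (\<omega> * t) + cos (\<omega> * t) / sqrt 2)"

lemma profile_0: "profile 0 = 1" and profile_1: "profile 1 = 1 / sqrt 2"
  and profile'_0: "profile' 0 = - \<omega> / sqrt 2" and profile'_1: "profile' 1 = - \<omega>"
proof -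
  show "profile 1 = 1 / sqrt 2" unfolding profile_def by (simp add: cos_omega sin_omega field_simps)
  show "profile' 1 = - \<omega>" unfolding profile'_def by (simp add: cos_omega sin_omega field_simps)
qed (simp_all add: profile_def profile'_def)

lemma profile_deriv: "(profile has_real_derivative profile' t) (at t within S)"
  unfolding profile_def[abs_def] profile'_def divide_inverse by (auto intro!: derivative_eq_intros simp: algebra_simps)

lemma profile'_deriv: "(profile' has_real_derivative - \<omega>\<^sup>2 * profile t) (at t within S)"
  unfolding profile_def profile'_def[abs_def] divide_inverse by (auto intro!: derivative_eq_intros simp: algebra_simps power2_eq_square)

lemma profile_decreasing:
  assumes "0 \<le> s" "s \<le> t" "t \<le> 1" shows "profile t \<le> profile s"
proof (rule DERIV_nonpos_imp_nonincreasing[OF assms(2)])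
  fix x assume x: "s \<le> x" "x \<le> t"
  have b: "0 \<le> \<omega> * x" "\<omega> * x \<le> \<omega>" using x assms omega_pos by (auto simp: mult_left_le)
  have "sin (\<omega> * x) \<ge> 0" using b omega_lt by (intro sin_ge_zero) auto
  moreover have "cos (\<omega> * x) \<ge> 0" using b omega_lt by (intro cos_ge_zero) auto
  ultimately have "profile' x \<le> 0" unfolding profile'_def using omega_pos by (auto intro!: mult_nonneg_nonneg add_nonneg_nonneg)
  then show "\<exists>y. (profile has_real_derivative y) (at x) \<and> y \<le> 0" using profile_deriv by blast
qed

lemma profile_pos: assumes "t \<in> {0..1}" shows "0 < profile t"
proof -
  have "1 / sqrt 2 \<le> profile t" using profile_decreasing[of t 1] assms profile_1 by simp
  then show ?thesis by (rule less_le_trans[rotated]) simp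
qed

lemma profile_continuous: "continuous_on S profile" and profile'_continuous: "continuous_on S profile'"
  unfolding profile_def[abs_def] profile'_def[abs_def] by (auto intro!: continuous_intros)

lemma has_L2_deriv_prof: "has_L2_deriv profile profile'"
  by (rule has_L2_deriv_C1[OF profile_deriv profile'_continuous])

text \<open>
  The square is completed with a solution \<open>w\<close> of the Riccati equation \<open>w' + w\<^sup>2 = - L\<close>: the cross term is
  \<open>- (w u\<^sup>2)' - L u\<^sup>2\<close> up to \<open>- w\<^sup>2 u\<^sup>2\<close>.
\<close>

lemma riccati_identity:
  assumes u: "has_L2_deriv u g"
    and w: "\<And>t. t \<in> {0..1} \<Longrightarrow> (w has_real_derivative - L - (w t)\<^sup>2) (at t within {0..1})"
  shows "L2_edge (\<lambda>t. g t - w t * u t)"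
    and "(\<integral>t. (g t - w t * u t)\<^sup>2 \<partial>\<II>) = (\<integral>t. (g t)\<^sup>2 \<partial>\<II>) - L * (\<integral>t. (u t)\<^sup>2 \<partial>\<II>) - (w 1 * (u 1)\<^sup>2 - w 0 * (u 0)\<^sup>2)"
proof -
  have wc: "continuous_on {0..1} w" by (rule DERIV_continuous_on[OF w])
  have uc: "continuous_on {0..1} u" by (rule has_L2_deriv_continuous[OF u])
  have g: "L2_edge g" by (rule has_L2_derivD[OF u])
  have wu: "L2_edge (\<lambda>t. w t * u t)" by (intro L2_edge_continuous continuous_intros wc uc)
  show hL: "L2_edge (\<lambda>t. g t - w t * u t)" by (rule L2_edge_diff[OF g wu])
  let ?w' = "\<lambda>t. - L - (w t)\<^sup>2"
  have wd: "has_L2_deriv w ?w'"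
    by (rule has_L2_deriv_C1[OF w]) (auto intro!: continuous_intros wc)
  have uu: "has_L2_deriv (\<lambda>t. u t * u t) (\<lambda>t. g t * u t + u t * g t)" by (rule has_L2_deriv_mult[OF u u])
  let ?k = "\<lambda>t. ?w' t * (u t * u t) + w t * (g t * u t + u t * g t)"
  have wuu: "has_L2_deriv (\<lambda>t. w t * (u t * u t)) ?k" by (rule has_L2_deriv_mult[OF wd uu])
  have i: "integrable \<II> ?k" "integrable \<II> (\<lambda>t. (g t)\<^sup>2)" "integrable \<II> (\<lambda>t. L * (u t)\<^sup>2)"
    using L2_edge_integrable[OF has_L2_derivD(1)[OF wuu]] g L2_edge_continuous[OF uc] by (auto simp: L2_edge_def)
  have "(\<integral>t. (g t - w t * u t)\<^sup>2 \<partial>\<II>) = (\<integral>t. (g t)\<^sup>2 - L * (u t)\<^sup>2 - ?k t \<partial>\<II>)"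
    by (rule Bochner_Integration.integral_cong) (auto simp: power2_eq_square algebra_simps)
  also have "\<dots> = (\<integral>t. (g t)\<^sup>2 \<partial>\<II>) - (\<integral>t. L * (u t)\<^sup>2 \<partial>\<II>) - integral\<^sup>L \<II> ?k"
    by (subst Bochner_Integration.integral_diff, (intro Bochner_Integration.integrable_diff i)+)
      (subst Bochner_Integration.integral_diff, (rule i)+, rule refl)
  also have "integral\<^sup>L \<II> ?k = w 1 * (u 1)\<^sup>2 - w 0 * (u 0)\<^sup>2"
    using has_L2_deriv_integral[OF wuu] by (simp add: power2_eq_square)
  finally show "(\<integral>t. (g t - w t * u t)\<^sup>2 \<partial>\<II>) = (\<integral>t. (g t)\<^sup>2 \<partial>\<II>) - L * (\<integral>t. (u t)\<^sup>2 \<partial>\<II>) - (w 1 * (u 1)\<^sup>2 - w 0 * (u 0)\<^sup>2)"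
    by simp
qed

text \<open>
  The integral of \<open>(u' - w u)\<^sup>2\<close> over an edge, where \<open>w\<close> is the logarithmic derivative of \<open>profile\<close>, after
  integration by parts.
\<close>

definition edge_defect :: "(real \<Rightarrow> real) \<Rightarrow> real" where
  "edge_defect u = edge_dirichlet u - \<omega>\<^sup>2 * edge_mass u + sqrt 2 * \<omega> * (u 1)\<^sup>2 - \<omega> / sqrt 2 * (u 0)\<^sup>2"

lemma profile_riccati:
  assumes "t \<in> {0..1}"
  shows "((\<lambda>t. profile' t / profile t) has_real_derivative - \<omega>\<^sup>2 - (profile' t / profile t)\<^sup>2) (at t within {0..1})"
  using profile_pos[OF assms]
  by (auto intro!: derivative_eq_intros profile_deriv profile'_deriv simp: field_simps power2_eq_square)

lemma profile_integral_zero: "edge_dirichlet profile = \<omega>\<^sup>2 * edge_mass profile"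
proof -
  have "(\<integral>t. (profile' t - profile' t / profile t * profile t)\<^sup>2 \<partial>\<II>) = (\<integral>t. 0 \<partial>\<II>)"
    by (rule Bochner_Integration.integral_cong) (use profile_pos in force)+
  then show ?thesis
    using riccati_identity(2)[OF has_L2_deriv_prof profile_riccati] edge_dirichlet_eq[OF has_L2_deriv_prof]
    by (simp add: profile_0 profile_1 profile'_0 profile'_1 edge_mass_def power2_eq_square field_simps)
qed

text \<open>
  The quotient of \<open>u\<close> by \<open>profile\<close> has derivative \<open>(u' - w u) / profile\<close>, and \<open>profile\<close> is decreasing. Hence \<open>u\<close>
  decays like \<open>profile\<close> up to an error that is controlled by the defect.
\<close>

lemma edge_inequality:
  assumes u: "sobolev u"
  shows "0 \<le> edge_defect u" "t \<in> {0..1} \<Longrightarrow> \<bar>u t\<bar> \<le> profile t * \<bar>u 0\<bar> + sqrt (edge_defect u)"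
proof -
  obtain g where g: "has_L2_deriv u g" using u unfolding sobolev_def by blast
  define w where "w = (\<lambda>t. profile' t / profile t)"
  define h where "h = (\<lambda>t. g t - w t * u t)"
  have hL: "L2_edge h" and id: "(\<integral>t. (h t)\<^sup>2 \<partial>\<II>) = (\<integral>t. (g t)\<^sup>2 \<partial>\<II>) - \<omega>\<^sup>2 * (\<integral>t. (u t)\<^sup>2 \<partial>\<II>) - (w 1 * (u 1)\<^sup>2 - w 0 * (u 0)\<^sup>2)"
    unfolding h_def w_def by (rule riccati_identity[OF g profile_riccati]; assumption)+
  have w01: "w 1 = - sqrt 2 * \<omega>" "w 0 = - \<omega> / sqrt 2"
    unfolding w_def profile_0 profile_1 profile'_0 profile'_1 by simp_all
  have H: "edge_defect u = (\<integral>t. (h t)\<^sup>2 \<partial>\<II>)"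
    unfolding id w01 edge_defect_def edge_dirichlet_eq[OF g] edge_mass_def by simp
  then show "0 \<le> edge_defect u" by simp
  assume t: "t \<in> {0..1}"
  let ?r = "\<lambda>t. inverse (profile t)"
  have nz: "profile s \<noteq> 0" if "s \<in> {0..1}" for s using profile_pos[OF that] by simp
  have r: "has_L2_deriv ?r (\<lambda>t. - (inverse (profile t) * profile' t * inverse (profile t)))"
    by (rule has_L2_deriv_C1)
      (auto intro!: derivative_eq_intros profile_deriv continuous_intros profile_continuous profile'_continuous nz simp: mult.assoc)
  let ?k = "\<lambda>t. g t * ?r t + u t * - (?r t * profile' t * ?r t)"
  have ur: "has_L2_deriv (\<lambda>t. u t * ?r t) ?k" by (rule has_L2_deriv_mult[OF g r])
  have kh: "?k s = h s * ?r s" if "s \<in> {0..1}" for s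
    using nz[OF that] by (simp add: h_def w_def field_simps)
  have habs: "integrable \<II> (\<lambda>s. \<bar>h s\<bar>)" by (rule L2_edge_integrable[OF L2_edge_abs[OF hL]])
  have "u t * ?r t = u 0 + prim ?k t" using has_L2_derivD(2)[OF ur t] by (simp add: profile_0)
  then have "u t = profile t * u 0 + profile t * prim ?k t" using nz[OF t] by (simp add: field_simps)
  moreover have "\<bar>profile t * prim ?k t\<bar> \<le> sqrt (edge_defect u)"
  proof -
    have i: "integrable \<II> (\<lambda>s. profile t * (indicator {0..t} s * ?k s))"
      by (intro Bochner_Integration.integrable_mult_right integrable_indicator_mult L2_edge_integrable has_L2_derivD(1)[OF ur])
    have "\<bar>profile t * prim ?k t\<bar> = \<bar>\<integral>s. profile t * (indicator {0..t} s * ?k s) \<partial>\<II>\<bar>"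
      by (simp add: prim_def)
    also have "\<dots> \<le> (\<integral>s. \<bar>profile t * (indicator {0..t} s * ?k s)\<bar> \<partial>\<II>)" by (rule integral_abs_bound)
    also have "\<dots> \<le> (\<integral>s. \<bar>h s\<bar> \<partial>\<II>)"
    proof (rule integral_mono[OF integrable_abs[OF i] habs])
      fix s assume "s \<in> space \<II>"
      then have s: "s \<in> {0..1}" by simp
      show "\<bar>profile t * (indicator {0..t} s * ?k s)\<bar> \<le> \<bar>h s\<bar>"
      proof (cases "s \<le> t")
        case True
        have "profile t * ?r s \<le> 1" using profile_decreasing[of s t] True s t profile_pos[OF s] by (simp add: field_simps)
        moreover have "0 \<le> profile t * ?r s" using profile_pos[OF s] profile_pos[OF t] by simp
        ultimately have "\<bar>profile t * ?r s\<bar> * \<bar>h s\<bar> \<le> 1 * \<bar>h s\<bar>" by (intro mult_right_mono) auto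
        then show ?thesis using True s unfolding kh[OF s] by (simp add: abs_mult ac_simps)
      qed (simp add: indicator_def)
    qed
    also have "\<dots> \<le> sqrt (edge_defect u)" unfolding H by (rule L2_edge_integral_abs_le[OF hL])
    finally show ?thesis .
  qed
  moreover have "\<bar>profile t * u 0\<bar> = profile t * \<bar>u 0\<bar>" using profile_pos[OF t] by (simp add: abs_mult)
  ultimately show "\<bar>u t\<bar> \<le> profile t * \<bar>u 0\<bar> + sqrt (edge_defect u)" by linarith
qed

text \<open>
  A root edge alone has a negative gap. It is compensated by the boundary term that a branch at its far end
  contributes, with room to spare; the numbers only use \<open>\<omega> \<le> \<surd>2 / 4\<close>.
\<close>

lemma root_edge_inequality:
  assumes u: "sobolev u"
  shows "min (5 / 8) (sqrt 2 / 8 * \<omega>) * (edge_dirichlet u + (u 1)\<^sup>2) \<le> edge_dirichlet u - \<omega>\<^sup>2 * edge_mass u + \<omega> / sqrt 2 * (u 1)\<^sup>2"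
    and "t \<in> {0..1} \<Longrightarrow> (u t)\<^sup>2 \<le> 2 * (edge_dirichlet u + (u 1)\<^sup>2)"
proof -
  have osc: "(u 1 - u t)\<^sup>2 \<le> edge_dirichlet u" if t: "t \<in> {0..1}" for t
  proof -
    have "(u 1 - u t)\<^sup>2 \<le> \<bar>1 - t\<bar> * edge_dirichlet u"
      using has_L2_deriv_Hoelder[OF sobolev_weak_deriv[OF u] t, of 1] by (simp add: edge_dirichlet_def)
    also have "\<dots> \<le> 1 * edge_dirichlet u" using t edge_dirichlet_nonneg by (intro mult_right_mono) auto
    finally show ?thesis by simp
  qed
  have split: "(u t)\<^sup>2 \<le> 3 / 2 * (u 1)\<^sup>2 + 3 * (u 1 - u t)\<^sup>2" "(u t)\<^sup>2 \<le> 2 * (u 1)\<^sup>2 + 2 * (u 1 - u t)\<^sup>2" for t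
  proof -
    have "3 / 2 * (u 1)\<^sup>2 + 3 * (u 1 - u t)\<^sup>2 - (u t)\<^sup>2 = (3 * u 1 - 2 * u t)\<^sup>2 / 2"
      by (simp add: power2_eq_square algebra_simps)
    then show "(u t)\<^sup>2 \<le> 3 / 2 * (u 1)\<^sup>2 + 3 * (u 1 - u t)\<^sup>2"
      using zero_le_power2[of "3 * u 1 - 2 * u t"] by linarith
    have "2 * (u 1)\<^sup>2 + 2 * (u 1 - u t)\<^sup>2 - (u t)\<^sup>2 = (2 * u 1 - u t)\<^sup>2"
      by (simp add: power2_eq_square algebra_simps)
    then show "(u t)\<^sup>2 \<le> 2 * (u 1)\<^sup>2 + 2 * (u 1 - u t)\<^sup>2"
      using zero_le_power2[of "2 * u 1 - u t"] by linarith
  qed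
  show "(u t)\<^sup>2 \<le> 2 * (edge_dirichlet u + (u 1)\<^sup>2)" if "t \<in> {0..1}"
    using split(2)[of t] osc[OF that] by simp
  have "edge_mass u \<le> (\<integral>t. 3 / 2 * (u 1)\<^sup>2 + 3 * edge_dirichlet u \<partial>\<II>)"
    unfolding edge_mass_def
  proof (rule integral_mono[OF edge_mass_integrable[OF u]])
    fix t assume "t \<in> space \<II>"
    then show "(u t)\<^sup>2 \<le> 3 / 2 * (u 1)\<^sup>2 + 3 * edge_dirichlet u" using split(1)[of t] osc[of t] by simp
  qed simp
  then have M: "edge_mass u \<le> 3 / 2 * (u 1)\<^sup>2 + 3 * edge_dirichlet u" by (simp add: measure_unit)
  have om2: "\<omega>\<^sup>2 \<le> \<omega> * (sqrt 2 / 4)" "\<omega>\<^sup>2 \<le> 1 / 8"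
  proof -
    show 1: "\<omega>\<^sup>2 \<le> \<omega> * (sqrt 2 / 4)" using omega_le omega_pos by (simp add: power2_eq_square)
    have "\<omega> * (sqrt 2 / 4) \<le> sqrt 2 / 4 * (sqrt 2 / 4)" using omega_le by (intro mult_right_mono) auto
    then show "\<omega>\<^sup>2 \<le> 1 / 8" using 1 by simp
  qed
  define c where "c = min (5 / 8) (sqrt 2 / 8 * \<omega>)"
  have "\<omega>\<^sup>2 * edge_mass u \<le> \<omega>\<^sup>2 * (3 / 2 * (u 1)\<^sup>2 + 3 * edge_dirichlet u)" using M by (intro mult_left_mono) auto
  also have "\<dots> = \<omega>\<^sup>2 * (3 / 2 * (u 1)\<^sup>2) + \<omega>\<^sup>2 * (3 * edge_dirichlet u)" by (simp add: algebra_simps)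
  also have "\<dots> \<le> \<omega> * (sqrt 2 / 4) * (3 / 2 * (u 1)\<^sup>2) + 1 / 8 * (3 * edge_dirichlet u)"
    using om2 edge_dirichlet_nonneg by (intro add_mono mult_right_mono) auto
  finally have 1: "\<omega>\<^sup>2 * edge_mass u \<le> 3 * sqrt 2 / 8 * \<omega> * (u 1)\<^sup>2 + 3 / 8 * edge_dirichlet u" by (simp add: algebra_simps)
  have 2: "\<omega> / sqrt 2 * (u 1)\<^sup>2 = sqrt 2 / 2 * \<omega> * (u 1)\<^sup>2" by (simp add: field_simps)
  have "c * (edge_dirichlet u + (u 1)\<^sup>2) \<le> 5 / 8 * edge_dirichlet u + sqrt 2 / 8 * \<omega> * (u 1)\<^sup>2"
    unfolding distrib_left by (intro add_mono mult_right_mono) (auto simp: c_def edge_dirichlet_nonneg)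
  also have "\<dots> \<le> edge_dirichlet u - \<omega>\<^sup>2 * edge_mass u + \<omega> / sqrt 2 * (u 1)\<^sup>2"
    using 1 unfolding 2 by (simp add: algebra_simps)
  finally show "min (5 / 8) (sqrt 2 / 8 * \<omega>) * (edge_dirichlet u + (u 1)\<^sup>2) \<le> edge_dirichlet u - \<omega>\<^sup>2 * edge_mass u + \<omega> / sqrt 2 * (u 1)\<^sup>2"
    unfolding c_def .
qed

section \<open>Binary trees and the spectral gap\<close>

text \<open>
  Both trees at once: \<open>A\<close> is the set of directions at the root that are present.
\<close>

definition tree :: "nat set \<Rightarrow> nat list mgraph" where
  "tree A = {(v, w) \<in> unrooted_tree. last w \<in> A}"

text \<open>
  An edge is determined by its far endpoint, so sums over the tree become sums over nonempty words.
\<close>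

definition words :: "nat set \<Rightarrow> nat list set" where
  "words A = {y. y \<noteq> [] \<and> set y \<subseteq> {0, 1, 2} \<and> distinct_adj y \<and> last y \<in> A}"

definition edge :: "'a list \<Rightarrow> 'a list \<times> 'a list" where "edge y = (tl y, y)"

definition vertex_values :: "'v mgraph \<Rightarrow> ('v point \<Rightarrow> real) \<Rightarrow> ('v \<Rightarrow> real) \<Rightarrow> bool" where
  "vertex_values G u f \<longleftrightarrow> (\<forall>(v, w)\<in>G. u ((v, w), 0) = f v \<and> u ((v, w), 1) = f w)"

lemma vertex_values_exist: "u \<in> H1 G \<Longrightarrow> \<exists>f. vertex_values G u f"
  using H1_cont[of u G] unfolding cont_on_graph_def vertex_values_def by blast

lemma rooted_tree_eq: "rooted_tree = tree {0}"
  unfolding rooted_tree_def tree_def by simp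

lemma unrooted_tree_eq: "unrooted_tree = tree {0, 1, 2}"
proof -
  have "last w \<in> {0, 1, 2}" if vw: "(v, w) \<in> unrooted_tree" for v w
  proof -
    obtain a where w: "w = a # v" "set w \<subseteq> {0, 1, 2}" using vw unfolding unrooted_tree_iff by blast
    then have "w \<noteq> []" by simp
    from subsetD[OF w(2) last_in_set[OF this]] show ?thesis .
  qed
  then show ?thesis unfolding tree_def by blast
qed

lemma countable_tree: "countable (tree A)" by (rule countableI_type)

lemma mem_tree: "(v, w) \<in> tree A \<longleftrightarrow> w \<in> words A \<and> v = tl w"
  unfolding tree_def words_def by (cases w) (auto simp: unrooted_tree_iff)

lemma inj_edge: "inj_on edge S" unfolding edge_def inj_on_def by simp

lemma tree_eq_image: "tree A = edge ` words A"
  unfolding edge_def using mem_tree by fastforce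

lemma edge_mem: "edge y \<in> tree A \<longleftrightarrow> y \<in> words A" by (simp add: edge_def mem_tree)

lemma bij_edge: "bij_betw edge (words A) (tree A)"
  unfolding bij_betw_def tree_eq_image by (intro conjI inj_edge refl)

lemma tree_sum: "(\<Sum>\<^sub>\<infinity>e\<in>tree A. F e) = (\<Sum>\<^sub>\<infinity>y\<in>words A. F (edge y) :: real)"
  by (rule infsum_reindex_bij_betw[OF bij_edge, symmetric])

lemma tree_summable: "F summable_on tree A \<longleftrightarrow> (\<lambda>y. F (edge y) :: real) summable_on words A"
  by (rule summable_on_reindex_bij_betw[OF bij_edge, symmetric])

text \<open>
  The two letters that may follow the first letter \<open>h\<close> are \<open>h + 1\<close> and \<open>h + 2\<close> modulo \<open>3\<close>.
\<close>

definition child :: "nat \<Rightarrow> nat list \<Rightarrow> nat list" where "child i y = ((hd y + i) mod 3) # y"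

lemma words_Cons: "a # y \<in> words A \<longleftrightarrow> a \<in> {0, 1, 2} \<and> (if y = [] then a \<in> A else a \<noteq> hd y \<and> y \<in> words A)"
  unfolding words_def by (cases y) auto

lemma three_letters: "(h::nat) \<in> {0, 1, 2} \<Longrightarrow> a \<in> {0, 1, 2} \<Longrightarrow> a \<noteq> h \<longleftrightarrow> a = (h + 1) mod 3 \<or> a = (h + 2) mod 3"
  by (elim insertE emptyE) (simp_all add: mod_Suc numeral_2_eq_2)

lemma words_hd: "y \<in> words A \<Longrightarrow> y \<noteq> [] \<and> hd y \<in> {0, 1, 2}"
  unfolding words_def by (cases y) auto

lemma child_mem: assumes "y \<in> words A" "i \<in> {1, 2}" shows "child i y \<in> words A"
proof -
  have y: "y \<noteq> []" "hd y \<in> {0, 1, 2}" using words_hd[OF assms(1)] by auto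
  then have "(hd y + i) mod 3 \<in> {0, 1, 2}" "(hd y + i) mod 3 \<noteq> hd y"
    using assms(2) by (elim insertE emptyE; simp)+
  then show ?thesis using assms(1) y(1) unfolding child_def words_Cons by simp
qed

lemma words_decomp:
  assumes A: "A \<subseteq> {0, 1, 2}"
  shows "words A = (\<lambda>a. [a]) ` A \<union> (child 1 ` words A \<union> child 2 ` words A)"
proof (intro subset_antisym subsetI)
  fix y assume y: "y \<in> words A"
  then obtain a z where yz: "y = a # z" using words_hd by (cases y) auto
  show "y \<in> (\<lambda>a. [a]) ` A \<union> (child 1 ` words A \<union> child 2 ` words A)"
  proof (cases "z = []")
    case True
    then show ?thesis using y unfolding yz words_Cons by auto
  next
    case False
    then have z: "z \<in> words A" "a \<noteq> hd z" "a \<in> {0, 1, 2}" using y unfolding yz words_Cons by auto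
    then have "a = (hd z + 1) mod 3 \<or> a = (hd z + 2) mod 3" using three_letters[of "hd z" a] words_hd[OF z(1)] by blast
    then show ?thesis using z(1) unfolding yz child_def by auto
  qed
next
  fix y assume "y \<in> (\<lambda>a. [a]) ` A \<union> (child 1 ` words A \<union> child 2 ` words A)"
  then show "y \<in> words A" using child_mem A by (auto simp: words_Cons)
qed

lemma child_disjoint: "child 1 ` words A \<inter> child 2 ` words A = {}"
proof -
  have "child 1 y \<noteq> child 2 z" if "y \<in> words A" for y z
    using words_hd[OF that] by (auto simp: child_def)
  then show ?thesis by blast
qed

lemma root_disjoint: "(\<lambda>a. [a]) ` A \<inter> (child 1 ` words A \<union> child 2 ` words A) = {}"
  unfolding words_def child_def by auto

lemma inj_child: "inj_on (child i) S" unfolding child_def inj_on_def by simp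

lemma words_sum:
  fixes g :: "nat list \<Rightarrow> real"
  assumes A: "A \<subseteq> {0, 1, 2}" and g: "g summable_on words A"
  shows "(\<lambda>y. g (child 1 y)) summable_on words A" "(\<lambda>y. g (child 2 y)) summable_on words A"
    "(\<Sum>\<^sub>\<infinity>y\<in>words A. g y) = (\<Sum>a\<in>A. g [a]) + (\<Sum>\<^sub>\<infinity>y\<in>words A. g (child 1 y)) + (\<Sum>\<^sub>\<infinity>y\<in>words A. g (child 2 y))"
proof -
  have sub: "g summable_on S" if "S \<subseteq> words A" for S using summable_on_subset_banach[OF g that] .
  have s1: "g summable_on child 1 ` words A" and s2: "g summable_on child 2 ` words A"
    by (rule sub; use child_mem in auto)+
  show c1: "(\<lambda>y. g (child 1 y)) summable_on words A"
    using s1 unfolding summable_on_reindex[OF inj_child] by (simp add: o_def)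
  show c2: "(\<lambda>y. g (child 2 y)) summable_on words A"
    using s2 unfolding summable_on_reindex[OF inj_child] by (simp add: o_def)
  have fin: "finite ((\<lambda>a. [a]) ` A)" using A finite_subset by blast
  have "(\<Sum>\<^sub>\<infinity>y\<in>words A. g y) = infsum g ((\<lambda>a. [a]) ` A) + infsum g (child 1 ` words A \<union> child 2 ` words A)"
    by (subst words_decomp[OF A]) (intro infsum_Un_disjoint summable_on_finite fin summable_on_Un_disjoint s1 s2 child_disjoint root_disjoint)
  also have "infsum g (child 1 ` words A \<union> child 2 ` words A) = infsum g (child 1 ` words A) + infsum g (child 2 ` words A)"
    by (intro infsum_Un_disjoint s1 s2 child_disjoint)
  also have "infsum g (child 1 ` words A) = (\<Sum>\<^sub>\<infinity>y\<in>words A. g (child 1 y))"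
    by (simp add: infsum_reindex[OF inj_child] o_def)
  also have "infsum g (child 2 ` words A) = (\<Sum>\<^sub>\<infinity>y\<in>words A. g (child 2 y))"
    by (simp add: infsum_reindex[OF inj_child] o_def)
  also have "infsum g ((\<lambda>a. [a]) ` A) = (\<Sum>a\<in>A. g [a])"
    using fin by (simp add: sum.reindex inj_on_def)
  finally show "(\<Sum>\<^sub>\<infinity>y\<in>words A. g y) = (\<Sum>a\<in>A. g [a]) + (\<Sum>\<^sub>\<infinity>y\<in>words A. g (child 1 y)) + (\<Sum>\<^sub>\<infinity>y\<in>words A. g (child 2 y))"
    by simp
qed

definition gap :: "'v mgraph \<Rightarrow> ('v point \<Rightarrow> real) \<Rightarrow> real" where
  "gap G u = dirichlet G u - \<omega>\<^sup>2 * mass G u"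

lemma vertex_values_edge:
  "vertex_values (tree A) u f \<Longrightarrow> y \<in> words A \<Longrightarrow> u (edge y, 0) = f (tl y) \<and> u (edge y, 1) = f y"
  unfolding vertex_values_def edge_def using mem_tree by auto

text \<open>
  Summing the edge defects, the boundary terms cancel at every vertex other than the root: the value at
  the end of an edge occurs once with weight \<open>\<surd>2 \<omega>\<close> and, at the start of its two children, twice with weight
  \<open>- \<omega> / \<surd>2\<close>. Only the terms of the root survive.
\<close>

lemma tree_gap_identity:
  assumes A: "A \<subseteq> {0, 1, 2}" and u: "u \<in> H1 (tree A)" and f: "vertex_values (tree A) u f"
  shows "(\<lambda>y. edge_defect (slice u (edge y))) summable_on words A"
    "gap (tree A) u = real (card A) * (\<omega> / sqrt 2) * (f [])\<^sup>2 + (\<Sum>\<^sub>\<infinity>y\<in>words A. edge_defect (slice u (edge y)))"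
proof -
  note G = countable_tree[of A]
  let ?D = "\<lambda>y. edge_dirichlet (slice u (edge y))" and ?M = "\<lambda>y. edge_mass (slice u (edge y))"
  have D: "?D summable_on words A" and M: "?M summable_on words A"
    using H1_summable[OF G u] unfolding tree_summable .
  have DM: "(\<lambda>y. 2 * (?M y + ?D y)) summable_on words A"
    by (intro summable_on_cmult_right summable_on_add M D)
  have sq: "(u (edge y, t))\<^sup>2 \<le> 2 * (?M y + ?D y)" if "y \<in> words A" "t \<in> {0..1}" for y t
    by (rule sobolev_square_le_H1[OF H1_sobolev[OF u]]) (use that edge_mem in auto)
  have f1: "(\<lambda>y. (f y)\<^sup>2) summable_on words A"
    by (rule summable_on_comparison_test[OF DM]) (use sq[of _ 1] vertex_values_edge[OF f] in auto)
  have f0: "(\<lambda>y. (f (tl y))\<^sup>2) summable_on words A"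
    by (rule summable_on_comparison_test[OF DM]) (use sq[of _ 0] vertex_values_edge[OF f] in auto)
  have f0_sum: "(\<Sum>\<^sub>\<infinity>y\<in>words A. (f (tl y))\<^sup>2) = real (card A) * (f [])\<^sup>2 + 2 * (\<Sum>\<^sub>\<infinity>y\<in>words A. (f y)\<^sup>2)"
    using words_sum(3)[OF A f0] by (simp add: child_def)
  have edge_defect_eq: "edge_defect (slice u (edge y)) = ?D y + (- \<omega>\<^sup>2) * ?M y + (sqrt 2 * \<omega>) * (f y)\<^sup>2 + (- \<omega> / sqrt 2) * (f (tl y))\<^sup>2"
    if "y \<in> words A" for y
    unfolding edge_defect_def using vertex_values_edge[OF f that] by simp
  have hs: "((\<lambda>y. ?D y + (- \<omega>\<^sup>2) * ?M y + (sqrt 2 * \<omega>) * (f y)\<^sup>2 + (- \<omega> / sqrt 2) * (f (tl y))\<^sup>2) has_sum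
     (infsum ?D (words A) + (- \<omega>\<^sup>2) * infsum ?M (words A) + (sqrt 2 * \<omega>) * (\<Sum>\<^sub>\<infinity>y\<in>words A. (f y)\<^sup>2) +
       (- \<omega> / sqrt 2) * (\<Sum>\<^sub>\<infinity>y\<in>words A. (f (tl y))\<^sup>2))) (words A)"
    by (intro has_sum_add has_sum_cmult_right has_sum_infsum D M f1 f0)
  then have hs': "((\<lambda>y. edge_defect (slice u (edge y))) has_sum
     (infsum ?D (words A) + (- \<omega>\<^sup>2) * infsum ?M (words A) + (sqrt 2 * \<omega>) * (\<Sum>\<^sub>\<infinity>y\<in>words A. (f y)\<^sup>2) +
       (- \<omega> / sqrt 2) * (\<Sum>\<^sub>\<infinity>y\<in>words A. (f (tl y))\<^sup>2))) (words A)"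
    by (rule has_sum_cong[THEN iffD1, rotated]) (simp add: edge_defect_eq)
  show "(\<lambda>y. edge_defect (slice u (edge y))) summable_on words A" using hs' by (rule has_sum_imp_summable)
  have s2: "\<omega> / sqrt 2 * 2 = sqrt 2 * \<omega>" by (simp add: field_simps)
  have "(\<Sum>\<^sub>\<infinity>y\<in>words A. edge_defect (slice u (edge y))) = gap (tree A) u + (sqrt 2 * \<omega>) * (\<Sum>\<^sub>\<infinity>y\<in>words A. (f y)\<^sup>2) -
       \<omega> / sqrt 2 * (real (card A) * (f [])\<^sup>2) - (\<omega> / sqrt 2 * 2) * (\<Sum>\<^sub>\<infinity>y\<in>words A. (f y)\<^sup>2)"
    using infsumI[OF hs'] unfolding gap_def dirichlet_eq[OF G u] mass_eq[OF G u] tree_sum f0_sum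
    by (simp add: algebra_simps)
  then show "gap (tree A) u = real (card A) * (\<omega> / sqrt 2) * (f [])\<^sup>2 + (\<Sum>\<^sub>\<infinity>y\<in>words A. edge_defect (slice u (edge y)))"
    unfolding s2 by (simp add: algebra_simps)
qed

text \<open>
  From one vertex to the next the function shrinks by \<open>1 / \<surd>2\<close> up to the square root of a defect. The resulting
  geometric series is bounded along every path; \<open>4\<close> exceeds \<open>1 / (1 - 1 / \<surd>2)\<close>.
\<close>

lemma tree_sup_bound:
  assumes A: "A \<subseteq> {0, 1, 2}" and u: "u \<in> H1 (tree A)" and f: "vertex_values (tree A) u f"
    and y: "y \<in> words A" and t: "t \<in> {0..1}"
  shows "0 \<le> gap (tree A) u - real (card A) * (\<omega> / sqrt 2) * (f [])\<^sup>2"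
    "\<bar>u (edge y, t)\<bar> \<le> \<bar>f []\<bar> + 5 * sqrt (gap (tree A) u - real (card A) * (\<omega> / sqrt 2) * (f [])\<^sup>2)"
proof -
  define H where "H = (\<Sum>\<^sub>\<infinity>y\<in>words A. edge_defect (slice u (edge y)))"
  have H_eq: "gap (tree A) u - real (card A) * (\<omega> / sqrt 2) * (f [])\<^sup>2 = H"
    using tree_gap_identity(2)[OF A u f] unfolding H_def by simp
  have sob: "sobolev (slice u (edge z))" if "z \<in> words A" for z
    using H1_sobolev[OF u] edge_mem that by blast
  have eH0: "0 \<le> edge_defect (slice u (edge z))" if "z \<in> words A" for z by (rule edge_inequality(1)[OF sob[OF that]])
  have "0 \<le> H" unfolding H_def by (rule infsum_nonneg) (rule eH0)
  then show "0 \<le> gap (tree A) u - real (card A) * (\<omega> / sqrt 2) * (f [])\<^sup>2" using H_eq by simp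
  have edge_defect_le: "sqrt (edge_defect (slice u (edge z))) \<le> sqrt H" if "z \<in> words A" for z
    using finite_sum_le_infsum[OF tree_gap_identity(1)[OF A u f], of "{z}"] eH0 that unfolding H_def by simp
  have step: "\<bar>u (edge z, s)\<bar> \<le> profile s * \<bar>f (tl z)\<bar> + sqrt H" if "z \<in> words A" "s \<in> {0..1}" for z s
  proof -
    have "\<bar>u (edge z, s)\<bar> \<le> profile s * \<bar>f (tl z)\<bar> + sqrt (edge_defect (slice u (edge z)))"
      using edge_inequality(2)[OF sob[OF that(1)] that(2)] vertex_values_edge[OF f that(1)] by simp
    also have "\<dots> \<le> profile s * \<bar>f (tl z)\<bar> + sqrt H" by (rule add_left_mono[OF edge_defect_le[OF that(1)]])
    finally show ?thesis .
  qed
  have four: "(1 / sqrt 2) * (a + 4 * s) + s \<le> a + 4 * s" if "0 \<le> a" "0 \<le> s" for a s :: real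
  proof -
    have r: "1 / sqrt 2 \<le> (3 / 4 :: real)"
    proof -
      have "4 / 3 \<le> sqrt (2::real)" by (rule real_le_rsqrt) (simp add: power2_eq_square)
      then show ?thesis by (simp add: field_simps)
    qed
    have "(1 / sqrt 2) * (a + 4 * s) \<le> 3 / 4 * (a + 4 * s)"
      by (rule mult_right_mono[OF r]) (use that in simp)
    also have "\<dots> \<le> a + 3 * s" using that by (simp add: field_simps)
    finally show ?thesis by simp
  qed
  have vert: "\<bar>f z\<bar> \<le> \<bar>f []\<bar> + 4 * sqrt H" if "z = [] \<or> z \<in> words A" for z
    using that
  proof (induction z)
    case Nil
    then show ?case using \<open>0 \<le> H\<close> by simp
  next
    case (Cons a z)
    then have w: "a # z \<in> words A" by simp
    then have IH: "\<bar>f z\<bar> \<le> \<bar>f []\<bar> + 4 * sqrt H" using Cons.IH unfolding words_Cons by (auto split: if_splits)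
    have "\<bar>f (a # z)\<bar> \<le> (1 / sqrt 2) * \<bar>f z\<bar> + sqrt H"
      using step[OF w, of 1] vertex_values_edge[OF f w] by (simp add: profile_1)
    also have "\<dots> \<le> (1 / sqrt 2) * (\<bar>f []\<bar> + 4 * sqrt H) + sqrt H"
      using mult_left_mono[OF IH, of "1 / sqrt 2"] by simp
    also have "\<dots> \<le> \<bar>f []\<bar> + 4 * sqrt H" by (rule four) (use \<open>0 \<le> H\<close> in auto)
    finally show ?case .
  qed
  have tl: "tl y = [] \<or> tl y \<in> words A"
    using y words_hd[OF y] by (cases y) (auto simp: words_Cons split: if_splits)
  have "profile t * \<bar>f (tl y)\<bar> \<le> 1 * \<bar>f (tl y)\<bar>"
    using profile_decreasing[of 0 t] t profile_0 by (intro mult_right_mono) auto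
  then have "\<bar>u (edge y, t)\<bar> \<le> \<bar>f (tl y)\<bar> + sqrt H" using step[OF y t] by simp
  also have "\<dots> \<le> \<bar>f []\<bar> + 5 * sqrt H" using vert[OF tl] by simp
  finally show "\<bar>u (edge y, t)\<bar> \<le> \<bar>f []\<bar> + 5 * sqrt (gap (tree A) u - real (card A) * (\<omega> / sqrt 2) * (f [])\<^sup>2)"
    unfolding H_eq .
qed

lemma gap_nonneg:
  assumes A: "A \<subseteq> {0, 1, 2}" and u: "u \<in> H1 (tree A)"
  shows "0 \<le> gap (tree A) u"
proof -
  obtain f where f: "vertex_values (tree A) u f" using vertex_values_exist[OF u] by blast
  have "0 \<le> (\<Sum>\<^sub>\<infinity>y\<in>words A. edge_defect (slice u (edge y)))"
    by (rule infsum_nonneg, rule edge_inequality(1), rule H1_sobolev[OF u]) (simp add: edge_mem)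
  then show ?thesis unfolding tree_gap_identity(2)[OF A u f] using omega_pos by simp
qed

text \<open>
  From \<open>tree_sup_bound\<close>: \<open>50 = 2 \<cdot> 5\<^sup>2\<close> for the defects, \<open>2 \<surd>2 / \<omega>\<close> for the value at the root.
\<close>

definition Ksup :: real where "Ksup = 2 * sqrt 2 / \<omega> + 50"

lemma Ksup_pos: "0 < Ksup" unfolding Ksup_def using omega_pos by (intro add_pos_pos) auto

text \<open>
  At the bottom of the spectrum the gap still controls the supremum. For \<open>4 \<le> p\<close> this makes the power
  integral small compared with the gap at small masses.
\<close>

lemma gap_controls_sup:
  assumes A: "A \<subseteq> {0, 1, 2}" "A \<noteq> {}" and u: "u \<in> H1 (tree A)" and e: "e \<in> tree A" and t: "t \<in> {0..1}"
  shows "(u (e, t))\<^sup>2 \<le> Ksup * gap (tree A) u"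
proof -
  obtain f where f: "vertex_values (tree A) u f" using vertex_values_exist[OF u] by blast
  obtain y where y: "y \<in> words A" "e = edge y" using e unfolding tree_eq_image by blast
  define H where "H = gap (tree A) u - real (card A) * (\<omega> / sqrt 2) * (f [])\<^sup>2"
  note b = tree_sup_bound[OF A(1) u f y(1) t, folded H_def y(2)]
  have "real (card A) \<ge> 1"
    using A finite_subset[OF A(1)] by (simp add: Suc_le_eq card_gt_0_iff)
  then have "\<omega> / sqrt 2 * (f [])\<^sup>2 \<le> real (card A) * (\<omega> / sqrt 2 * (f [])\<^sup>2)"
    using omega_pos mult_right_mono[of 1 "real (card A)" "\<omega> / sqrt 2 * (f [])\<^sup>2"] by simp
  then have 1: "\<omega> / sqrt 2 * (f [])\<^sup>2 + H \<le> gap (tree A) u" unfolding H_def by (simp add: mult.assoc)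
  have "(u (e, t))\<^sup>2 \<le> (\<bar>f []\<bar> + 5 * sqrt H)\<^sup>2"
    using b by (intro power2_le_iff_abs_le[THEN iffD2]) auto
  also have "\<dots> \<le> 2 * (f [])\<^sup>2 + 50 * H"
  proof -
    have "(\<bar>f []\<bar> + 5 * sqrt H)\<^sup>2 + (\<bar>f []\<bar> - 5 * sqrt H)\<^sup>2 = 2 * \<bar>f []\<bar>\<^sup>2 + 50 * (sqrt H)\<^sup>2"
      by (simp add: power2_eq_square algebra_simps)
    then have "(\<bar>f []\<bar> + 5 * sqrt H)\<^sup>2 + (\<bar>f []\<bar> - 5 * sqrt H)\<^sup>2 = 2 * (f [])\<^sup>2 + 50 * H"
      using b(1) by simp
    then show ?thesis using zero_le_power2[of "\<bar>f []\<bar> - 5 * sqrt H"] by linarith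
  qed
  also have "2 * (f [])\<^sup>2 = 2 * sqrt 2 / \<omega> * (\<omega> / sqrt 2 * (f [])\<^sup>2)" using omega_pos by simp
  also have "2 * sqrt 2 / \<omega> * (\<omega> / sqrt 2 * (f [])\<^sup>2) + 50 * H \<le> Ksup * (\<omega> / sqrt 2 * (f [])\<^sup>2) + Ksup * H"
    using omega_pos b(1) unfolding Ksup_def by (intro add_mono mult_right_mono) auto
  also have "\<dots> \<le> Ksup * gap (tree A) u"
    using 1 Ksup_pos unfolding distrib_left[symmetric] by (intro mult_left_mono) auto
  finally show ?thesis .
qed

section \<open>The bottom of the spectrum\<close>

definition level :: "nat set \<Rightarrow> nat \<Rightarrow> nat list set" where "level A n = {y \<in> words A. length y = Suc n}"

lemma level_Suc:
  assumes A: "A \<subseteq> {0, 1, 2}" shows "level A (Suc n) = child 1 ` level A n \<union> child 2 ` level A n"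
proof (intro subset_antisym subsetI)
  fix y assume y: "y \<in> level A (Suc n)"
  have "y \<in> (\<lambda>a. [a]) ` A \<union> (child 1 ` words A \<union> child 2 ` words A)"
    using y unfolding level_def by (subst words_decomp[OF A, symmetric]) simp
  moreover have "y \<notin> (\<lambda>a. [a]) ` A" using y unfolding level_def by auto
  ultimately obtain i z where iz: "i = 1 \<or> i = 2" "z \<in> words A" "y = child i z" by blast
  then have "z \<in> level A n" using y unfolding level_def child_def by simp
  then show "y \<in> child 1 ` level A n \<union> child 2 ` level A n" using iz by blast
next
  fix y assume "y \<in> child 1 ` level A n \<union> child 2 ` level A n"
  then obtain i z where iz: "i \<in> {1, 2}" "z \<in> level A n" "y = child i z" by blast
  then have "child i z \<in> words A" by (intro child_mem) (auto simp: level_def)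
  moreover have "length (child i z) = Suc (Suc n)" using iz(2) by (simp add: child_def level_def)
  ultimately show "y \<in> level A (Suc n)" unfolding level_def iz(3) by simp
qed

lemma level_card:
  assumes A: "A \<subseteq> {0, 1, 2}" shows "finite (level A n) \<and> card (level A n) = card A * 2 ^ n"
proof (induction n)
  case 0
  have "level A 0 = (\<lambda>a. [a]) ` A"
    using A unfolding level_def words_def by (auto simp: length_Suc_conv)
  then show ?case using A finite_subset[OF A] by (simp add: card_image inj_on_def)
next
  case (Suc n)
  have "child 1 ` level A n \<inter> child 2 ` level A n = {}"
    using child_disjoint[of A] unfolding level_def by auto
  then show ?case
    unfolding level_Suc[OF A] using Suc by (simp add: card_Un_disjoint card_image[OF inj_child])
qed

text \<open>
  The eigenfunction of the tree, cut off linearly in generation \<open>N\<close>. It is not square integrable before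
  the cutoff: every generation carries the same mass.
\<close>

definition truncated_profile :: "nat \<Rightarrow> nat list point \<Rightarrow> real" where
  "truncated_profile N = (\<lambda>((x, y), t). if length x < N then (1 / sqrt 2) ^ length x * profile t
     else if length x = N then (1 / sqrt 2) ^ N * (1 - t) else 0)"

lemma sobolev_prof: "sobolev profile" unfolding sobolev_def by (rule exI[of _ profile']) (rule has_L2_deriv_prof)

lemma sobolev_ramp: "sobolev (\<lambda>t. 1 - t)" "edge_dirichlet (\<lambda>t. 1 - t) = 1" "edge_mass (\<lambda>t. 1 - t) = 1 / 3"
proof -
  have d: "has_L2_deriv (\<lambda>t. 1 - t) (\<lambda>t. -1)"
    by (rule has_L2_deriv_C1) (auto intro!: derivative_eq_intros)
  show "sobolev (\<lambda>t. 1 - t)" unfolding sobolev_def by (rule exI[of _ "\<lambda>t. -1"]) (rule d)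
  show "edge_dirichlet (\<lambda>t. 1 - t) = 1" unfolding edge_dirichlet_eq[OF d] by (simp add: measure_unit)
  have "prim (\<lambda>t. (1 - t)\<^sup>2) 1 = (\<lambda>t. - ((1 - t) ^ 3) / 3) 1 - (\<lambda>t. - ((1 - t) ^ 3) / 3 :: real) 0"
    by (rule prim_deriv) (auto intro!: derivative_eq_intros continuous_intros simp: power2_eq_square)
  then show "edge_mass (\<lambda>t. 1 - t) = 1 / 3" unfolding edge_mass_def prim_1 by simp
qed

lemma sobolev_zero: "sobolev (\<lambda>t. 0)" "edge_dirichlet (\<lambda>t. 0) = 0" "edge_mass (\<lambda>t. 0) = 0"
  using sobolev_scale[OF sobolev_prof, of 0] by simp_all

lemma edge_mass_prof_pos: "0 < edge_mass profile"
proof -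
  have "edge_mass profile \<noteq> 0"
    using integral_continuous_zero[of "\<lambda>t. (profile t)\<^sup>2" 0] profile_0
    by (auto simp: edge_mass_def intro!: continuous_intros profile_continuous)
  then show ?thesis using edge_mass_nonneg[of profile] by simp
qed

lemma sqrt_half_power: "((1 / sqrt 2) ^ n)\<^sup>2 = (1 / 2 :: real) ^ n"
  by (simp add: power_mult[symmetric] mult.commute[of n] power_mult power_divide)

text \<open>
  For the truncated eigenfunction the gap comes from the last generation only and stays bounded, while the
  mass grows linearly with the number of generations.
\<close>

lemma small_gap_exists:
  assumes A: "A \<subseteq> {0, 1, 2}" "A \<noteq> {}" and \<epsilon>: "0 < \<epsilon>"
  shows "\<exists>u\<in>H1 (tree A). 0 < mass (tree A) u \<and> gap (tree A) u \<le> \<epsilon> * mass (tree A) u"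
proof -
  define m where "m = edge_mass profile"
  have m: "0 < m" unfolding m_def by (rule edge_mass_prof_pos)
  obtain N :: nat where N1: "3 / (\<epsilon> * m) < real N" using reals_Archimedean2 by blast
  have "0 < 3 / (\<epsilon> * m)" using \<epsilon> m by simp
  then have N: "N > 0" "3 / (\<epsilon> * m) \<le> real N"
    using order_less_trans[OF _ N1, of 0] N1 by simp_all
  define u where "u = truncated_profile N"
  have sl: "slice u (edge y) = (if n < N then (\<lambda>t. (1 / sqrt 2) ^ n * profile t)
      else if n = N then (\<lambda>t. (1 / sqrt 2) ^ N * (1 - t)) else (\<lambda>t. 0))" if "length y = Suc n" for y n
    using that unfolding u_def truncated_profile_def edge_def by auto
  have len: "\<exists>n. length y = Suc n" if "y \<in> words A" for y using words_hd[OF that] by (cases y) auto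
  have sob: "sobolev (slice u (edge y))" if y: "y \<in> words A" for y
  proof -
    obtain n where n: "length y = Suc n" using len[OF y] by blast
    show ?thesis unfolding sl[OF n]
      using sobolev_scale(1)[OF sobolev_prof] sobolev_scale(1)[OF sobolev_ramp(1)] sobolev_zero(1) by simp
  qed
  have D: "edge_dirichlet (slice u (edge y)) = (if n < N then (1 / 2) ^ n * \<omega>\<^sup>2 * m else if n = N then (1 / 2) ^ N else 0)" if "length y = Suc n" for y n
    unfolding sl[OF that] m_def
    using sobolev_scale(2)[OF sobolev_prof] sobolev_scale(2)[OF sobolev_ramp(1)] sobolev_zero(2) profile_integral_zero sqrt_half_power
    by (simp add: sobolev_ramp)
  have M: "edge_mass (slice u (edge y)) = (if n < N then (1 / 2) ^ n * m else if n = N then (1 / 2) ^ N / 3 else 0)" if "length y = Suc n" for y n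
    unfolding sl[OF that] m_def
    using sobolev_scale(3)[OF sobolev_prof] sobolev_scale(3)[OF sobolev_ramp(1)] sobolev_zero(3) sqrt_half_power
    by (simp add: sobolev_ramp)
  \<comment> \<open>outside this finite set of edges the function vanishes\<close>
  define T where "T = (\<Union>n\<le>N. level A n)"
  have T: "finite T" "T \<subseteq> words A" unfolding T_def using level_card[OF A(1)] by (auto simp: level_def)
  have out: "edge_dirichlet (slice u (edge y)) = 0 \<and> edge_mass (slice u (edge y)) = 0" if y: "y \<in> words A - T" for y
  proof -
    obtain n where n: "length y = Suc n" using len y by blast
    then have "n > N" using y unfolding T_def level_def by (auto simp: not_le)
    then show ?thesis unfolding D[OF n] M[OF n] by simp
  qed
  have summ: "g summable_on words A" if "\<And>y. y \<in> words A - T \<Longrightarrow> g y = 0" for g :: "nat list \<Rightarrow> real"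
  proof -
    have "g summable_on T" using T(1) by (rule summable_on_finite)
    then show ?thesis by (rule summable_on_cong_neutral[THEN iffD1, rotated -1]) (use that T(2) in auto)
  qed
  have "cont_on_graph (tree A) u"
    unfolding cont_on_graph_def
  proof (intro conjI ballI exI)
    fix e assume "e \<in> tree A"
    then obtain y where y: "y \<in> words A" "e = edge y" unfolding tree_eq_image by blast
    show "continuous_on {0..1} (slice u e)" unfolding y(2) by (rule sobolev_continuous[OF sob[OF y(1)]])
    let ?f = "\<lambda>x. if length x \<le> N then (1 / sqrt 2) ^ length x else (0 :: real)"
    show "case e of (v, w) \<Rightarrow> u ((v, w), 0) = ?f v \<and> u ((v, w), 1) = ?f w"
      using words_hd[OF y(1)] unfolding y(2) edge_def u_def truncated_profile_def
      by (cases y) (auto simp: profile_0 profile_1)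
  qed
  moreover have "(\<lambda>e. edge_dirichlet (slice u e) + edge_mass (slice u e)) summable_on tree A"
    unfolding tree_summable by (rule summ) (use out in simp)
  ultimately have u: "u \<in> H1 (tree A)"
    unfolding H1_iff[OF countable_tree] using sob by (auto simp: tree_eq_image)
  have sums: "(\<Sum>\<^sub>\<infinity>y\<in>words A. g y) = sum g T" if "\<And>y. y \<in> words A - T \<Longrightarrow> g y = 0" for g :: "nat list \<Rightarrow> real"
  proof -
    have "(\<Sum>\<^sub>\<infinity>y\<in>words A. g y) = infsum g T" by (rule infsum_cong_neutral) (use that T(2) in auto)
    then show ?thesis using T(1) by simp
  qed
  have T_sum: "sum g T = (\<Sum>n\<le>N. \<Sum>y\<in>level A n. g y)" for g :: "nat list \<Rightarrow> real"
    unfolding T_def using level_card[OF A(1)] by (intro sum.UNION_disjoint) (auto simp: level_def)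
  have dir: "dirichlet (tree A) u = (\<Sum>y\<in>T. edge_dirichlet (slice u (edge y)))"
    unfolding dirichlet_eq[OF countable_tree u] tree_sum by (rule sums) (use out in simp)
  have mas: "mass (tree A) u = (\<Sum>y\<in>T. edge_mass (slice u (edge y)))"
    unfolding mass_eq[OF countable_tree u] tree_sum by (rule sums) (use out in simp)
  have "gap (tree A) u = (\<Sum>y\<in>T. edge_dirichlet (slice u (edge y)) - \<omega>\<^sup>2 * edge_mass (slice u (edge y)))"
    unfolding gap_def dir mas by (simp add: sum_subtractf sum_distrib_left)
  also have "\<dots> = (\<Sum>n\<le>N. \<Sum>y\<in>level A n. if n = N then (1 / 2) ^ N * (1 - \<omega>\<^sup>2 / 3) else 0)"
    unfolding T_sum
  proof (intro sum.cong refl)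
    fix n y assume "n \<in> {..N}" "y \<in> level A n"
    then have n: "length y = Suc n" "n \<le> N" unfolding level_def by auto
    show "edge_dirichlet (slice u (edge y)) - \<omega>\<^sup>2 * edge_mass (slice u (edge y)) = (if n = N then (1 / 2) ^ N * (1 - \<omega>\<^sup>2 / 3) else 0)"
      unfolding D[OF n(1)] M[OF n(1)] using n(2) by (auto simp: algebra_simps)
  qed
  also have "\<dots> = (\<Sum>n\<le>N. if n = N then real (card (level A N)) * ((1 / 2) ^ N * (1 - \<omega>\<^sup>2 / 3)) else 0)"
    by (intro sum.cong) auto
  also have "\<dots> = real (card A) * (1 - \<omega>\<^sup>2 / 3)"
    using level_card[OF A(1), of N] by (simp add: power_one_over)
  also have "\<dots> \<le> 3 * 1"
  proof (rule mult_mono)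
    have "sqrt 2 \<le> (2 :: real)" by (rule real_le_lsqrt) auto
    then have "\<omega> \<le> 1" using omega_le by simp
    then have "\<omega>\<^sup>2 \<le> 1" using omega_pos by (intro power_le_one) auto
    then show "0 \<le> 1 - \<omega>\<^sup>2 / 3" by simp
    show "real (card A) \<le> 3" using card_mono[OF _ A(1)] by simp
  qed (auto simp: omega_pos)
  finally have g3: "gap (tree A) u \<le> 3" by simp
  have cA: "1 \<le> real (card A)" using A finite_subset[OF A(1)] by (simp add: Suc_le_eq card_gt_0_iff)
  have "real N * m \<le> (\<Sum>n<N. real (card A) * m)"
    using cA m mult_right_mono[OF cA, of "real N * m"] by (simp add: algebra_simps)
  also have "\<dots> = (\<Sum>n<N. \<Sum>y\<in>level A n. (1 / 2) ^ n * m)"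
    using level_card[OF A(1)] by (intro sum.cong) (auto simp: power_one_over)
  also have "\<dots> = (\<Sum>n<N. \<Sum>y\<in>level A n. edge_mass (slice u (edge y)))"
    by (intro sum.cong refl) (simp add: level_def M)
  also have "\<dots> \<le> mass (tree A) u"
    unfolding mas T_sum by (rule sum_mono2) (auto intro!: sum_nonneg edge_mass_nonneg)
  finally have mN: "real N * m \<le> mass (tree A) u" .
  have "3 \<le> \<epsilon> * (real N * m)" using N(2) \<epsilon> m by (simp add: field_simps)
  also have "\<dots> \<le> \<epsilon> * mass (tree A) u" using mN \<epsilon> by (intro mult_left_mono) auto
  finally have "gap (tree A) u \<le> \<epsilon> * mass (tree A) u" using g3 by simp
  moreover have "0 < mass (tree A) u" using mN N(1) m by (meson less_le_trans mult_pos_pos of_nat_0_less_iff)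
  ultimately show ?thesis using u by blast
qed

lemma mass_pos:
  assumes G: "countable G" and u: "u \<in> H1 G" and e: "e \<in> G" and t: "t \<in> {0..1}" and nz: "u (e, t) \<noteq> 0"
  shows "0 < mass G u"
proof -
  have "edge_mass (slice u e) \<noteq> 0"
    using integral_continuous_zero[OF continuous_on_power[OF sobolev_continuous[OF H1_sobolev[OF u e]], of 2], of t] nz t
    by (auto simp: edge_mass_def)
  then show ?thesis using edge_mass_nonneg[of "slice u e"] H1_term_le(2)[OF G u e] by linarith
qed

lemma lambda1_eq: "lambda1 = \<omega>\<^sup>2"
proof -
  let ?T = "unrooted_tree"
  let ?S = "{dirichlet ?T u / mass ?T u | u. u \<in> H1 ?T \<and> (\<exists>e\<in>?T. \<exists>t\<in>{0..1}. u (e, t) \<noteq> 0)}"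
  have A: "{0, 1, 2} \<subseteq> {0, 1, 2 :: nat}" "{0, 1, 2 :: nat} \<noteq> {}" by auto
  have cT: "countable ?T" by (rule countableI_type)
  have lower: "\<omega>\<^sup>2 \<le> x" if x: "x \<in> ?S" for x
  proof -
    obtain u where u: "x = dirichlet ?T u / mass ?T u" "u \<in> H1 ?T" "\<exists>e\<in>?T. \<exists>t\<in>{0..1}. u (e, t) \<noteq> 0"
      using x by blast
    have "0 < mass ?T u" using mass_pos[OF cT] u(2,3) by blast
    moreover have "\<omega>\<^sup>2 * mass ?T u \<le> dirichlet ?T u"
      using gap_nonneg[OF A(1), of u] u(2) unfolding unrooted_tree_eq gap_def by simp
    ultimately show ?thesis unfolding u(1) by (simp add: pos_le_divide_eq)
  qed
  have upper: "\<exists>x\<in>?S. x \<le> \<omega>\<^sup>2 + \<epsilon>" if \<epsilon>: "0 < \<epsilon>" for \<epsilon>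
  proof -
    obtain u where u: "u \<in> H1 ?T" "0 < mass ?T u" "gap ?T u \<le> \<epsilon> * mass ?T u"
      using small_gap_exists[OF A \<epsilon>] unfolding unrooted_tree_eq by blast
    have "\<exists>e\<in>?T. \<exists>t\<in>{0..1}. u (e, t) \<noteq> 0"
    proof (rule ccontr)
      assume "\<not> ?thesis"
      then have "edge_mass (slice u e) = 0" if "e \<in> ?T" for e
        using that sobolev_cong(3)[of "slice u e" "\<lambda>t. 0"] sobolev_zero(3) by auto
      then have "mass ?T u = 0" unfolding mass_eq[OF cT u(1)] by (intro infsum_0)
      then show False using u(2) by simp
    qed
    then have "dirichlet ?T u / mass ?T u \<in> ?S" using u(1) by blast
    moreover have "dirichlet ?T u / mass ?T u \<le> \<omega>\<^sup>2 + \<epsilon>"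
      using u(2,3) unfolding gap_def by (simp add: field_simps)
    ultimately show ?thesis by blast
  qed
  have ne: "?S \<noteq> {}" using upper[of 1] by auto
  have bdd: "bdd_below ?S" using lower by (rule bdd_belowI)
  have "Inf ?S \<le> \<omega>\<^sup>2"
  proof (rule field_le_epsilon)
    fix \<epsilon> :: real assume "0 < \<epsilon>"
    then obtain x where "x \<in> ?S" "x \<le> \<omega>\<^sup>2 + \<epsilon>" using upper by blast
    then show "Inf ?S \<le> \<omega>\<^sup>2 + \<epsilon>" using cInf_lower[OF _ bdd] by fastforce
  qed
  moreover have "\<omega>\<^sup>2 \<le> Inf ?S" by (rule cInf_greatest[OF ne lower])
  ultimately show ?thesis unfolding lambda1_def by simp
qed

section \<open>Scaling and the critical mass\<close>

text \<open>
  The energy minus \<open>\<lambda>\<^sub>1 / 2\<close> times the mass. The ground level lies strictly below the line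
  \<open>\<mu> \<mapsto> \<lambda>\<^sub>1 \<mu> / 2\<close> exactly where the excess takes negative values.
\<close>

definition excess :: "real \<Rightarrow> 'v mgraph \<Rightarrow> ('v point \<Rightarrow> real) \<Rightarrow> real" where
  "excess p G u = gap G u / 2 - power_integral p G u / p"

lemma omega2_le_1: "\<omega>\<^sup>2 \<le> 1"
proof -
  have "sqrt 2 \<le> (2 :: real)" by (rule real_le_lsqrt) auto
  then have "\<omega> \<le> 1" using omega_le by simp
  then show ?thesis using omega_pos by (intro power_le_one) auto
qed

lemma energy_excess:
  assumes "countable G" "u \<in> H1 G" "2 < p"
  shows "energy p G u = 1 / 2 * lambda1 * mass G u + excess p G u"
  unfolding energy_eq[OF assms] excess_def gap_def lambda1_eq by (simp add: field_simps)

lemma gap_scale: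
  assumes "countable G" "u \<in> H1 G" shows "gap G (\<lambda>z. a * u z) = a\<^sup>2 * gap G u"
  using H1_scale(2,3)[OF assms, of 3] unfolding gap_def by (simp add: algebra_simps)

lemma excess_scale:
  assumes "countable G" "u \<in> H1 G" "2 < p"
  shows "excess p G (\<lambda>z. a * u z) = a\<^sup>2 * gap G u / 2 - \<bar>a\<bar> powr p * power_integral p G u / p"
  unfolding excess_def gap_scale[OF assms(1,2)] H1_scale(4)[OF assms] by simp

text \<open>
  The quadratic part scales with \<open>\<theta>\<close>, the power part with the larger \<open>\<theta> powr (p / 2)\<close>.
\<close>

lemma excess_scale_up:
  assumes "countable G" "u \<in> H1 G" "2 < p" "1 \<le> \<theta>"
  shows "excess p G (\<lambda>z. sqrt \<theta> * u z) = \<theta> * (excess p G u - (\<theta> powr ((p - 2) / 2) - 1) * power_integral p G u / p)"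
proof -
  have "sqrt \<theta> powr p = \<theta> powr (p / 2)" using assms(4) by (simp add: powr_half_sqrt[symmetric] powr_powr)
  also have "p / 2 = 1 + (p - 2) / 2" by (simp add: field_simps)
  also have "\<theta> powr (1 + (p - 2) / 2) = \<theta> * \<theta> powr ((p - 2) / 2)" using assms(4) by (simp add: powr_add)
  finally have "\<bar>sqrt \<theta>\<bar> powr p = \<theta> * \<theta> powr ((p - 2) / 2)" using assms(4) by simp
  then show ?thesis unfolding excess_scale[OF assms(1-3)] using assms(3,4)
    by (simp add: excess_def field_simps)
qed

lemma mass_normalize:
  assumes G: "countable G" and u: "u \<in> H1 G" and m: "0 < mass G u" and "0 \<le> \<mu>"
  shows "mass G (\<lambda>z. sqrt (\<mu> / mass G u) * u z) = \<mu>"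
  using H1_scale(3)[OF G u, of 3] m assms(4) by simp

lemma power_integral_pos:
  assumes G: "countable G" and u: "u \<in> H1 G" and m: "0 < mass G u" and p: "2 < p"
  shows "0 < power_integral p G u"
proof (rule ccontr)
  assume "\<not> ?thesis"
  then have z: "power_integral p G u = 0" using power_integral_nonneg[of p G u] by simp
  have "edge_mass (slice u e) = 0" if e: "e \<in> G" for e
  proof -
    have s: "sobolev (slice u e)" by (rule H1_sobolev[OF u e])
    have "edge_power p (slice u e) = 0"
      using finite_sum_le_infsum[OF power_summable[OF G u p], of "{e}"] e z edge_power_nonneg[of p "slice u e"]
      unfolding power_integral_def by (simp add: edge_power_nonneg)
    moreover have "continuous_on {0..1} (\<lambda>t. \<bar>u (e, t)\<bar> powr p)"
      using p by (intro continuous_on_powr' continuous_intros sobolev_continuous[OF s]) auto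
    ultimately have "\<bar>u (e, t)\<bar> powr p = 0" if "t \<in> {0..1}" for t
      using integral_continuous_zero[of "\<lambda>t. \<bar>u (e, t)\<bar> powr p" t] that unfolding edge_power_def by simp
    then have "u (e, t) = 0" if "t \<in> {0..1}" for t using that by simp
    then show ?thesis using sobolev_cong(3)[of "slice u e" "\<lambda>t. 0"] sobolev_zero(3) by simp
  qed
  then have "mass G u = 0" unfolding mass_eq[OF G u] by (intro infsum_0)
  then show False using m by simp
qed

definition negative_excess :: "real \<Rightarrow> 'v mgraph \<Rightarrow> real \<Rightarrow> bool" where
  "negative_excess p G \<mu> \<longleftrightarrow> (\<exists>u\<in>H1 G. mass G u = \<mu> \<and> excess p G u < 0)"

locale binary_tree =
  fixes A :: "nat set" and p :: real
  assumes A: "A \<subseteq> {0, 1, 2}" "A \<noteq> {}" and p: "2 < p" "p < 6"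
begin

abbreviation "T \<equiv> tree A"

lemmas cT = countable_tree[of A]

lemma excess_small:
  assumes "0 \<le> \<mu>" "0 < \<epsilon>" shows "\<exists>u\<in>H1 T. mass T u = \<mu> \<and> excess p T u < \<epsilon>"
proof -
  define \<delta> where "\<delta> = \<epsilon> / (\<mu> + 1)"
  have \<delta>: "0 < \<delta>" using assms by (simp add: \<delta>_def)
  obtain u where u: "u \<in> H1 T" "0 < mass T u" "gap T u \<le> \<delta> * mass T u"
    using small_gap_exists[OF A \<delta>] by blast
  define a where "a = sqrt (\<mu> / mass T u)"
  have m: "mass T (\<lambda>z. a * u z) = \<mu>" unfolding a_def by (rule mass_normalize[OF cT u(1,2) assms(1)])
  have a2: "a\<^sup>2 = \<mu> / mass T u" unfolding a_def using assms u(2) by simp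
  have "gap T (\<lambda>z. a * u z) = \<mu> / mass T u * gap T u" using gap_scale[OF cT u(1)] a2 by simp
  also have "\<dots> \<le> \<mu> / mass T u * (\<delta> * mass T u)" using u assms by (intro mult_left_mono) auto
  also have "\<dots> = \<mu> * \<delta>" using u(2) by simp
  also have "\<dots> \<le> (\<mu> + 1) * \<delta>" using \<delta> by (intro mult_right_mono) auto
  also have "\<dots> = \<epsilon>" using assms by (simp add: \<delta>_def)
  also have "\<dots> < 2 * \<epsilon>" using assms by simp
  finally have "gap T (\<lambda>z. a * u z) < 2 * \<epsilon>" .
  then have "excess p T (\<lambda>z. a * u z) < \<epsilon>"
  proof -
    have "0 \<le> power_integral p T (\<lambda>z. a * u z) / p" using power_integral_nonneg p by (intro divide_nonneg_pos) auto
    moreover assume "gap T (\<lambda>z. a * u z) < 2 * \<epsilon>"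
    ultimately show ?thesis unfolding excess_def by linarith
  qed
  then show ?thesis using H1_scale(1)[OF cT u(1) p(1)] m by blast
qed

lemma ground_level_le: assumes "0 \<le> \<mu>" shows "ground_level p T \<mu> \<le> ereal (1 / 2 * lambda1 * \<mu>)"
proof (rule ereal_le_epsilon2)
  fix \<epsilon> :: real assume "0 < \<epsilon>"
  then obtain u where u: "u \<in> H1 T" "mass T u = \<mu>" "excess p T u < \<epsilon>" using excess_small[OF assms] by blast
  have "ground_level p T \<mu> \<le> ereal (energy p T u)"
    unfolding ground_level_def H1_mass_def by (rule INF_lower) (use u in simp)
  also have "\<dots> \<le> ereal (1 / 2 * lambda1 * \<mu>) + ereal \<epsilon>"
    using u energy_excess[OF cT u(1) p(1)] by simp
  finally show "ground_level p T \<mu> \<le> ereal (1 / 2 * lambda1 * \<mu>) + ereal \<epsilon>" .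
qed

lemma ground_level_less_iff:
  assumes "0 \<le> \<mu>" shows "ground_level p T \<mu> < ereal (1 / 2 * lambda1 * \<mu>) \<longleftrightarrow> negative_excess p T \<mu>"
proof
  assume "negative_excess p T \<mu>"
  then obtain u where u: "u \<in> H1 T" "mass T u = \<mu>" "excess p T u < 0" unfolding negative_excess_def by blast
  have "ground_level p T \<mu> \<le> ereal (energy p T u)"
    unfolding ground_level_def H1_mass_def by (rule INF_lower) (use u in simp)
  also have "\<dots> < ereal (1 / 2 * lambda1 * \<mu>)" using u energy_excess[OF cT u(1) p(1)] by simp
  finally show "ground_level p T \<mu> < ereal (1 / 2 * lambda1 * \<mu>)" .
next
  assume "ground_level p T \<mu> < ereal (1 / 2 * lambda1 * \<mu>)"
  then obtain u where u: "u \<in> H1_mass T \<mu>" "ereal (energy p T u) < ereal (1 / 2 * lambda1 * \<mu>)"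
    unfolding ground_level_def INF_less_iff by blast
  then have "u \<in> H1 T" "mass T u = \<mu>" "excess p T u < 0"
    using energy_excess[OF cT _ p(1), of u] by (auto simp: H1_mass_def)
  then show "negative_excess p T \<mu>" unfolding negative_excess_def by blast
qed

lemma critical_mass_iff: "critical_mass p T \<mu> \<longleftrightarrow> 0 \<le> \<mu> \<and> \<not> negative_excess p T \<mu>"
  unfolding critical_mass_def using ground_level_less_iff[of \<mu>] ground_level_le[of \<mu>] by force

lemma negative_excess_pos: assumes "negative_excess p T \<mu>" shows "0 < \<mu>"
proof -
  obtain u where u: "u \<in> H1 T" "mass T u = \<mu>" "excess p T u < 0" using assms unfolding negative_excess_def by blast
  have "\<mu> \<noteq> 0"
  proof
    assume "\<mu> = 0"
    have "u (e, t) = 0" if "e \<in> T" "t \<in> {0..1}" for e t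
      using mass_pos[OF cT u(1) that] u(2) \<open>\<mu> = 0\<close> by auto
    then have "power_integral p T u \<le> 0 powr (p - 2) * mass T u"
      by (intro power_bound(2)[OF cT u(1) p(1)]) auto
    then have "power_integral p T u \<le> 0" by simp
    moreover have "0 \<le> gap T u" by (rule gap_nonneg[OF A(1) u(1)])
    ultimately show False using u(3) p power_integral_nonneg[of p T u] unfolding excess_def by simp
  qed
  then show ?thesis using u(2) mass_nonneg[of T u] by simp
qed

text \<open>
  Scaling up a function of negative excess makes the excess more negative.
\<close>

lemma negative_excess_mono:
  assumes "negative_excess p T \<mu>" "\<mu> \<le> \<mu>'" shows "negative_excess p T \<mu>'"
proof -
  obtain u where u: "u \<in> H1 T" "mass T u = \<mu>" "excess p T u < 0" using assms unfolding negative_excess_def by blast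
  have \<mu>: "0 < \<mu>" by (rule negative_excess_pos[OF assms(1)])
  define \<theta> where "\<theta> = \<mu>' / \<mu>"
  have \<theta>: "1 \<le> \<theta>" using assms \<mu> by (simp add: \<theta>_def)
  have m: "mass T (\<lambda>z. sqrt \<theta> * u z) = \<mu>'" using mass_normalize[OF cT u(1), of \<mu>'] u(2) \<mu> assms by (simp add: \<theta>_def)
  have "0 \<le> (\<theta> powr ((p - 2) / 2) - 1) * power_integral p T u / p"
    using \<theta> p power_integral_nonneg[of p T u] by (intro divide_nonneg_pos mult_nonneg_nonneg) (auto simp: ge_one_powr_ge_zero)
  then have "excess p T (\<lambda>z. sqrt \<theta> * u z) < 0"
    unfolding excess_scale_up[OF cT u(1) p(1) \<theta>] using \<theta> u(3) by (intro mult_pos_neg) auto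
  then show ?thesis unfolding negative_excess_def using H1_scale(1)[OF cT u(1) p(1)] m by blast
qed

text \<open>
  Scaling down a little keeps the excess negative.
\<close>

lemma negative_excess_open:
  assumes "negative_excess p T \<mu>" shows "\<exists>\<mu>'<\<mu>. negative_excess p T \<mu>'"
proof -
  obtain u where u: "u \<in> H1 T" "mass T u = \<mu>" "excess p T u < 0" using assms unfolding negative_excess_def by blast
  have \<mu>: "0 < \<mu>" by (rule negative_excess_pos[OF assms(1)])
  have "((\<lambda>a. a\<^sup>2 * gap T u / 2 - \<bar>a\<bar> powr p * power_integral p T u / p) \<longlongrightarrow>
      1\<^sup>2 * gap T u / 2 - \<bar>1\<bar> powr p * power_integral p T u / p) (at_left 1)"
    using p by (intro tendsto_intros) auto
  moreover have "1\<^sup>2 * gap T u / 2 - \<bar>1\<bar> powr p * power_integral p T u / p < 0"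
    using u(3) by (simp add: excess_def)
  ultimately have "\<forall>\<^sub>F a in at_left 1. a\<^sup>2 * gap T u / 2 - \<bar>a\<bar> powr p * power_integral p T u / p < 0"
    by (rule order_tendstoD(2))
  moreover have "\<forall>\<^sub>F a in at_left (1::real). a \<in> {0<..<1}" by (rule eventually_at_left_real) simp
  ultimately have "\<forall>\<^sub>F a in at_left 1. excess p T (\<lambda>z. a * u z) < 0 \<and> a \<in> {0<..<1}"
    unfolding excess_scale[OF cT u(1) p(1)] by (rule eventually_conj)
  then obtain a where a: "excess p T (\<lambda>z. a * u z) < 0" "0 < a" "a < 1"
    using eventually_happens[of _ "at_left (1::real)"] by (auto simp: trivial_limit_at_left_real)
  have "a\<^sup>2 < 1" using a by (simp add: power_less_one_iff)
  then have "mass T (\<lambda>z. a * u z) < \<mu>"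
    using H1_scale(3)[OF cT u(1) p(1)] u(2) \<mu> mult_strict_right_mono[of "a\<^sup>2" 1 \<mu>] by simp
  then show ?thesis unfolding negative_excess_def using H1_scale(1)[OF cT u(1) p(1)] a by blast
qed

lemma negative_excess_exists: "\<exists>\<mu>. negative_excess p T \<mu>"
proof -
  obtain u where u: "u \<in> H1 T" "0 < mass T u" using small_gap_exists[OF A zero_less_one] by blast
  define P where "P = power_integral p T u"
  have P: "0 < P" unfolding P_def by (rule power_integral_pos[OF cT u p(1)])
  define \<theta> where "\<theta> = 1 + (1 + p * \<bar>excess p T u\<bar> / P) powr (2 / (p - 2))"
  have x: "1 \<le> 1 + p * \<bar>excess p T u\<bar> / P" using p P by simp
  have \<theta>: "1 \<le> \<theta>" by (simp add: \<theta>_def)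
  have "1 + p * \<bar>excess p T u\<bar> / P = ((1 + p * \<bar>excess p T u\<bar> / P) powr (2 / (p - 2))) powr ((p - 2) / 2)"
  proof -
    have "2 / (p - 2) * ((p - 2) / 2) = 1" using p by simp
    then have "((1 + p * \<bar>excess p T u\<bar> / P) powr (2 / (p - 2))) powr ((p - 2) / 2) = (1 + p * \<bar>excess p T u\<bar> / P) powr 1"
      by (simp only: powr_powr)
    then show ?thesis using x by simp
  qed
  also have "\<dots> < \<theta> powr ((p - 2) / 2)" unfolding \<theta>_def using p by (intro powr_less_mono2) auto
  finally have "p * \<bar>excess p T u\<bar> / P < \<theta> powr ((p - 2) / 2) - 1" by simp
  then have "\<bar>excess p T u\<bar> < (\<theta> powr ((p - 2) / 2) - 1) * P / p" using P p by (simp add: field_simps)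
  then have "excess p T (\<lambda>z. sqrt \<theta> * u z) < 0"
    unfolding excess_scale_up[OF cT u(1) p(1) \<theta>] P_def[symmetric] using \<theta> by (intro mult_pos_neg) auto
  then show ?thesis unfolding negative_excess_def using H1_scale(1)[OF cT u(1) p(1)] by blast
qed

definition \<mu>c :: real where "\<mu>c = Inf {\<mu>. negative_excess p T \<mu>}"

lemma negative_excess_iff: "negative_excess p T \<mu> \<longleftrightarrow> \<mu>c < \<mu>"
proof -
  have ne: "{\<mu>. negative_excess p T \<mu>} \<noteq> {}" using negative_excess_exists by simp
  have bdd: "bdd_below {\<mu>. negative_excess p T \<mu>}" by (rule bdd_belowI[of _ 0]) (auto dest: negative_excess_pos)
  show ?thesis
  proof
    assume "negative_excess p T \<mu>"
    then obtain \<mu>' where "\<mu>' < \<mu>" "negative_excess p T \<mu>'" using negative_excess_open by blast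
    then show "\<mu>c < \<mu>" unfolding \<mu>c_def using cInf_lower[OF _ bdd, of \<mu>'] by simp
  next
    assume "\<mu>c < \<mu>"
    then obtain \<mu>' where "\<mu>' < \<mu>" "negative_excess p T \<mu>'" unfolding \<mu>c_def using cInf_lessD[OF ne] by blast
    then show "negative_excess p T \<mu>" using negative_excess_mono by simp
  qed
qed

lemma \<mu>c_nonneg: "0 \<le> \<mu>c"
  unfolding \<mu>c_def by (rule cInf_greatest) (use negative_excess_exists negative_excess_pos in \<open>auto intro: less_imp_le\<close>)

lemma critical_mass_\<mu>c: "critical_mass p T \<mu> \<longleftrightarrow> 0 \<le> \<mu> \<and> \<mu> \<le> \<mu>c"
  unfolding critical_mass_iff negative_excess_iff by auto

lemma mu_star_eq: "mu_star p T = \<mu>c"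
  unfolding mu_star_def by (rule Greatest_equality) (auto simp: critical_mass_\<mu>c \<mu>c_nonneg)

lemma ground_state_iff:
  "ground_state p T \<mu> u \<longleftrightarrow> u \<in> H1 T \<and> mass T u = \<mu> \<and> (\<forall>v\<in>H1 T. mass T v = \<mu> \<longrightarrow> excess p T u \<le> excess p T v)"
proof -
  have "ereal (energy p T u) = ground_level p T \<mu> \<longleftrightarrow> (\<forall>v\<in>H1_mass T \<mu>. energy p T u \<le> energy p T v)"
    if "u \<in> H1_mass T \<mu>"
  proof
    assume "ereal (energy p T u) = ground_level p T \<mu>"
    then show "\<forall>v\<in>H1_mass T \<mu>. energy p T u \<le> energy p T v"
      unfolding ground_level_def by (metis INF_lower ereal_less_eq(3))
  next
    assume *: "\<forall>v\<in>H1_mass T \<mu>. energy p T u \<le> energy p T v"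
    show "ereal (energy p T u) = ground_level p T \<mu>"
      unfolding ground_level_def
      by (rule antisym) (use * that in \<open>auto intro!: INF_greatest INF_lower\<close>)
  qed
  then show ?thesis
    unfolding ground_state_def by (auto simp: H1_mass_def energy_excess[OF cT _ p(1)])
qed

text \<open>
  A ground state below the critical mass would have excess at most \<open>0\<close>; scaled up to the critical mass its
  excess would be negative.
\<close>

lemma no_ground_state:
  assumes "0 < \<mu>" "\<mu> < \<mu>c" shows "\<not> ground_state p T \<mu> u"
proof
  assume "ground_state p T \<mu> u"
  then have u: "u \<in> H1 T" "mass T u = \<mu>" and min: "\<And>v. v \<in> H1 T \<Longrightarrow> mass T v = \<mu> \<Longrightarrow> excess p T u \<le> excess p T v"
    unfolding ground_state_iff by auto
  have le: "excess p T u \<le> 0"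
  proof (rule field_le_epsilon)
    fix \<epsilon> :: real assume "0 < \<epsilon>"
    then obtain v where "v \<in> H1 T" "mass T v = \<mu>" "excess p T v < \<epsilon>" using excess_small[of \<mu> \<epsilon>] assms by auto
    then show "excess p T u \<le> 0 + \<epsilon>" using min[of v] by simp
  qed
  have P: "0 < power_integral p T u" by (rule power_integral_pos[OF cT u(1) _ p(1)]) (use u assms in simp)
  define \<theta> where "\<theta> = \<mu>c / \<mu>"
  have \<theta>: "1 < \<theta>" using assms by (simp add: \<theta>_def)
  have "1 powr ((p - 2) / 2) < \<theta> powr ((p - 2) / 2)" using \<theta> p by (intro powr_less_mono2) auto
  then have "0 < (\<theta> powr ((p - 2) / 2) - 1) * power_integral p T u / p"
    using P p by (intro divide_pos_pos mult_pos_pos) auto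
  then have "excess p T (\<lambda>z. sqrt \<theta> * u z) < 0"
    using le \<theta> excess_scale_up[OF cT u(1) p(1), of \<theta>] by (simp add: mult_pos_neg)
  moreover have "mass T (\<lambda>z. sqrt \<theta> * u z) = \<mu>c"
    using mass_normalize[OF cT u(1), of \<mu>c] u(2) assms \<mu>c_nonneg by (simp add: \<theta>_def)
  ultimately have "negative_excess p T \<mu>c" unfolding negative_excess_def using H1_scale(1)[OF cT u(1) p(1)] by blast
  then show False unfolding negative_excess_iff by simp
qed

lemma sup_le_sqrt_gap:
  assumes "u \<in> H1 T" "e \<in> T" "t \<in> {0..1}" shows "\<bar>u (e, t)\<bar> \<le> sqrt (Ksup * gap T u)"
  using gap_controls_sup[OF A assms] by (intro real_le_rsqrt) simp

text \<open>
  The power integral is at most the power \<open>p - 2\<close> of the supremum times the mass. If the gap is at most \<open>1\<close>, the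
  supremum is bounded by a multiple of the square root of the gap, and \<open>p - 2 \<ge> 2\<close>; if the gap is larger and the mass
  at most \<open>1\<close>, it is bounded by a multiple of the fourth root of the gap, and \<open>p - 2 \<le> 4\<close>. In both cases the power integral is at most a multiple of gap times mass.
\<close>

lemma \<mu>c_pos: assumes p4: "4 \<le> p" shows "0 < \<mu>c"
proof -
  define K where "K = max (Ksup powr ((p - 2) / 2)) (4 powr ((p - 2) / 2))"
  have K: "0 < K" unfolding K_def by (simp add: less_max_iff_disj)
  define \<mu>0 where "\<mu>0 = min 1 (p / (2 * K))"
  have \<mu>0: "0 < \<mu>0" "\<mu>0 \<le> 1" "K * \<mu>0 \<le> p / 2"
  proof -
    have "K * \<mu>0 \<le> K * (p / (2 * K))" using K by (intro mult_left_mono) (auto simp: \<mu>0_def)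
    then show "K * \<mu>0 \<le> p / 2" using K by simp
  qed (use K p in \<open>auto simp: \<mu>0_def\<close>)
  have "0 \<le> excess p T u" if u: "u \<in> H1 T" and m: "mass T u = \<mu>0" for u
  proof -
    define Q where "Q = gap T u"
    have Q: "0 \<le> Q" unfolding Q_def by (rule gap_nonneg[OF A(1) u])
    have P: "power_integral p T u \<le> K * Q * \<mu>0"
    proof (cases "Q \<le> 1")
      case True
      have "power_integral p T u \<le> sqrt (Ksup * Q) powr (p - 2) * \<mu>0"
        using power_bound(2)[OF cT u p(1) sup_le_sqrt_gap[OF u]] m unfolding Q_def by simp
      also have "sqrt (Ksup * Q) powr (p - 2) = Ksup powr ((p - 2) / 2) * Q powr ((p - 2) / 2)"
        using Q Ksup_pos by (simp add: powr_half_sqrt[symmetric] powr_powr powr_mult)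
      also have "\<dots> \<le> K * Q"
      proof (rule mult_mono)
        have "Q powr ((p - 2) / 2) \<le> Q powr 1" using True Q p4 by (intro powr_mono') auto
        then show "Q powr ((p - 2) / 2) \<le> Q" using Q by simp
      qed (use K in \<open>auto simp: K_def\<close>)
      finally show ?thesis using \<mu>0 by (simp add: mult_right_mono)
    next
      case False
      define S where "S = sqrt (mass T u + 2 * sqrt (mass T u * dirichlet T u))"
      have D: "dirichlet T u \<le> 2 * Q"
      proof -
        have "\<omega>\<^sup>2 * \<mu>0 \<le> 1 * 1" using omega2_le_1 \<mu>0 by (intro mult_mono) auto
        then show ?thesis using False m unfolding Q_def gap_def by simp
      qed
      have "mass T u + 2 * sqrt (mass T u * dirichlet T u) \<le> 1 + 2 * sqrt (1 * (2 * Q))"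
        using D m \<mu>0 dirichlet_nonneg[of T u] by (intro add_mono mult_left_mono real_sqrt_le_mono mult_mono) auto
      also have "\<dots> \<le> sqrt Q + 3 * sqrt Q"
      proof (rule add_mono)
        show "1 \<le> sqrt Q" using False by simp
        have "2 * sqrt 2 \<le> (3::real)" by (rule power2_le_imp_le) (auto simp: power_mult_distrib)
        then show "2 * sqrt (1 * (2 * Q)) \<le> 3 * sqrt Q" using Q by (simp add: real_sqrt_mult mult_right_mono flip: mult.assoc)
      qed
      finally have S2: "mass T u + 2 * sqrt (mass T u * dirichlet T u) \<le> 4 * sqrt Q" by simp
      have S: "\<bar>u (e, t)\<bar> \<le> S" if "e \<in> T" "t \<in> {0..1}" for e t
        unfolding S_def using H1_bounded[OF cT u that] by (intro real_le_rsqrt) simp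
      have "S powr (p - 2) \<le> sqrt (4 * sqrt Q) powr (p - 2)"
        unfolding S_def using S2 p mass_nonneg[of T u] dirichlet_nonneg[of T u] by (intro powr_mono2 real_sqrt_le_mono) auto
      also have "\<dots> = 4 powr ((p - 2) / 2) * Q powr ((p - 2) / 4)"
        using Q by (simp add: powr_half_sqrt[symmetric] powr_powr powr_mult)
      also have "\<dots> \<le> K * Q"
      proof (rule mult_mono)
        have "Q powr ((p - 2) / 4) \<le> Q powr 1" using False p by (intro powr_mono) auto
        then show "Q powr ((p - 2) / 4) \<le> Q" using Q by simp
      qed (use K in \<open>auto simp: K_def\<close>)
      finally have "S powr (p - 2) * \<mu>0 \<le> K * Q * \<mu>0" using \<mu>0 by (intro mult_right_mono) auto
      then show ?thesis using power_bound(2)[OF cT u p(1) S] m by simp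
    qed
    have "K * Q * \<mu>0 \<le> p / 2 * Q" using mult_right_mono[OF \<mu>0(3) Q] by (simp add: ac_simps)
    then have "power_integral p T u / p \<le> Q / 2" using P p by (simp add: field_simps)
    then show ?thesis unfolding excess_def Q_def[symmetric] by simp
  qed
  then have "\<not> negative_excess p T \<mu>0" unfolding negative_excess_def by force
  then show ?thesis using \<mu>0 unfolding negative_excess_iff by simp
qed

text \<open>
  By \<open>H1_bounded\<close> the power integral grows at most like the power \<open>(p - 2) / 4 < 1\<close> of the Dirichlet integral.
\<close>

lemma coercive:
  assumes \<mu>: "0 \<le> \<mu>"
  shows "\<exists>B>0. \<forall>u\<in>H1 T. mass T u \<le> \<mu> \<and> excess p T u \<le> c \<longrightarrow> dirichlet T u \<le> B"
proof -
  define \<beta> where "\<beta> = (p - 2) / 4"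
  have \<beta>: "0 < \<beta>" "\<beta> < 1" using p by (auto simp: \<beta>_def)
  define K where "K = (\<mu> + 2 * sqrt \<mu>) powr ((p - 2) / 2) * \<mu> / p"
  have K: "0 \<le> K" unfolding K_def using \<mu> p by simp
  have "((\<lambda>x. K * x powr (\<beta> - 1)) \<longlongrightarrow> K * 0) at_top"
    by (intro tendsto_intros tendsto_neg_powr filterlim_ident) (use \<beta> in auto)
  then have "\<forall>\<^sub>F x in at_top. K * x powr (\<beta> - 1) < 1 / 4"
    by (intro order_tendstoD(2)) auto
  then obtain B0 where B0: "\<And>x. B0 \<le> x \<Longrightarrow> K * x powr (\<beta> - 1) < 1 / 4"
    unfolding eventually_at_top_linorder by blast
  define B where "B = max (max 1 B0) (4 * (c + \<omega>\<^sup>2 * \<mu> / 2))"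
  have "dirichlet T u \<le> B" if u: "u \<in> H1 T" and m: "mass T u \<le> \<mu>" and ex: "excess p T u \<le> c" for u
  proof (rule ccontr)
    define D where "D = dirichlet T u"
    assume "\<not> dirichlet T u \<le> B"
    then have D: "1 \<le> D" "B0 \<le> D" "4 * (c + \<omega>\<^sup>2 * \<mu> / 2) < D" unfolding B_def D_def by auto
    have m0: "0 \<le> mass T u" by (rule mass_nonneg)
    define S where "S = sqrt (mass T u + 2 * sqrt (mass T u * D))"
    have S: "\<bar>u (e, t)\<bar> \<le> S" if "e \<in> T" "t \<in> {0..1}" for e t
      unfolding S_def D_def using H1_bounded[OF cT u that] by (intro real_le_rsqrt) simp
    have "mass T u + 2 * sqrt (mass T u * D) \<le> \<mu> * sqrt D + 2 * (sqrt \<mu> * sqrt D)"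
    proof (rule add_mono)
      have "mass T u * 1 \<le> \<mu> * sqrt D" using m \<mu> D by (intro mult_mono) auto
      then show "mass T u \<le> \<mu> * sqrt D" by simp
      show "2 * sqrt (mass T u * D) \<le> 2 * (sqrt \<mu> * sqrt D)"
        using m D unfolding real_sqrt_mult by (intro mult_left_mono mult_right_mono real_sqrt_le_mono) auto
    qed
    then have "S powr (p - 2) \<le> sqrt ((\<mu> + 2 * sqrt \<mu>) * sqrt D) powr (p - 2)"
      unfolding S_def using p m0 D by (intro powr_mono2 real_sqrt_le_mono) (auto simp: algebra_simps)
    also have "\<dots> = (\<mu> + 2 * sqrt \<mu>) powr ((p - 2) / 2) * D powr \<beta>"
      using D \<mu> by (simp add: powr_half_sqrt[symmetric] powr_powr powr_mult \<beta>_def)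
    finally have "S powr (p - 2) * mass T u \<le> ((\<mu> + 2 * sqrt \<mu>) powr ((p - 2) / 2) * D powr \<beta>) * \<mu>"
      using m m0 by (intro mult_mono) auto
    then have "power_integral p T u \<le> ((\<mu> + 2 * sqrt \<mu>) powr ((p - 2) / 2) * D powr \<beta>) * \<mu>"
      using power_bound(2)[OF cT u p(1) S] by simp
    then have "power_integral p T u / p \<le> K * D powr \<beta>"
      unfolding K_def using p by (simp add: divide_right_mono field_simps)
    also have "D powr \<beta> = D powr (\<beta> - 1) * D" using D by (simp add: powr_diff)
    also have "K * (D powr (\<beta> - 1) * D) \<le> 1 / 4 * D"
      using mult_right_mono[OF less_imp_le[OF B0[OF D(2)]], of D] D by (simp add: mult.assoc)
    finally have P: "power_integral p T u / p \<le> 1 / 4 * D" .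
    moreover have "\<omega>\<^sup>2 * mass T u \<le> \<omega>\<^sup>2 * \<mu>" using m by (intro mult_left_mono) auto
    moreover have lin: "q \<le> 1 / 4 * D \<Longrightarrow> a \<le> b \<Longrightarrow> D / 4 - b / 2 \<le> (D - a) / 2 - q" for q a b :: real
      by argo
    ultimately have "D / 4 - \<omega>\<^sup>2 * \<mu> / 2 \<le> excess p T u"
      unfolding excess_def gap_def D_def[symmetric] by (intro lin)
    then show False using ex D(3) by argo
  qed
  moreover have "0 < B" by (simp add: B_def less_max_iff_disj)
  ultimately show ?thesis by blast
qed

lemma excess_bounded_below:
  assumes \<mu>: "0 \<le> \<mu>" shows "\<exists>b. \<forall>u\<in>H1 T. mass T u \<le> \<mu> \<longrightarrow> b \<le> excess p T u"
proof -
  obtain B where B: "0 < B" "\<And>u. u \<in> H1 T \<Longrightarrow> mass T u \<le> \<mu> \<Longrightarrow> excess p T u \<le> 0 \<Longrightarrow> dirichlet T u \<le> B"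
    using coercive[OF \<mu>, of 0] by blast
  define S where "S = sqrt (\<mu> + 2 * sqrt (\<mu> * B))"
  have "- (S powr (p - 2) * \<mu> / p) \<le> excess p T u" if u: "u \<in> H1 T" and m: "mass T u \<le> \<mu>" for u
  proof (cases "excess p T u \<le> 0")
    case True
    note D = B(2)[OF u m True]
    have "\<bar>u (e, t)\<bar> \<le> S" if "e \<in> T" "t \<in> {0..1}" for e t
      unfolding S_def
    proof (rule real_le_rsqrt)
      have "mass T u + 2 * sqrt (mass T u * dirichlet T u) \<le> \<mu> + 2 * sqrt (\<mu> * B)"
        using m D \<mu> mass_nonneg[of T u] dirichlet_nonneg[of T u]
        by (intro add_mono mult_left_mono real_sqrt_le_mono mult_mono) auto
      then show "\<bar>u (e, t)\<bar>\<^sup>2 \<le> \<mu> + 2 * sqrt (\<mu> * B)" using H1_bounded[OF cT u that] by simp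
    qed
    then have "power_integral p T u \<le> S powr (p - 2) * mass T u" by (rule power_bound(2)[OF cT u p(1)])
    also have "\<dots> \<le> S powr (p - 2) * \<mu>" using m by (intro mult_left_mono) auto
    finally have "power_integral p T u / p \<le> S powr (p - 2) * \<mu> / p" using p by (simp add: divide_right_mono)
    then show ?thesis unfolding excess_def using gap_nonneg[OF A(1) u] by simp
  next
    case False
    moreover have "0 \<le> S powr (p - 2) * \<mu> / p" using \<mu> p by simp
    ultimately show ?thesis by simp
  qed
  then show ?thesis by blast
qed

end

section \<open>Branches of a tree\<close>

definition branch_words :: "nat set \<Rightarrow> nat list \<Rightarrow> nat list set" where
  "branch_words A w = {y \<in> words A. \<exists>s. y = s @ w}"

text \<open>
  Words of \<open>tree {0}\<close> are mapped to the branch that starts with the edge of \<open>w\<close>. The letter \<open>0\<close> next to the root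
  is replaced by \<open>w\<close>, and the transposition keeps the following letter different from the first letter of \<open>w\<close>.
\<close>

definition graft :: "nat list \<Rightarrow> nat list \<Rightarrow> nat list" where
  "graft w z = (if z = [] then tl w else map (Transposition.transpose 0 (hd w)) (butlast z) @ w)"

definition subtree :: "nat list \<Rightarrow> (nat list point \<Rightarrow> real) \<Rightarrow> nat list point \<Rightarrow> real" where
  "subtree w u = (\<lambda>(e, t). u (map_prod (graft w) (graft w) e, t))"

lemma distinct_adj_append:
  "distinct_adj (xs @ ys) \<longleftrightarrow> distinct_adj xs \<and> distinct_adj ys \<and> (xs = [] \<or> ys = [] \<or> last xs \<noteq> hd ys)"
  by (induction xs) (auto simp: distinct_adj_Cons hd_append)

lemma transpose_letters:
  "a \<in> {0, 1, 2 :: nat} \<Longrightarrow> Transposition.transpose 0 a x \<in> {0, 1, 2} \<longleftrightarrow> x \<in> {0, 1, 2}"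
  by (auto simp: Transposition.transpose_def)

lemma graft_word_iff:
  assumes w: "w \<in> words A"
  shows "map (Transposition.transpose 0 (hd w)) s @ w \<in> words A \<longleftrightarrow> s @ [0] \<in> words {0}"
proof -
  have w0: "w \<noteq> []" "hd w \<in> {0, 1, 2}" using words_hd[OF w] by auto
  define m where "m = map (Transposition.transpose 0 (hd w)) s"
  have 1: "set m \<subseteq> {0, 1, 2} \<longleftrightarrow> set s \<subseteq> {0, 1, 2}"
    unfolding m_def set_map image_subset_iff
    by (simp only: transpose_letters[OF w0(2)] subset_iff Ball_def)
  have 2: "distinct_adj m \<longleftrightarrow> distinct_adj s"
    unfolding m_def by (rule distinct_adj_map_iff) (metis inj_onI transpose_involutory)
  have 3: "s \<noteq> [] \<Longrightarrow> last m \<noteq> hd w \<longleftrightarrow> last s \<noteq> 0"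
    unfolding m_def by (subst last_map) (auto simp: Transposition.transpose_def)
  have 4: "m = [] \<longleftrightarrow> s = []" unfolding m_def by simp
  have 5: "m @ w \<in> words A \<longleftrightarrow> set m \<subseteq> {0, 1, 2} \<and> distinct_adj m \<and> (m = [] \<or> last m \<noteq> hd w)"
    using w w0(1) unfolding words_def mem_Collect_eq distinct_adj_append set_append by auto
  have 6: "s @ [0] \<in> words {0} \<longleftrightarrow> set s \<subseteq> {0, 1, 2} \<and> distinct_adj s \<and> (s = [] \<or> last s \<noteq> 0)"
    unfolding words_def mem_Collect_eq distinct_adj_append set_append by auto
  show ?thesis
  proof (cases "s = []")
    case True
    then show ?thesis using 4 unfolding m_def[symmetric] 5 6 1 2 by simp
  next
    case False
    with 3 have "last m \<noteq> hd w \<longleftrightarrow> last s \<noteq> 0" by blast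
    with False show ?thesis using 4 unfolding m_def[symmetric] 5 6 1 2 by simp
  qed
qed

lemma rooted_word: "z \<in> words {0} \<Longrightarrow> z = butlast z @ [0]"
proof -
  assume "z \<in> words {0}"
  then have "z \<noteq> []" "last z = 0" unfolding words_def by simp_all
  then show ?thesis using append_butlast_last_id[of z] by simp
qed

lemma graft_edge:
  assumes "w \<noteq> []" "z \<in> words {0}" shows "map_prod (graft w) (graft w) (edge z) = edge (graft w z)"
proof -
  obtain s where z: "z = s @ [0]" using rooted_word[OF assms(2)] by blast
  show ?thesis unfolding edge_def z by (cases s) (auto simp: graft_def butlast_append)
qed

lemma graft_bij:
  assumes w: "w \<in> words A"
  shows "bij_betw (map_prod (graft w) (graft w)) (tree {0}) (edge ` branch_words A w)"
proof -
  have w0: "w \<noteq> []" using words_hd[OF w] by auto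
  have g: "graft w (s @ [0]) = map (Transposition.transpose 0 (hd w)) s @ w" for s by (simp add: graft_def)
  have b: "bij_betw (graft w) (words {0}) (branch_words A w)"
  proof (rule bij_betw_imageI)
    show "inj_on (graft w) (words {0})"
    proof (rule inj_onI)
      fix z z' assume z: "z \<in> words {0}" "z' \<in> words {0}" and eq: "graft w z = graft w z'"
      obtain s s' where s: "z = s @ [0]" "z' = s' @ [0]" using rooted_word[OF z(1)] rooted_word[OF z(2)] by blast
      have "map (Transposition.transpose 0 (hd w)) s = map (Transposition.transpose 0 (hd w)) s'" using eq unfolding s g by simp
      then have "s = s'" using inj_map_eq_map[of "Transposition.transpose 0 (hd w)"] by simp
      then show "z = z'" using s by simp
    qed
    show "graft w ` words {0} = branch_words A w"
    proof (intro subset_antisym subsetI)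
      fix y assume "y \<in> graft w ` words {0}"
      then obtain z where z: "z \<in> words {0}" "y = graft w z" by blast
      obtain s where s: "z = s @ [0]" using rooted_word[OF z(1)] by blast
      have "map (Transposition.transpose 0 (hd w)) s @ w \<in> words A" using graft_word_iff[OF w, of s] z(1) s by simp
      then show "y \<in> branch_words A w" unfolding branch_words_def z(2) s g by blast
    next
      fix y assume "y \<in> branch_words A w"
      then obtain s where s: "y = s @ w" "y \<in> words A" unfolding branch_words_def by blast
      have s2: "map (Transposition.transpose 0 (hd w)) (map (Transposition.transpose 0 (hd w)) s) = s" by (simp add: comp_def)
      have "map (Transposition.transpose 0 (hd w)) s @ [0] \<in> words {0}"
        using graft_word_iff[OF w, of "map (Transposition.transpose 0 (hd w)) s"] s unfolding s2 by simp
      moreover have "graft w (map (Transposition.transpose 0 (hd w)) s @ [0]) = y" unfolding g s2 s(1) ..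
      ultimately show "y \<in> graft w ` words {0}" by (metis imageI)
    qed
  qed
  have e: "bij_betw edge (branch_words A w) (edge ` branch_words A w)"
    by (intro bij_betw_imageI inj_edge refl)
  have c: "bij_betw (edge \<circ> graft w) (words {0}) (edge ` branch_words A w)"
    by (rule bij_betw_trans[OF b e])
  have "bij_betw (map_prod (graft w) (graft w) \<circ> edge) (words {0}) (edge ` branch_words A w)"
    by (rule bij_betw_cong[THEN iffD1, OF _ c]) (use graft_edge[OF w0] in simp)
  then show ?thesis using bij_betw_comp_iff[OF bij_edge[of "{0}"]] by blast
qed

text \<open>
  Every branch is a copy of the rooted tree.
\<close>

lemma subtree_H1:
  assumes w: "w \<in> words A" and u: "u \<in> H1 (tree A)"
  shows "subtree w u \<in> H1 (tree {0})"
    "\<And>F :: (real \<Rightarrow> real) \<Rightarrow> real. (\<Sum>\<^sub>\<infinity>e\<in>tree {0}. F (slice (subtree w u) e)) = (\<Sum>\<^sub>\<infinity>y\<in>branch_words A w. F (slice u (edge y)))"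
proof -
  have sub: "edge ` branch_words A w \<subseteq> tree A" unfolding tree_eq_image branch_words_def by blast
  have u': "u \<in> H1 (edge ` branch_words A w)" by (rule H1_subset[OF countable_tree sub u])
  have c: "countable (edge ` branch_words A w)" by (rule countableI_type)
  note I = H1_isomorphism[OF graft_bij[OF w] c u', folded subtree_def]
  show "subtree w u \<in> H1 (tree {0})" by (rule I(1))
  show "(\<Sum>\<^sub>\<infinity>e\<in>tree {0}. F (slice (subtree w u) e)) = (\<Sum>\<^sub>\<infinity>y\<in>branch_words A w. F (slice u (edge y)))" for F :: "(real \<Rightarrow> real) \<Rightarrow> real"
    unfolding I(2)[of F] by (subst infsum_reindex[OF inj_edge]) (simp add: comp_def)
qed

lemma subtree_root_value:
  "w \<in> words A \<Longrightarrow> subtree w u (edge [0], 0) = u (edge w, 0)"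
  by (simp add: subtree_def edge_def graft_def)

lemma subtree_value:
  assumes w: "w \<in> words A" and y: "s @ w \<in> words A"
  shows "\<exists>z\<in>words {0}. length z = Suc (length s) \<and> (\<forall>t. subtree w u (edge z, t) = u (edge (s @ w), t))"
proof
  let ?z = "map (Transposition.transpose 0 (hd w)) s @ [0]"
  have s2: "map (Transposition.transpose 0 (hd w)) (map (Transposition.transpose 0 (hd w)) s) = s" by (simp add: comp_def)
  show z: "?z \<in> words {0}" using graft_word_iff[OF w, of "map (Transposition.transpose 0 (hd w)) s"] y unfolding s2 by simp
  have "graft w ?z = s @ w" unfolding graft_def using s2 by simp
  then show "length ?z = Suc (length s) \<and> (\<forall>t. subtree w u (edge ?z, t) = u (edge (s @ w), t))"
    using graft_edge[OF _ z, of w] words_hd[OF w] by (simp add: subtree_def)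
qed

lemma words_level_split:
  "words A = {y \<in> words A. length y \<le> R} \<union> (\<Union>w\<in>level A R. branch_words A w)"
proof (intro subset_antisym subsetI)
  fix y assume y: "y \<in> words A"
  show "y \<in> {y \<in> words A. length y \<le> R} \<union> (\<Union>w\<in>level A R. branch_words A w)"
  proof (cases "length y \<le> R")
    case False
    define k where "k = length y - Suc R"
    have yk: "y = take k y @ drop k y" "length (drop k y) = Suc R" using False by (auto simp: k_def)
    have y': "set y \<subseteq> {0, 1, 2}" "distinct_adj y" "last y \<in> A" using y unfolding words_def by simp_all
    have ne: "drop k y \<noteq> []" using yk(2) by auto
    have "distinct_adj (drop k y)"
      using y'(2) distinct_adj_append[of "take k y" "drop k y"] by simp
    moreover have "last (drop k y) \<in> A" using ne y'(3) by (simp add: last_drop)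
    ultimately have "drop k y \<in> words A"
      using order_trans[OF set_drop_subset y'(1)] ne unfolding words_def mem_Collect_eq by blast
    then have "drop k y \<in> level A R" using yk(2) by (simp add: level_def)
    then show ?thesis using y yk(1) unfolding branch_words_def by blast
  qed (use y in simp)
qed (auto simp: branch_words_def)

lemma split_level_sum:
  fixes g :: "nat list \<Rightarrow> real"
  assumes A: "A \<subseteq> {0, 1, 2}" and g: "g summable_on words A"
  shows "(\<Sum>\<^sub>\<infinity>y\<in>words A. g y) =
    (\<Sum>y\<in>{y \<in> words A. length y \<le> R}. g y) + (\<Sum>w\<in>level A R. \<Sum>\<^sub>\<infinity>y\<in>branch_words A w. g y)"
    and "finite {y \<in> words A. length y \<le> R}"
proof -
  let ?S = "{y \<in> words A. length y \<le> R}" and ?B = "\<Union>w\<in>level A R. branch_words A w"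
  have "?S \<subseteq> {y. set y \<subseteq> {0, 1, 2} \<and> length y \<le> R}" unfolding words_def by blast
  then show fin: "finite ?S" using finite_lists_length_le[of "{0, 1, 2 :: nat}" R] finite_subset by blast
  have disj: "branch_words A w \<inter> branch_words A w' = {}" if "w \<in> level A R" "w' \<in> level A R" "w \<noteq> w'" for w w'
    using that unfolding branch_words_def level_def by auto
  have sub: "g summable_on S" if "S \<subseteq> words A" for S using summable_on_subset_banach[OF g that] .
  have subB: "branch_words A w \<subseteq> words A" for w unfolding branch_words_def by blast
  have "(\<Sum>\<^sub>\<infinity>y\<in>words A. g y) = infsum g ?S + infsum g ?B"
    by (subst words_level_split[of A R]) (intro infsum_Un_disjoint sub; use subB in \<open>auto simp: branch_words_def level_def\<close>)
  also have "infsum g ?B = (\<Sum>w\<in>level A R. infsum g (branch_words A w))"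
    using level_card[OF A] disj sub[OF subB] by (intro sum_infsum[symmetric]) auto
  finally show "(\<Sum>\<^sub>\<infinity>y\<in>words A. g y) = (\<Sum>y\<in>?S. g y) + (\<Sum>w\<in>level A R. \<Sum>\<^sub>\<infinity>y\<in>branch_words A w. g y)"
    using fin by simp
qed

text \<open>
  The contribution of one edge to the functional defined next, which is therefore additive over pieces of the tree.
\<close>

definition edge_action :: "real \<Rightarrow> real \<Rightarrow> (real \<Rightarrow> real) \<Rightarrow> real" where
  "edge_action \<kappa> p v = (edge_dirichlet v - \<omega>\<^sup>2 * edge_mass v) / 2 + \<kappa> * edge_mass v - edge_power p v / p"

definition penalized :: "real \<Rightarrow> real \<Rightarrow> 'v mgraph \<Rightarrow> ('v point \<Rightarrow> real) \<Rightarrow> real" where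
  "penalized \<kappa> p G u = excess p G u + \<kappa> * mass G u"

lemma penalized_eq:
  assumes G: "countable G" and u: "u \<in> H1 G" and p: "2 < p"
  shows "(\<lambda>e. edge_action \<kappa> p (slice u e)) summable_on G"
    "penalized \<kappa> p G u = (\<Sum>\<^sub>\<infinity>e\<in>G. edge_action \<kappa> p (slice u e))"
proof -
  have "((\<lambda>e. (1 / 2) * edge_dirichlet (slice u e) + (\<kappa> - \<omega>\<^sup>2 / 2) * edge_mass (slice u e) + (- 1 / p) * edge_power p (slice u e)) has_sum
    ((1 / 2) * dirichlet G u + (\<kappa> - \<omega>\<^sup>2 / 2) * mass G u + (- 1 / p) * power_integral p G u)) G"
    unfolding dirichlet_eq[OF G u] mass_eq[OF G u] power_integral_def
    by (intro has_sum_add has_sum_cmult_right has_sum_infsum H1_summable[OF G u] power_summable[OF G u p])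
  then have hs: "((\<lambda>e. edge_action \<kappa> p (slice u e)) has_sum penalized \<kappa> p G u) G"
    by (simp add: edge_action_def penalized_def excess_def gap_def algebra_simps diff_divide_distrib add_divide_distrib)
  then show "(\<lambda>e. edge_action \<kappa> p (slice u e)) summable_on G" by (rule has_sum_imp_summable)
  show "penalized \<kappa> p G u = (\<Sum>\<^sub>\<infinity>e\<in>G. edge_action \<kappa> p (slice u e))" using infsumI[OF hs] by simp
qed

lemma penalized_level_split:
  assumes A: "A \<subseteq> {0, 1, 2}" and u: "u \<in> H1 (tree A)" and p: "2 < p"
  shows "penalized \<kappa> p (tree A) u = (\<Sum>y\<in>{y \<in> words A. length y \<le> R}. edge_action \<kappa> p (slice u (edge y)))
      + (\<Sum>w\<in>level A R. penalized \<kappa> p (tree {0}) (subtree w u))"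
    "mass (tree A) u = (\<Sum>y\<in>{y \<in> words A. length y \<le> R}. edge_mass (slice u (edge y)))
      + (\<Sum>w\<in>level A R. mass (tree {0}) (subtree w u))"
    "dirichlet (tree A) u = (\<Sum>y\<in>{y \<in> words A. length y \<le> R}. edge_dirichlet (slice u (edge y)))
      + (\<Sum>w\<in>level A R. dirichlet (tree {0}) (subtree w u))"
proof -
  have lw: "w \<in> words A" if "w \<in> level A R" for w using that by (simp add: level_def)
  note T = countable_tree
  show "penalized \<kappa> p (tree A) u = (\<Sum>y\<in>{y \<in> words A. length y \<le> R}. edge_action \<kappa> p (slice u (edge y)))
      + (\<Sum>w\<in>level A R. penalized \<kappa> p (tree {0}) (subtree w u))"
    unfolding penalized_eq(2)[OF T u p] tree_sum
    using split_level_sum(1)[OF A, of "\<lambda>y. edge_action \<kappa> p (slice u (edge y))" R] penalized_eq(1)[OF T u p, of \<kappa>]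
    by (simp add: tree_summable penalized_eq(2)[OF T subtree_H1(1)[OF lw u] p] subtree_H1(2)[OF lw u])
  show "mass (tree A) u = (\<Sum>y\<in>{y \<in> words A. length y \<le> R}. edge_mass (slice u (edge y)))
      + (\<Sum>w\<in>level A R. mass (tree {0}) (subtree w u))"
    unfolding mass_eq[OF T u] tree_sum
    using split_level_sum(1)[OF A, of "\<lambda>y. edge_mass (slice u (edge y))" R] H1_summable(2)[OF T u]
    by (simp add: tree_summable mass_eq[OF T subtree_H1(1)[OF lw u]] subtree_H1(2)[OF lw u])
  show "dirichlet (tree A) u = (\<Sum>y\<in>{y \<in> words A. length y \<le> R}. edge_dirichlet (slice u (edge y)))
      + (\<Sum>w\<in>level A R. dirichlet (tree {0}) (subtree w u))"
    unfolding dirichlet_eq[OF T u] tree_sum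
    using split_level_sum(1)[OF A, of "\<lambda>y. edge_dirichlet (slice u (edge y))" R] H1_summable(1)[OF T u]
    by (simp add: tree_summable dirichlet_eq[OF T subtree_H1(1)[OF lw u]] subtree_H1(2)[OF lw u])
qed

text \<open>
  A function on the rooted tree is continued to the unrooted tree by linear cutoffs along the two other edges at the root.
\<close>

definition extend :: "(nat list point \<Rightarrow> real) \<Rightarrow> nat list point \<Rightarrow> real" where
  "extend v = (\<lambda>((x, y), t). if last y = 0 then v ((x, y), t)
     else if x = [] then v (edge [0], 0) * (1 - t) else 0)"

lemma words_restrict: "words {0} = {y \<in> words {0, 1, 2}. last y = 0}"
  unfolding words_def by auto

lemma edge_power_zero: "edge_power p (\<lambda>t. 0) = 0" unfolding edge_power_def by simp

lemma extend_H1: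
  assumes v: "v \<in> H1 (tree {0})" and p: "2 < p"
  shows "extend v \<in> H1 (tree {0, 1, 2})"
    "mass (tree {0, 1, 2}) (extend v) = mass (tree {0}) v + 2 / 3 * (v (edge [0], 0))\<^sup>2"
    "0 \<le> \<kappa> \<Longrightarrow> penalized \<kappa> p (tree {0, 1, 2}) (extend v) \<le> penalized \<kappa> p (tree {0}) v + (1 + \<kappa>) * (v (edge [0], 0))\<^sup>2"
proof -
  let ?U = "{0, 1, 2} :: nat set"
  define a where "a = v (edge [0], 0)"
  let ?r = "\<lambda>t. a * (1 - t)"
  have sl: "slice (extend v) (edge y) = (if last y = 0 then slice v (edge y) else if y \<in> {[1], [2]} then ?r else (\<lambda>t. 0))"
    if y: "y \<in> words ?U" for y
  proof -
    have "tl y = [] \<longleftrightarrow> y \<in> {[0], [1], [2]}" using y unfolding words_def by (cases y) auto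
    then show ?thesis by (auto simp: extend_def edge_def a_def)
  qed
  have sob_r: "sobolev ?r" by (rule sobolev_scale(1)[OF sobolev_ramp(1)])
  have sob: "sobolev (slice (extend v) (edge y))" if y: "y \<in> words ?U" for y
    unfolding sl[OF y] using sob_r sobolev_zero(1) H1_sobolev[OF v, of "edge y"] y
    by (auto simp: edge_mem words_restrict)
  have split: "words ?U = words {0} \<union> {[1], [2]} \<union> {y \<in> words ?U. last y \<noteq> 0 \<and> y \<notin> {[1], [2]}}"
    unfolding words_def by auto
  have summ: "((\<lambda>y. F (slice (extend v) (edge y))) has_sum (s + 2 * F ?r)) (words ?U)"
    if F: "((\<lambda>y. F (slice v (edge y))) has_sum s) (words {0})" and F0: "F (\<lambda>t. 0) = 0" for F :: "(real \<Rightarrow> real) \<Rightarrow> real" and s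
  proof -
    have 1: "((\<lambda>y. F (slice (extend v) (edge y))) has_sum s) (words {0})"
      by (rule has_sum_cong[THEN iffD1, OF _ F]) (use sl words_restrict in auto)
    have w12: "[1] \<in> words ?U" "[2] \<in> words ?U" by (auto simp: words_def)
    have 2: "((\<lambda>y. F (slice (extend v) (edge y))) has_sum (2 * F ?r)) {[1], [2]}"
      using sl[OF w12(1)] sl[OF w12(2)] by (intro has_sum_finiteI) auto
    have 3: "((\<lambda>y. F (slice (extend v) (edge y))) has_sum 0) {y \<in> words ?U. last y \<noteq> 0 \<and> y \<notin> {[1], [2]}}"
      by (rule has_sum_0) (use sl F0 in auto)
    have "((\<lambda>y. F (slice (extend v) (edge y))) has_sum (s + 2 * F ?r + 0)) (words ?U)"
      by (subst split) (intro has_sum_Un_disjoint 1 2 3; auto simp: words_def)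
    then show ?thesis by simp
  qed
  obtain f where f: "vertex_values (tree {0}) v f" using vertex_values_exist[OF v] by blast
  have f0: "f [] = a" using vertex_values_edge[OF f, of "[0]"] by (simp add: words_def a_def)
  have "cont_on_graph (tree ?U) (extend v)"
    unfolding cont_on_graph_def
  proof (intro conjI ballI exI)
    fix e assume "e \<in> tree ?U"
    then obtain y where y: "y \<in> words ?U" "e = edge y" unfolding tree_eq_image by blast
    show "continuous_on {0..1} (slice (extend v) e)" unfolding y(2) by (rule sobolev_continuous[OF sob[OF y(1)]])
    let ?f = "\<lambda>x. if x = [] then a else if last x = 0 then f x else 0"
    show "case e of (x, y) \<Rightarrow> extend v ((x, y), 0) = ?f x \<and> extend v ((x, y), 1) = ?f y"
    proof (cases "last y = 0")
      case True
      then have "y \<in> words {0}" using y(1) words_restrict by blast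
      then have "v (edge y, 0) = f (tl y)" "v (edge y, 1) = f y" using vertex_values_edge[OF f] by auto
      then show ?thesis using True y(1) f0 words_hd[OF y(1)] unfolding y(2) by (cases y) (auto simp: edge_def extend_def)
    next
      case False
      then show ?thesis using words_hd[OF y(1)] unfolding y(2) by (cases y) (auto simp: edge_def extend_def a_def)
    qed
  qed
  moreover have "(\<lambda>e. edge_dirichlet (slice (extend v) e) + edge_mass (slice (extend v) e)) summable_on tree ?U"
  proof -
    have "(\<lambda>y. edge_dirichlet (slice v (edge y)) + edge_mass (slice v (edge y))) summable_on words {0}"
      using v unfolding H1_iff[OF countable_tree] tree_summable by blast
    then have hs: "((\<lambda>y. edge_dirichlet (slice v (edge y)) + edge_mass (slice v (edge y))) has_sum
        (\<Sum>\<^sub>\<infinity>y\<in>words {0}. edge_dirichlet (slice v (edge y)) + edge_mass (slice v (edge y)))) (words {0})"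
      by (rule has_sum_infsum)
    have z: "edge_dirichlet (\<lambda>t. 0) + edge_mass (\<lambda>t. 0) = 0" by (simp add: sobolev_zero)
    show ?thesis
      unfolding tree_summable
      by (rule has_sum_imp_summable[OF summ[of "\<lambda>h. edge_dirichlet h + edge_mass h", OF hs z]])
  qed
  ultimately show H: "extend v \<in> H1 (tree ?U)"
    unfolding H1_iff[OF countable_tree] using sob by (auto simp: tree_eq_image)
  note T = countable_tree
  have eMr: "edge_mass ?r = a\<^sup>2 / 3" "edge_dirichlet ?r = a\<^sup>2" using sobolev_scale[OF sobolev_ramp(1)] sobolev_ramp by auto
  have "((\<lambda>y. edge_mass (slice v (edge y))) has_sum mass (tree {0}) v) (words {0})"
    using H1_summable(2)[OF T v] unfolding mass_eq[OF T v] tree_sum tree_summable by simp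
  from summ[OF this sobolev_zero(3)] have "(\<Sum>\<^sub>\<infinity>y\<in>words ?U. edge_mass (slice (extend v) (edge y))) = mass (tree {0}) v + 2 * (a\<^sup>2 / 3)"
    unfolding eMr by (rule infsumI)
  then show "mass (tree ?U) (extend v) = mass (tree {0}) v + 2 / 3 * (v (edge [0], 0))\<^sup>2"
    unfolding mass_eq[OF T H] tree_sum a_def by simp
  assume \<kappa>: "0 \<le> \<kappa>"
  have "((\<lambda>y. edge_action \<kappa> p (slice v (edge y))) has_sum penalized \<kappa> p (tree {0}) v) (words {0})"
    using penalized_eq[OF T v p, of \<kappa>] unfolding tree_sum tree_summable by simp
  moreover have "edge_action \<kappa> p (\<lambda>t. 0) = 0" unfolding edge_action_def by (simp add: sobolev_zero edge_power_zero)
  ultimately have "(\<Sum>\<^sub>\<infinity>y\<in>words ?U. edge_action \<kappa> p (slice (extend v) (edge y))) = penalized \<kappa> p (tree {0}) v + 2 * edge_action \<kappa> p ?r"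
    using infsumI[OF summ] by blast
  moreover have "2 * edge_action \<kappa> p ?r \<le> (1 + \<kappa>) * a\<^sup>2"
  proof -
    have "0 \<le> edge_power p ?r / p" using edge_power_nonneg p by (intro divide_nonneg_pos) auto
    moreover have "0 \<le> \<omega>\<^sup>2 * (a\<^sup>2 / 3)" "0 \<le> \<kappa> * a\<^sup>2" using \<kappa> by auto
    moreover have "\<kappa> * (a\<^sup>2 / 3) = (\<kappa> * a\<^sup>2) / 3" "(1 + \<kappa>) * a\<^sup>2 = a\<^sup>2 + \<kappa> * a\<^sup>2"
      by (simp_all add: algebra_simps)
    ultimately show ?thesis unfolding edge_action_def eMr by argo
  qed
  ultimately show "penalized \<kappa> p (tree ?U) (extend v) \<le> penalized \<kappa> p (tree {0}) v + (1 + \<kappa>) * (v (edge [0], 0))\<^sup>2"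
    unfolding penalized_eq(2)[OF T H p] tree_sum a_def by simp
qed

section \<open>Moving the centre of the unrooted tree\<close>

text \<open>
  Reduced words form the free product of three groups of order two; this is right multiplication by the
  generator \<open>b\<close>, an automorphism of the tree that exchanges the root with its neighbour \<open>[b]\<close>.
\<close>

definition turn :: "'a \<Rightarrow> 'a list \<Rightarrow> 'a list" where
  "turn b x = (if x \<noteq> [] \<and> last x = b then butlast x else x @ [b])"

lemma words_all: "y \<in> words {0, 1, 2} \<longleftrightarrow> y \<noteq> [] \<and> set y \<subseteq> {0, 1, 2} \<and> distinct_adj y"
  unfolding words_def using last_in_set by blast

lemma turn_turn:
  assumes "x = [] \<or> x \<in> words {0, 1, 2}" shows "turn b (turn b x) = x"
proof (cases "x = [] \<or> last x \<noteq> b")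
  case True
  then show ?thesis by (auto simp: turn_def)
next
  case False
  then obtain z where x: "x = z @ [b]" by (metis append_butlast_last_id)
  then have "distinct_adj (z @ [b])" using assms words_all by auto
  then have "z = [] \<or> last z \<noteq> b" by (simp add: distinct_adj_append)
  then show ?thesis unfolding x by (auto simp: turn_def)
qed

lemma turn_words:
  assumes y: "y \<in> words {0, 1, 2}" and b: "b \<in> {0, 1, 2}" and nb: "y \<noteq> [b]"
  shows "turn b y \<in> words {0, 1, 2}" "turn b y \<noteq> [b]" "map_prod (turn b) (turn b) (edge y) = edge (turn b y)"
proof -
  have y': "y \<noteq> []" "set y \<subseteq> {0, 1, 2}" "distinct_adj y" using y unfolding words_all by auto
  have "turn b y \<in> words {0, 1, 2} \<and> turn b y \<noteq> [b] \<and> map_prod (turn b) (turn b) (edge y) = edge (turn b y)"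
  proof (cases "last y = b")
    case True
    then obtain z where z: "y = z @ [b]" using y'(1) by (metis append_butlast_last_id)
    have zne: "z \<noteq> []" using nb z by auto
    then have lz: "last z \<noteq> b" "distinct_adj z" "set z \<subseteq> {0, 1, 2}" using y' unfolding z by (auto simp: distinct_adj_append)
    then have t: "turn b y = z" unfolding z turn_def by simp
    obtain c z' where c: "z = c # z'" using zne by (cases z) auto
    have "turn b (tl y) = tl z" unfolding z c turn_def by simp
    moreover have "z \<noteq> [b]" using lz(1) by auto
    ultimately show ?thesis using t lz zne unfolding words_all edge_def by simp
  next
    case False
    have t: "turn b y = y @ [b]" using False unfolding turn_def by simp
    have "turn b (tl y) = tl y @ [b]" using False y'(1) unfolding turn_def by (cases y) (auto split: if_splits)
    then show ?thesis using t False y' b unfolding words_all edge_def by (simp add: distinct_adj_append)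
  qed
  then show "turn b y \<in> words {0, 1, 2}" "turn b y \<noteq> [b]" "map_prod (turn b) (turn b) (edge y) = edge (turn b y)" by auto
qed

text \<open>
  The automorphism preserves the orientation of all edges but the one that it turns around.
\<close>

lemma turn_bij:
  assumes b: "b \<in> {0, 1, 2}"
  shows "bij_betw (map_prod (turn b) (turn b)) (tree {0, 1, 2}) (insert ([b], []) (tree {0, 1, 2} - {([], [b])}))"
    (is "bij_betw ?J ?T ?T'")
proof -
  have bw: "[b] \<in> words {0, 1, 2}" using b unfolding words_all by simp
  have J0: "?J ([], [b]) = ([b], [])" "?J ([b], []) = ([], [b])" by (simp_all add: turn_def)
  have eb: "edge y = ([], [b]) \<longleftrightarrow> y = [b]" for y by (auto simp: edge_def)
  have T': "edge y \<in> ?T'" if "y \<in> words {0, 1, 2}" "y \<noteq> [b]" for y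
    using that eb[of y] by (simp add: edge_mem)
  have Jin: "?J e \<in> ?T' \<and> ?J (?J e) = e" if e: "e \<in> ?T" for e
  proof -
    obtain y where y: "y \<in> words {0, 1, 2}" "e = edge y" using e unfolding tree_eq_image by blast
    show ?thesis
    proof (cases "y = [b]")
      case True
      then show ?thesis using J0 unfolding y(2) by (simp add: edge_def)
    next
      case False
      note t = turn_words[OF y(1) b False]
      have "turn b (turn b y) = y" by (rule turn_turn) (use y(1) in simp)
      then show ?thesis unfolding y(2) t(3) using turn_words(3)[OF t(1) b t(2)] T'[OF t(1,2)] by simp
    qed
  qed
  have Jin': "?J e \<in> ?T \<and> ?J (?J e) = e" if e: "e \<in> ?T'" for e
  proof (cases "e = ([b], [])")
    case True
    have "([], [b]) \<in> ?T" using bw by (simp add: mem_tree)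
    then show ?thesis using True J0 by simp
  next
    case False
    then obtain y where y: "y \<in> words {0, 1, 2}" "e = edge y" "y \<noteq> [b]" using e eb unfolding tree_eq_image by blast
    note t = turn_words[OF y(1) b y(3)]
    have "turn b (turn b y) = y" by (rule turn_turn) (use y(1) in simp)
    then show ?thesis unfolding y(2) t(3) using turn_words(3)[OF t(1) b t(2)] t(1) by (simp add: edge_mem)
  qed
  show ?thesis
    by (rule bij_betw_byWitness[where f' = ?J])
      (intro ballI image_subsetI conjunct1[OF Jin] conjunct2[OF Jin] conjunct1[OF Jin'] conjunct2[OF Jin']; assumption)+
qed

text \<open>
  The automorphism shortens by one letter every word that ends with \<open>b\<close>.
\<close>

lemma rotate_once:
  assumes u: "u \<in> H1 (tree {0, 1, 2})" and y: "y \<in> words {0, 1, 2}" "y = z @ [b]" "z \<noteq> []" and p: "2 < p"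
  shows "\<exists>v\<in>H1 (tree {0, 1, 2}). z \<in> words {0, 1, 2} \<and> (\<forall>t. v (edge z, t) = u (edge y, t)) \<and>
    dirichlet (tree {0, 1, 2}) v = dirichlet (tree {0, 1, 2}) u \<and>
    mass (tree {0, 1, 2}) v = mass (tree {0, 1, 2}) u \<and>
    power_integral p (tree {0, 1, 2}) v = power_integral p (tree {0, 1, 2}) u"
proof -
  let ?T = "tree {0, 1, 2}"
  note cT = countable_tree[of "{0, 1, 2}"]
  have y': "set y \<subseteq> {0, 1, 2}" "distinct_adj y" using y(1) unfolding words_all by auto
  have b: "b \<in> {0, 1, 2}" using y'(1) y(2) by auto
  have z: "z \<in> words {0, 1, 2}" "last z \<noteq> b" using y' y(2,3) unfolding words_all by (auto simp: distinct_adj_append)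
  have bT: "([], [b]) \<in> ?T" "([b], []) \<notin> ?T" using b unfolding mem_tree words_all by auto
  define T' where "T' = insert ([b], []) (?T - {([], [b])})"
  define w where "w = (\<lambda>(e, t). if e = ([b], []) then u (([], [b]), 1 - t) else u (e, t))"
  note F = H1_flip[OF cT u bT, folded T'_def w_def]
  have c': "countable T'" by (rule countableI_type)
  define v where "v = (\<lambda>(e, t). w (map_prod (turn b) (turn b) e, t))"
  note I = H1_isomorphism[OF turn_bij[OF b, folded T'_def] c' F(1), folded v_def]
  have sob: "sobolev (slice u ([], [b]))" by (rule H1_sobolev[OF u bT(1)])
  have sums: "(\<Sum>\<^sub>\<infinity>e\<in>?T. E (slice v e)) = (\<Sum>\<^sub>\<infinity>e\<in>?T. E (slice u e))"
    if "E (\<lambda>t. u (([], [b]), 1 - t)) = E (slice u ([], [b]))" for E :: "(real \<Rightarrow> real) \<Rightarrow> real"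
    using I(2)[of E] F(2)[of E, OF that] by simp
  have "dirichlet ?T v = dirichlet ?T u"
    unfolding dirichlet_eq[OF cT I(1)] dirichlet_eq[OF cT u] by (rule sums) (rule sobolev_reflect(2)[OF sob])
  moreover have "mass ?T v = mass ?T u"
    unfolding mass_eq[OF cT I(1)] mass_eq[OF cT u] by (rule sums) (rule sobolev_reflect(3)[OF sob])
  moreover have "power_integral p ?T v = power_integral p ?T u"
    unfolding power_integral_def by (rule sums) (rule sobolev_reflect(4)[OF sob], use p in simp)
  moreover have "v (edge z, t) = u (edge y, t)" for t
  proof -
    have zb: "z \<noteq> [b]" using z(2) by auto
    have "turn b z = y" using z y(2,3) by (simp add: turn_def)
    then have "map_prod (turn b) (turn b) (edge z) = edge y" using turn_words(3)[OF z(1) b zb] by simp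
    moreover have "edge y \<noteq> ([b], [])" using y(2) by (simp add: edge_def)
    ultimately show ?thesis by (simp add: v_def w_def)
  qed
  ultimately show ?thesis using I(1) z(1) by blast
qed

lemma recentre:
  assumes u: "u \<in> H1 (tree {0, 1, 2})" and y: "y \<in> words {0, 1, 2}" and p: "2 < p"
  shows "\<exists>v\<in>H1 (tree {0, 1, 2}). \<exists>a\<in>{0, 1, 2}. (\<forall>t. v (edge [a], t) = u (edge y, t)) \<and>
    dirichlet (tree {0, 1, 2}) v = dirichlet (tree {0, 1, 2}) u \<and>
    mass (tree {0, 1, 2}) v = mass (tree {0, 1, 2}) u \<and>
    power_integral p (tree {0, 1, 2}) v = power_integral p (tree {0, 1, 2}) u"
  using u y
proof (induction y arbitrary: u rule: rev_induct)
  case Nil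
  then show ?case unfolding words_all by simp
next
  case (snoc b z)
  show ?case
  proof (cases "z = []")
    case True
    have "b \<in> {0, 1, 2}" using snoc.prems(2) True unfolding words_all by simp
    then show ?thesis using snoc.prems(1) True by (intro bexI[of _ u] bexI[of _ b]) auto
  next
    case False
    obtain v where v: "v \<in> H1 (tree {0, 1, 2})" "z \<in> words {0, 1, 2}" "\<And>t. v (edge z, t) = u (edge (z @ [b]), t)"
      "dirichlet (tree {0, 1, 2}) v = dirichlet (tree {0, 1, 2}) u"
      "mass (tree {0, 1, 2}) v = mass (tree {0, 1, 2}) u"
      "power_integral p (tree {0, 1, 2}) v = power_integral p (tree {0, 1, 2}) u"
      using rotate_once[OF snoc.prems refl False p] by blast
    show ?thesis using snoc.IH[OF v(1,2)] unfolding v(3-6) .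
  qed
qed

section \<open>Limits of minimizing sequences\<close>

text \<open>
  Convergence on a fine finite grid of rational points carries over to all points by the common modulus of continuity.
\<close>

lemma equi_Hoelder_uniform_limit:
  fixes v :: "nat \<Rightarrow> real \<Rightarrow> real"
  assumes H: "\<And>n s t. s \<in> {0..1} \<Longrightarrow> t \<in> {0..1} \<Longrightarrow> (v n t - v n s)\<^sup>2 \<le> \<bar>t - s\<bar> * B" and B: "0 \<le> B"
    and conv: "\<And>t. t \<in> \<rat> \<inter> {0..1} \<Longrightarrow> convergent (\<lambda>n. v n t)"
  shows "\<exists>g. uniform_limit {0..1} v g sequentially"
proof -
  have "uniformly_Cauchy_on {0..1} v"
  proof (rule uniformly_Cauchy_onI)
    fix e :: real assume e: "0 < e"
    obtain N0 :: nat where N0: "B / (e / 4)\<^sup>2 < real N0" using reals_Archimedean2 by blast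
    define N where "N = Suc N0"
    have N: "N > 0" "B / real N \<le> (e / 4)\<^sup>2"
    proof -
      have "B / (e / 4)\<^sup>2 \<le> real N" using N0 by (simp add: N_def)
      then show "B / real N \<le> (e / 4)\<^sup>2" using e by (simp add: N_def field_simps)
    qed (simp add: N_def)
    have net: "real j / real N \<in> \<rat> \<inter> {0..1}" if "j \<le> N" for j using that N by simp
    have "\<exists>M. \<forall>m\<ge>M. \<forall>n\<ge>M. \<bar>v m (real j / real N) - v n (real j / real N)\<bar> < e / 4" if "j \<le> N" for j
      using metric_CauchyD[OF convergent_Cauchy[OF conv[OF net[OF that]]], of "e / 4"] e
      unfolding dist_real_def by simp
    then obtain M where M: "\<And>j m n. j \<le> N \<Longrightarrow> M j \<le> m \<Longrightarrow> M j \<le> n \<Longrightarrow> \<bar>v m (real j / real N) - v n (real j / real N)\<bar> < e / 4"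
      by metis
    define M' where "M' = Max (M ` {..N})"
    have M': "M j \<le> M'" if "j \<le> N" for j unfolding M'_def using that by (intro Max_ge) auto
    have "dist (v m t) (v n t) < e" if t: "t \<in> {0..1}" and mn: "m \<ge> M'" "n \<ge> M'" for t m n
    proof -
      define j where "j = nat \<lfloor>t * real N\<rfloor>"
      have j1: "real j \<le> t * real N" "t * real N < real j + 1" using t unfolding j_def by (auto simp: of_nat_nat)
      have "t * real N \<le> 1 * real N" using t by (intro mult_right_mono) auto
      then have "real j \<le> real N" using j1(1) by linarith
      then have jN: "j \<le> N" by simp
      define s where "s = real j / real N"
      have s: "s \<in> {0..1}" using net[OF jN] by (simp add: s_def)
      have "t * real N - real j = (t - s) * real N" using N(1) by (simp add: s_def left_diff_distrib)
      then have "\<bar>t - s\<bar> * real N = \<bar>t * real N - real j\<bar>" by (simp add: abs_mult)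
      also have "\<dots> \<le> 1" using j1 by simp
      finally have ts: "\<bar>t - s\<bar> \<le> 1 / real N" using N(1) by (simp add: field_simps)
      have near: "\<bar>v k t - v k s\<bar> \<le> e / 4" for k
      proof -
        have "(v k t - v k s)\<^sup>2 \<le> \<bar>t - s\<bar> * B" by (rule H[OF s t])
        also have "\<dots> \<le> 1 / real N * B" by (rule mult_right_mono[OF ts B])
        also have "\<dots> \<le> (e / 4)\<^sup>2" using N(2) by simp
        finally show ?thesis using e abs_le_square_iff[of "v k t - v k s" "e / 4"] by simp
      qed
      have "\<bar>v m s - v n s\<bar> < e / 4" unfolding s_def using M[OF jN] M'[OF jN] mn by (meson order_trans)
      then have "\<bar>v m t - v n t\<bar> < e" using near[of m] near[of n] by linarith
      then show ?thesis by (simp add: dist_real_def)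
    qed
    then show "\<exists>M. \<forall>x\<in>{0..1}. \<forall>m\<ge>M. \<forall>n\<ge>M. dist (v m x) (v n x) < e" by blast
  qed
  then have "uniformly_convergent_on {0..1} v" by (rule Cauchy_uniformly_convergent)
  then show ?thesis unfolding uniformly_convergent_on_def .
qed

lemma integral_compose_limit:
  fixes \<phi> :: "real \<Rightarrow> real"
  assumes v: "\<And>n. continuous_on {0..1} (v n)" and g: "continuous_on {0..1} g"
    and lim: "\<And>t. t \<in> {0..1} \<Longrightarrow> (\<lambda>n. v n t) \<longlonglongrightarrow> g t"
    and \<phi>: "continuous_on UNIV \<phi>" and S: "\<And>n t. t \<in> {0..1} \<Longrightarrow> \<bar>v n t\<bar> \<le> S"
  shows "(\<lambda>n. \<integral>t. \<phi> (v n t) \<partial>\<II>) \<longlonglongrightarrow> (\<integral>t. \<phi> (g t) \<partial>\<II>)"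
proof -
  have "bounded (\<phi> ` {-S..S})"
    by (intro compact_imp_bounded compact_continuous_image continuous_on_subset[OF \<phi>]) auto
  then obtain C where C: "\<And>x. x \<in> {-S..S} \<Longrightarrow> \<bar>\<phi> x\<bar> \<le> C" unfolding bounded_iff by (metis imageI real_norm_def)
  show ?thesis
  proof (rule integral_dominated_convergence[where w = "\<lambda>_. C"])
    show "(\<lambda>t. \<phi> (g t)) \<in> borel_measurable \<II>"
      by (intro continuous_imp_measurable_unit continuous_on_compose2[OF \<phi> g]) auto
    show "(\<lambda>t. \<phi> (v n t)) \<in> borel_measurable \<II>" for n
      by (intro continuous_imp_measurable_unit continuous_on_compose2[OF \<phi> v]) auto
    show "AE t in \<II>. (\<lambda>n. \<phi> (v n t)) \<longlonglongrightarrow> \<phi> (g t)"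
    proof (rule AE_I2)
      fix t assume "t \<in> space \<II>"
      then have "(\<lambda>n. v n t) \<longlonglongrightarrow> g t" by (intro lim) simp
      then show "(\<lambda>n. \<phi> (v n t)) \<longlonglongrightarrow> \<phi> (g t)"
        by (rule isCont_tendsto_compose[rotated]) (use \<phi> in \<open>simp add: continuous_on_eq_continuous_at\<close>)
    qed
    show "AE t in \<II>. norm (\<phi> (v n t)) \<le> C" for n
    proof (rule AE_I2)
      fix t assume "t \<in> space \<II>"
      then have "\<bar>v n t\<bar> \<le> S" by (intro S) simp
      then show "norm (\<phi> (v n t)) \<le> C" using C[of "v n t"] by (simp add: abs_le_iff)
    qed
  qed simp
qed

lemma words_exhaustion:
  assumes A: "A \<subseteq> {0, 1, 2}" and h: "h summable_on words A"
  shows "(\<lambda>R. \<Sum>y\<in>{y \<in> words A. length y \<le> R}. h y :: real) \<longlonglongrightarrow> (\<Sum>\<^sub>\<infinity>y\<in>words A. h y)"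
    "(\<lambda>R. \<Sum>y\<in>level A R. h y) \<longlonglongrightarrow> 0"
proof -
  let ?W = "\<lambda>R. {y \<in> words A. length y \<le> R}"
  have fin: "finite (?W R)" for R
    using split_level_sum(2)[OF A, of "\<lambda>_. 0" R] by simp
  have "filterlim ?W (finite_subsets_at_top (words A)) sequentially"
  proof (rule filterlim_finite_subsets_at_top[THEN iffD2], intro allI impI)
    fix X assume X: "finite X \<and> X \<subseteq> words A"
    have "finite (?W R) \<and> X \<subseteq> ?W R \<and> ?W R \<subseteq> words A" if R: "Max (length ` X) \<le> R" for R
    proof (intro conjI fin subsetI CollectI)
      fix y assume y: "y \<in> X"
      then show "y \<in> words A" using X by blast
      have "length y \<le> Max (length ` X)" using X y by (intro Max_ge) auto
      then show "length y \<le> R" using R by simp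
    qed simp
    then show "\<forall>\<^sub>F R in sequentially. finite (?W R) \<and> X \<subseteq> ?W R \<and> ?W R \<subseteq> words A"
      by (intro eventually_sequentiallyI[of "Max (length ` X)"])
  qed
  moreover have "(sum h \<longlongrightarrow> infsum h (words A)) (finite_subsets_at_top (words A))"
    using has_sum_infsum[OF h] unfolding has_sum_def .
  ultimately show 1: "(\<lambda>R. \<Sum>y\<in>?W R. h y) \<longlonglongrightarrow> (\<Sum>\<^sub>\<infinity>y\<in>words A. h y)"
    by (rule filterlim_compose[rotated])
  have "(\<lambda>R. (\<Sum>y\<in>?W (Suc R). h y) - (\<Sum>y\<in>?W R. h y)) \<longlonglongrightarrow> infsum h (words A) - infsum h (words A)"
    by (intro tendsto_diff LIMSEQ_Suc 1)
  moreover have "(\<Sum>y\<in>?W (Suc R). h y) - (\<Sum>y\<in>?W R. h y) = (\<Sum>y\<in>level A R. h y)" for R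
  proof -
    have "?W (Suc R) = ?W R \<union> level A R" "?W R \<inter> level A R = {}" by (auto simp: level_def)
    then show ?thesis using fin[of R] level_card[OF A, of R] by (simp add: sum.union_disjoint)
  qed
  ultimately show "(\<lambda>R. \<Sum>y\<in>level A R. h y) \<longlonglongrightarrow> 0" by simp
qed

text \<open>
  Here \<open>- \<kappa> \<mu>\<close> is a lower bound for the excess at mass \<open>\<mu>\<close>. For \<open>\<mu>\<close> above the critical mass \<open>\<kappa>\<close> is chosen such
  that it is the infimum; at the critical mass \<open>\<kappa> = 0\<close>.
\<close>

locale penalized_problem = binary_tree +
  fixes \<kappa> \<mu> :: real
  assumes A_cases: "A = {0} \<or> A = {0, 1, 2}" and \<kappa>: "0 \<le> \<kappa>" and \<mu>: "0 < \<mu>"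
    and level_bound: "\<And>u. u \<in> H1 (tree A) \<Longrightarrow> mass (tree A) u = \<mu> \<Longrightarrow> - \<kappa> * \<mu> \<le> excess p (tree A) u"
begin

text \<open>
  A function of smaller mass is scaled up to mass \<open>\<mu>\<close>. Since the power part grows faster, the functional
  is bounded below by a positive amount. This excludes that a minimizing sequence splits.
\<close>

lemma penalized_gain:
  assumes u: "u \<in> H1 T" and m: "0 < mass T u" "mass T u \<le> \<mu>"
  shows "((\<mu> / mass T u) powr ((p - 2) / 2) - 1) * power_integral p T u / p \<le> penalized \<kappa> p T u"
proof -
  define \<theta> where "\<theta> = \<mu> / mass T u"
  have \<theta>: "1 \<le> \<theta>" using m by (simp add: \<theta>_def)
  have "- \<kappa> * \<mu> \<le> excess p T (\<lambda>z. sqrt \<theta> * u z)"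
    by (rule level_bound) (use H1_scale(1)[OF cT u p(1)] mass_normalize[OF cT u m(1)] \<mu> in \<open>auto simp: \<theta>_def\<close>)
  also have "- \<kappa> * \<mu> = \<theta> * (- \<kappa> * mass T u)" using m by (simp add: \<theta>_def)
  finally have "\<theta> * (- \<kappa> * mass T u) \<le> \<theta> * (excess p T u - (\<theta> powr ((p - 2) / 2) - 1) * power_integral p T u / p)"
    unfolding excess_scale_up[OF cT u p(1) \<theta>] .
  then have "- \<kappa> * mass T u \<le> excess p T u - (\<theta> powr ((p - 2) / 2) - 1) * power_integral p T u / p"
    by (rule mult_left_le_imp_le) (use \<theta> in simp)
  then show ?thesis unfolding penalized_def \<theta>_def[symmetric] by simp
qed

lemma penalized_nonneg:
  assumes u: "u \<in> H1 T" and m: "mass T u \<le> \<mu>"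
  shows "0 \<le> penalized \<kappa> p T u"
proof (cases "mass T u = 0")
  case True
  have "u (e, t) = 0" if "e \<in> T" "t \<in> {0..1}" for e t
    using mass_pos[OF cT u that] True by auto
  then have "power_integral p T u \<le> 0 powr (p - 2) * mass T u"
    by (intro power_bound(2)[OF cT u p(1)]) auto
  then have "power_integral p T u = 0" using power_integral_nonneg[of p T u] by simp
  then show ?thesis using gap_nonneg[OF A(1) u] True unfolding penalized_def excess_def by simp
next
  case False
  then have m0: "0 < mass T u" using mass_nonneg[of T u] by simp
  have "1 \<le> (\<mu> / mass T u) powr ((p - 2) / 2)" using m m0 p by (intro ge_one_powr_ge_zero) auto
  then have "0 \<le> ((\<mu> / mass T u) powr ((p - 2) / 2) - 1) * power_integral p T u / p"
    using power_integral_nonneg p by (intro divide_nonneg_pos mult_nonneg_nonneg) auto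
  then show ?thesis using penalized_gain[OF u m0 m] by simp
qed

text \<open>
  A branch may be cut off at the cost of a multiple of the squared value at the cut: in the rooted tree it is
  itself a competitor, in the unrooted tree its extension is.
\<close>

lemma branch_bound:
  assumes v: "v \<in> H1 (tree {0})" and m: "mass (tree {0}) v + 2 * (v (edge [0], 0))\<^sup>2 \<le> \<mu>"
  shows "- (1 + \<kappa>) * (v (edge [0], 0))\<^sup>2 \<le> penalized \<kappa> p (tree {0}) v"
  using A_cases
proof
  assume A0: "A = {0}"
  have "mass T v \<le> \<mu>" using m unfolding A0 by (smt (verit) zero_le_power2)
  then have "0 \<le> penalized \<kappa> p (tree {0}) v" using penalized_nonneg[of v] v unfolding A0 by blast
  moreover have "0 \<le> (1 + \<kappa>) * (v (edge [0], 0))\<^sup>2" using \<kappa> by simp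
  ultimately show ?thesis by linarith
next
  assume A3: "A = {0, 1, 2}"
  note E = extend_H1[OF v p(1)]
  have "mass T (extend v) \<le> \<mu>" unfolding A3 E(2) using m zero_le_power2[of "v (edge [0], 0)"] by linarith
  then have "0 \<le> penalized \<kappa> p T (extend v)" using penalized_nonneg[of "extend v"] E(1) unfolding A3 by blast
  then show ?thesis using E(3)[OF \<kappa>] unfolding A3 by linarith
qed

text \<open>
  The part of the functional in the first generations is lower semicontinuous, and the branches behind it
  cost at least minus a multiple of the sum of the squared values at their bases. That sum converges to the
  one of the limit function, which tends to \<open>0\<close> with the generation because the limit is in \<open>H\<^sup>1\<close>.
  Visibility on the root edges makes the limit nonzero and leaves room in the mass constraint of
  \<open>branch_bound\<close>.
\<close>

theorem limit_theorem:
  assumes U: "\<And>n. U n \<in> H1 T" and mU: "\<And>n. mass T (U n) \<le> \<mu>" and B: "0 < B" "\<And>n. dirichlet T (U n) \<le> B"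
    and pen: "(\<lambda>n. penalized \<kappa> p T (U n)) \<longlonglongrightarrow> 0"
    and c: "0 < c" and vis: "\<And>n. \<exists>a\<in>A. \<exists>t\<in>{0..1}. c \<le> \<bar>U n (edge [a], t)\<bar>"
  shows "\<exists>u\<in>H1 T. 0 < mass T u \<and> mass T u \<le> \<mu> \<and> penalized \<kappa> p T u \<le> 0"
proof -
  have bnd: "\<bar>U n (edge y, t)\<bar> \<le> sqrt (2 * (\<mu> + B))" if y: "y \<in> words A" and t: "t \<in> {0..1}" for n y t
  proof (rule real_le_rsqrt)
    have e: "edge y \<in> T" using y by (simp add: edge_mem)
    have "(U n (edge y, t))\<^sup>2 \<le> 2 * (edge_mass (slice (U n) (edge y)) + edge_dirichlet (slice (U n) (edge y)))"
      by (rule sobolev_square_le_H1[OF H1_sobolev[OF U e] t])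
    also have "\<dots> \<le> 2 * (\<mu> + B)"
      using H1_term_le[OF cT U e, of n] mU[of n] B(2)[of n] by (intro mult_left_mono add_mono) auto
    finally show "\<bar>U n (edge y, t)\<bar>\<^sup>2 \<le> 2 * (\<mu> + B)" by simp
  qed
  \<comment> \<open>one countable family of bounded sequences: values at rational points and Dirichlet integrals of all edges\<close>
  define idx where "idx = (\<lambda>(y, t). (y, Some t)) ` (words A \<times> (\<rat> \<inter> {0..1} :: real set)) \<union> (\<lambda>y. (y, None)) ` words A"
  define val where "val = (\<lambda>n (y, s). case s of None \<Rightarrow> edge_dirichlet (slice (U n) (edge y)) | Some t \<Rightarrow> U n (edge y, t))"
  have "countable (words A \<times> (\<rat> \<inter> {0..1} :: real set))"
    using countable_rat by (intro countable_SIGMA countableI_type) auto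
  then have "countable ((\<lambda>(y, t). (y, Some t)) ` (words A \<times> (\<rat> \<inter> {0..1} :: real set)))" by simp
  then have cidx: "countable idx" unfolding idx_def by (simp add: countableI_type)
  have bidx: "norm (val n x) \<le> max (sqrt (2 * (\<mu> + B))) B" if "x \<in> idx" for n x
    using that
  proof (cases x)
    case (Pair y s)
    have y: "y \<in> words A" using that unfolding Pair idx_def by auto
    show ?thesis
    proof (cases s)
      case None
      have "edge_dirichlet (slice (U n) (edge y)) \<le> B"
        using H1_term_le(1)[OF cT U, of "edge y" n] B(2)[of n] y by (simp add: edge_mem)
      then show ?thesis using edge_dirichlet_nonneg unfolding Pair None val_def by (simp add: le_max_iff_disj)
    next
      case (Some t)
      then have "t \<in> {0..1}" using that unfolding Pair idx_def by auto
      then show ?thesis using bnd[OF y, of t n] unfolding Pair Some val_def by (simp add: le_max_iff_disj)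
    qed
  qed
  obtain k where k: "strict_mono k" "\<And>x. x \<in> idx \<Longrightarrow> \<exists>l. (\<lambda>n. val (k n) x) \<longlonglongrightarrow> l"
    using function_convergent_subsequence[of idx val "max (sqrt (2 * (\<mu> + B))) B"] cidx bidx by metis
  define W where "W = (\<lambda>n. U (k n))"
  have W: "W n \<in> H1 T" and mW: "mass T (W n) \<le> \<mu>" and BW: "dirichlet T (W n) \<le> B" for n
    unfolding W_def using U mU B(2) by auto
  have penW: "(\<lambda>n. penalized \<kappa> p T (W n)) \<longlonglongrightarrow> 0"
    unfolding W_def using LIMSEQ_subseq_LIMSEQ[OF pen k(1)] by (simp add: o_def)
  have sobW: "sobolev (slice (W n) (edge y))" if "y \<in> words A" for n y
    using H1_sobolev[OF W, of "edge y" n] that by (simp add: edge_mem)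
  have "\<exists>g. uniform_limit {0..1} (\<lambda>n. slice (W n) (edge y)) g sequentially" if y: "y \<in> words A" for y
  proof (rule equi_Hoelder_uniform_limit)
    fix n and s t :: real assume s: "s \<in> {0..1}" and t: "t \<in> {0..1}"
    have "(W n (edge y, t) - W n (edge y, s))\<^sup>2 \<le> \<bar>t - s\<bar> * edge_dirichlet (slice (W n) (edge y))"
      using has_L2_deriv_Hoelder[OF sobolev_weak_deriv[OF sobW[OF y]] s t] by (simp add: edge_dirichlet_def)
    also have "\<dots> \<le> \<bar>t - s\<bar> * B"
      using H1_term_le(1)[OF cT W, of "edge y" n] BW[of n] y by (intro mult_left_mono) (auto simp: edge_mem)
    finally show "(W n (edge y, t) - W n (edge y, s))\<^sup>2 \<le> \<bar>t - s\<bar> * B" .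
  next
    fix t :: real assume "t \<in> \<rat> \<inter> {0..1}"
    then have "(y, Some t) \<in> idx" using y unfolding idx_def by force
    from k(2)[OF this] show "convergent (\<lambda>n. W n (edge y, t))" unfolding convergent_def val_def W_def by simp
  qed (use B in simp)
  then obtain g where g: "\<And>y. y \<in> words A \<Longrightarrow> uniform_limit {0..1} (\<lambda>n. slice (W n) (edge y)) (g y) sequentially"
    by metis
  have "\<exists>l. (\<lambda>n. edge_dirichlet (slice (W n) (edge y))) \<longlonglongrightarrow> l" if y: "y \<in> words A" for y
  proof -
    have "(y, None) \<in> idx" using y unfolding idx_def by force
    from k(2)[OF this] show ?thesis unfolding val_def W_def by simp
  qed
  then obtain D where D: "\<And>y. y \<in> words A \<Longrightarrow> (\<lambda>n. edge_dirichlet (slice (W n) (edge y))) \<longlonglongrightarrow> D y" by metis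
  have gs: "sobolev (g y)" "edge_dirichlet (g y) \<le> D y" if y: "y \<in> words A" for y
    using sobolev_limit[OF sobW[OF y] g[OF y] D[OF y]] by auto
  have ptw: "(\<lambda>n. W n (edge y, t)) \<longlonglongrightarrow> g y t" if "y \<in> words A" "t \<in> {0..1}" for y t
    using tendsto_uniform_limitI[OF g[OF that(1)] that(2)] .
  have bW: "\<bar>W n (edge y, t)\<bar> \<le> sqrt (2 * (\<mu> + B))" if "y \<in> words A" "t \<in> {0..1}" for n y t
    unfolding W_def by (rule bnd[OF that])
  have M: "(\<lambda>n. edge_mass (slice (W n) (edge y))) \<longlonglongrightarrow> edge_mass (g y)" if y: "y \<in> words A" for y
    unfolding edge_mass_def
    by (rule integral_compose_limit[OF sobolev_continuous[OF sobW[OF y]] sobolev_continuous[OF gs(1)[OF y]] ptw[OF y] _ bW[OF y]])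
      (auto intro!: continuous_intros)
  have cp: "continuous_on UNIV (\<lambda>x :: real. \<bar>x\<bar> powr p)"
    by (rule continuous_on_powr') (use p in \<open>auto intro!: continuous_intros\<close>)
  have P: "(\<lambda>n. edge_power p (slice (W n) (edge y))) \<longlonglongrightarrow> edge_power p (g y)" if y: "y \<in> words A" for y
    unfolding edge_power_def
    by (rule integral_compose_limit[OF sobolev_continuous[OF sobW[OF y]] sobolev_continuous[OF gs(1)[OF y]] ptw[OF y] cp bW[OF y]])
  define u where "u = (\<lambda>(e :: nat list \<times> nat list, t :: real). g (snd e) t)"
  have su: "slice u (edge y) = g y" for y unfolding u_def edge_def by simp
  have finM: "(\<Sum>y\<in>F. edge_mass (g y)) \<le> \<mu>" if F: "finite F" "F \<subseteq> words A" for F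
  proof (rule LIMSEQ_le_const2)
    show "(\<lambda>n. \<Sum>y\<in>F. edge_mass (slice (W n) (edge y))) \<longlonglongrightarrow> (\<Sum>y\<in>F. edge_mass (g y))" by (intro tendsto_sum M) (use F in auto)
    have "(\<Sum>y\<in>F. edge_mass (slice (W n) (edge y))) \<le> \<mu>" for n
    proof -
      have "(\<Sum>y\<in>F. edge_mass (slice (W n) (edge y))) \<le> (\<Sum>\<^sub>\<infinity>y\<in>words A. edge_mass (slice (W n) (edge y)))"
        by (rule finite_sum_le_infsum[OF _ F]) (use H1_summable(2)[OF cT W, of n] in \<open>simp_all add: tree_summable edge_mass_nonneg\<close>)
      also have "\<dots> = mass T (W n)" unfolding mass_eq[OF cT W] tree_sum ..
      also have "\<dots> \<le> \<mu>" by (rule mW)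
      finally show ?thesis .
    qed
    then show "\<exists>N. \<forall>n\<ge>N. (\<Sum>y\<in>F. edge_mass (slice (W n) (edge y))) \<le> \<mu>" by blast
  qed
  have finD: "(\<Sum>y\<in>F. edge_dirichlet (g y)) \<le> B" if F: "finite F" "F \<subseteq> words A" for F
  proof -
    have "(\<Sum>y\<in>F. edge_dirichlet (g y)) \<le> (\<Sum>y\<in>F. D y)" by (intro sum_mono gs) (use F in auto)
    also have "\<dots> \<le> B"
    proof (rule LIMSEQ_le_const2)
      show "(\<lambda>n. \<Sum>y\<in>F. edge_dirichlet (slice (W n) (edge y))) \<longlonglongrightarrow> (\<Sum>y\<in>F. D y)" by (intro tendsto_sum D) (use F in auto)
      have "(\<Sum>y\<in>F. edge_dirichlet (slice (W n) (edge y))) \<le> B" for n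
      proof -
        have "(\<Sum>y\<in>F. edge_dirichlet (slice (W n) (edge y))) \<le> (\<Sum>\<^sub>\<infinity>y\<in>words A. edge_dirichlet (slice (W n) (edge y)))"
          by (rule finite_sum_le_infsum[OF _ F]) (use H1_summable(1)[OF cT W, of n] in \<open>simp_all add: tree_summable edge_dirichlet_nonneg\<close>)
        also have "\<dots> = dirichlet T (W n)" unfolding dirichlet_eq[OF cT W] tree_sum ..
        also have "\<dots> \<le> B" by (rule BW)
        finally show ?thesis .
      qed
      then show "\<exists>N. \<forall>n\<ge>N. (\<Sum>y\<in>F. edge_dirichlet (slice (W n) (edge y))) \<le> B" by blast
    qed
    finally show ?thesis .
  qed
  have sM: "(\<lambda>y. edge_mass (g y)) summable_on words A"
    by (rule nonneg_bdd_above_summable_on) (use finM edge_mass_nonneg in \<open>auto intro!: bdd_aboveI[of _ \<mu>]\<close>)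
  have sD: "(\<lambda>y. edge_dirichlet (g y)) summable_on words A"
    by (rule nonneg_bdd_above_summable_on) (use finD edge_dirichlet_nonneg in \<open>auto intro!: bdd_aboveI[of _ B]\<close>)
  have "\<exists>f. vertex_values T (W n) f" for n by (rule vertex_values_exist[OF W])
  then obtain f where f: "\<And>n. vertex_values T (W n) (f n)" by metis
  have "cont_on_graph T u"
    unfolding cont_on_graph_def
  proof (intro conjI ballI exI)
    fix e assume "e \<in> T"
    then obtain y where y: "y \<in> words A" "e = edge y" unfolding tree_eq_image by blast
    show "continuous_on {0..1} (slice u e)" unfolding y(2) su by (rule sobolev_continuous[OF gs(1)[OF y(1)]])
    have "lim (\<lambda>n. f n (tl y)) = g y 0" "lim (\<lambda>n. f n y) = g y 1"
      using ptw[OF y(1), of 0] ptw[OF y(1), of 1] vertex_values_edge[OF f y(1)] by (auto intro!: limI)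
    then show "case e of (x, y) \<Rightarrow> u ((x, y), 0) = lim (\<lambda>n. f n x) \<and> u ((x, y), 1) = lim (\<lambda>n. f n y)"
      unfolding y(2) by (simp add: u_def edge_def)
  qed
  then have u: "u \<in> H1 T"
    unfolding H1_iff[OF cT] tree_summable su using gs(1) summable_on_add[OF sD sM] by (auto simp: tree_eq_image su)
  have mu: "mass T u \<le> \<mu>"
    unfolding mass_eq[OF cT u] tree_sum su by (rule infsum_le_finite_sums[OF sM]) (use finM in auto)
  have finA: "finite A" using A(1) finite_subset by blast
  have mu0: "0 < mass T u"
  proof (rule ccontr)
    assume "\<not> 0 < mass T u"
    then have z: "g y t = 0" if "y \<in> words A" "t \<in> {0..1}" for y t
      using mass_pos[OF cT u _ that(2), of "edge y"] that(1) unfolding edge_mem by (auto simp: u_def edge_def)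
    have wA: "[a] \<in> words A" if "a \<in> A" for a using that A(1) unfolding words_def by auto
    have "\<forall>\<^sub>F n in sequentially. \<forall>t\<in>{0..1}. \<bar>W n (edge [a], t)\<bar> < c" if "a \<in> A" for a
      using uniform_limitD[OF g[OF wA[OF that]] c]
      by eventually_elim (use z[OF wA[OF that]] in \<open>simp add: dist_real_def\<close>)
    then have "\<forall>\<^sub>F n in sequentially. \<forall>a\<in>A. \<forall>t\<in>{0..1}. \<bar>W n (edge [a], t)\<bar> < c"
      by (intro eventually_ball_finite finA) auto
    then obtain n where "\<forall>a\<in>A. \<forall>t\<in>{0..1}. \<bar>W n (edge [a], t)\<bar> < c" using eventually_happens' by force
    then show False using vis[of "k n"] unfolding W_def by force
  qed
  obtain \<delta> where \<delta>: "0 < \<delta>" "\<And>v. sobolev v \<and> edge_dirichlet v \<le> B \<and> (\<exists>t\<in>{0..1}. c \<le> \<bar>v t\<bar>) \<Longrightarrow> \<delta> \<le> edge_mass v"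
    using sobolev_not_concentrated[OF c B(1), of p] p by auto
  define h where "h = (\<lambda>y. 2 * (edge_mass (g y) + edge_dirichlet (g y)))"
  have hs: "h summable_on words A" unfolding h_def by (intro summable_on_cmult_right summable_on_add sM sD)
  have h0: "(g w 0)\<^sup>2 \<le> h w" if "w \<in> words A" for w
    unfolding h_def by (rule sobolev_square_le_H1[OF gs(1)[OF that]]) simp
  define X where "X = (\<lambda>R. \<Sum>y\<in>{y \<in> words A. length y \<le> R}. edge_action \<kappa> p (g y))"
  have key: "X R \<le> (1 + \<kappa>) * (\<Sum>w\<in>level A R. h w)" if R: "1 \<le> R" "(\<Sum>w\<in>level A R. h w) < \<delta> / 2" for R
  proof -
    let ?S = "{y \<in> words A. length y \<le> R}"
    have fin: "finite ?S" using split_level_sum(2)[OF A(1), of "\<lambda>_. 0" R] by simp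
    have finL: "finite (level A R)" using level_card[OF A(1)] by blast
    have lw: "w \<in> words A" if "w \<in> level A R" for w using that by (simp add: level_def)
    define Y where "Y = (\<Sum>y\<in>?S. (D y - \<omega>\<^sup>2 * edge_mass (g y)) / 2 + \<kappa> * edge_mass (g y) - edge_power p (g y) / p)"
    have "X R \<le> Y" unfolding X_def Y_def edge_action_def by (intro sum_mono) (use gs(2) in auto)
    also have "Y \<le> 0 + (1 + \<kappa>) * (\<Sum>w\<in>level A R. (g w 0)\<^sup>2)"
    proof (rule tendsto_le[OF sequentially_bot])
      show "(\<lambda>n. \<Sum>y\<in>?S. edge_action \<kappa> p (slice (W n) (edge y))) \<longlonglongrightarrow> Y"
        unfolding edge_action_def Y_def using p by (intro tendsto_intros D M P) auto
      show "(\<lambda>n. penalized \<kappa> p T (W n) + (1 + \<kappa>) * (\<Sum>w\<in>level A R. (W n (edge w, 0))\<^sup>2)) \<longlonglongrightarrow>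
          0 + (1 + \<kappa>) * (\<Sum>w\<in>level A R. (g w 0)\<^sup>2)"
        by (intro tendsto_intros penW ptw lw) auto
      have "\<forall>\<^sub>F n in sequentially. (W n (edge w, 0))\<^sup>2 < \<delta> / 2" if w: "w \<in> level A R" for w
      proof (rule order_tendstoD(2))
        show "(\<lambda>n. (W n (edge w, 0))\<^sup>2) \<longlonglongrightarrow> (g w 0)\<^sup>2" by (intro tendsto_intros ptw lw w) simp
        have "h w \<le> (\<Sum>w\<in>level A R. h w)"
          by (rule member_le_sum) (use w finL in \<open>auto simp: h_def edge_mass_nonneg edge_dirichlet_nonneg\<close>)
        then show "(g w 0)\<^sup>2 < \<delta> / 2" using h0[OF lw[OF w]] R(2) by linarith
      qed
      then have "\<forall>\<^sub>F n in sequentially. \<forall>w\<in>level A R. (W n (edge w, 0))\<^sup>2 < \<delta> / 2"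
        by (intro eventually_ball_finite finL) auto
      then show "\<forall>\<^sub>F n in sequentially. (\<Sum>y\<in>?S. edge_action \<kappa> p (slice (W n) (edge y)))
          \<le> penalized \<kappa> p T (W n) + (1 + \<kappa>) * (\<Sum>w\<in>level A R. (W n (edge w, 0))\<^sup>2)"
      proof eventually_elim
        case (elim n)
        note split = penalized_level_split[OF A(1) W[of n] p(1), where R = R]
        have "- (1 + \<kappa>) * (W n (edge w, 0))\<^sup>2 \<le> penalized \<kappa> p (tree {0}) (subtree w (W n))" if w: "w \<in> level A R" for w
        proof -
          have v: "subtree w (W n) \<in> H1 (tree {0})" by (rule subtree_H1(1)[OF lw[OF w] W])
          obtain a t where a: "a \<in> A" "t \<in> {0..1}" "c \<le> \<bar>W n (edge [a], t)\<bar>" using vis[of "k n"] unfolding W_def by blast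
          have aw: "[a] \<in> words A" using a(1) A(1) unfolding words_def by auto
          have "edge_dirichlet (slice (W n) (edge [a])) \<le> B"
            using H1_term_le(1)[OF cT W, of "edge [a]" n] BW[of n] aw by (simp add: edge_mem)
          then have "\<delta> \<le> edge_mass (slice (W n) (edge [a]))" using sobW[OF aw] a by (intro \<delta>(2)) blast
          also have "\<dots> \<le> (\<Sum>y\<in>?S. edge_mass (slice (W n) (edge y)))"
            by (rule member_le_sum) (use aw R fin in \<open>auto simp: edge_mass_nonneg\<close>)
          finally have 1: "\<delta> \<le> (\<Sum>y\<in>?S. edge_mass (slice (W n) (edge y)))" .
          have 2: "mass (tree {0}) (subtree w (W n)) \<le> (\<Sum>w\<in>level A R. mass (tree {0}) (subtree w (W n)))"
            by (rule member_le_sum[of _ _ "\<lambda>w. mass (tree {0}) (subtree w (W n))"]) (use w finL in \<open>auto simp: mass_nonneg\<close>)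
          have "mass (tree {0}) (subtree w (W n)) + \<delta> \<le> \<mu>"
            using 1 2 mW[of n] unfolding split(2) by linarith
          moreover have "(W n (edge w, 0))\<^sup>2 < \<delta> / 2" using elim w by blast
          ultimately have "mass (tree {0}) (subtree w (W n)) + 2 * (subtree w (W n) (edge [0], 0))\<^sup>2 \<le> \<mu>"
            unfolding subtree_root_value[OF lw[OF w]] by argo
          from branch_bound[OF v this] show ?thesis unfolding subtree_root_value[OF lw[OF w]] .
        qed
        then have "(\<Sum>w\<in>level A R. - (1 + \<kappa>) * (W n (edge w, 0))\<^sup>2) \<le> (\<Sum>w\<in>level A R. penalized \<kappa> p (tree {0}) (subtree w (W n)))"
          by (rule sum_mono)
        then have "- ((1 + \<kappa>) * (\<Sum>w\<in>level A R. (W n (edge w, 0))\<^sup>2)) \<le> (\<Sum>w\<in>level A R. penalized \<kappa> p (tree {0}) (subtree w (W n)))"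
          by (simp only: sum_distrib_left minus_mult_left[symmetric] sum_negf)
        then show ?case unfolding split(1) by linarith
      qed
    qed
    also have "\<dots> \<le> (1 + \<kappa>) * (\<Sum>w\<in>level A R. h w)"
      using \<kappa> h0 lw by (simp add: mult_left_mono sum_mono)
    finally show ?thesis .
  qed
  have "penalized \<kappa> p T u \<le> (1 + \<kappa>) * 0"
  proof (rule tendsto_le[OF sequentially_bot])
    have su': "(\<lambda>y. edge_action \<kappa> p (g y)) summable_on words A"
      using penalized_eq(1)[OF cT u p(1), of \<kappa>] unfolding tree_summable su .
    show "X \<longlonglongrightarrow> penalized \<kappa> p T u"
      unfolding X_def[abs_def] penalized_eq(2)[OF cT u p(1)] tree_sum su by (rule words_exhaustion(1)[OF A(1) su'])
    show "(\<lambda>R. (1 + \<kappa>) * (\<Sum>w\<in>level A R. h w)) \<longlonglongrightarrow> (1 + \<kappa>) * 0"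
      by (intro tendsto_intros words_exhaustion(2)[OF A(1) hs])
    have "\<forall>\<^sub>F R in sequentially. (\<Sum>w\<in>level A R. h w) < \<delta> / 2"
      by (rule order_tendstoD(2)[OF words_exhaustion(2)[OF A(1) hs]]) (use \<delta> in simp)
    with eventually_ge_at_top[of 1] show "\<forall>\<^sub>F R in sequentially. X R \<le> (1 + \<kappa>) * (\<Sum>w\<in>level A R. h w)"
      by eventually_elim (rule key)
  qed
  then show ?thesis using u mu0 mu by auto
qed

end

section \<open>Minimizing sequences that run off to infinity\<close>

lemma rooted_words:
  "{y \<in> words {0}. length y \<le> 1} = {[0]}" "level {0} 1 = {[1, 0], [2, 0]}"
proof -
  show "{y \<in> words {0}. length y \<le> 1} = {[0]}"
  proof (intro subset_antisym subsetI)
    fix y assume "y \<in> {y \<in> words {0}. length y \<le> 1}"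
    then have y: "y \<in> words {0}" "length y \<le> 1" by auto
    then show "y \<in> {[0]}" using words_hd[OF y(1)] unfolding words_def by (cases y) auto
  qed (simp add: words_def)
  have "level {0} 0 = {y \<in> words {0}. length y \<le> 1}"
    unfolding level_def words_def by (auto simp: le_Suc_eq)
  also have "\<dots> = {[0]}" by fact
  finally have l0: "level {0} 0 = {[0]}" .
  have sub: "{0} \<subseteq> {0, 1, 2 :: nat}" by simp
  show "level {0} 1 = {[1, 0], [2, 0]}"
    unfolding One_nat_def level_Suc[OF sub] l0 by (auto simp: child_def)
qed

lemma rooted_word_root:
  assumes z: "z \<in> words {0}" "z \<noteq> [0]"
  shows "\<exists>s. z = s @ [1, 0] \<or> z = s @ [2, 0]"
proof -
  obtain r where r: "z = r @ [0]" using rooted_word[OF z(1)] by blast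
  then have "r \<noteq> []" using z(2) by auto
  then obtain s b where s: "r = s @ [b]" by (metis append_butlast_last_id)
  have "b \<noteq> 0" "b \<in> {0, 1, 2}" using z(1) unfolding r s words_def by (auto simp: distinct_adj_append)
  then have "b = 1 \<or> b = 2" by auto
  then show ?thesis unfolding r s by auto
qed

context penalized_problem begin

lemma rooted_split:
  assumes u: "u \<in> H1 (tree {0})"
  shows "penalized \<kappa> p (tree {0}) u = edge_action \<kappa> p (slice u (edge [0])) +
      penalized \<kappa> p (tree {0}) (subtree [1, 0] u) + penalized \<kappa> p (tree {0}) (subtree [2, 0] u)"
    "mass (tree {0}) u = edge_mass (slice u (edge [0])) + mass (tree {0}) (subtree [1, 0] u) + mass (tree {0}) (subtree [2, 0] u)"
    "dirichlet (tree {0}) u = edge_dirichlet (slice u (edge [0])) + dirichlet (tree {0}) (subtree [1, 0] u) + dirichlet (tree {0}) (subtree [2, 0] u)"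
proof -
  have A0: "{0} \<subseteq> {0, 1, 2 :: nat}" by simp
  note s = penalized_level_split[OF A0 u p(1), where R = 1, unfolded rooted_words]
  show "penalized \<kappa> p (tree {0}) u = edge_action \<kappa> p (slice u (edge [0])) +
      penalized \<kappa> p (tree {0}) (subtree [1, 0] u) + penalized \<kappa> p (tree {0}) (subtree [2, 0] u)"
    using s(1)[of \<kappa>] by simp
  show "mass (tree {0}) u = edge_mass (slice u (edge [0])) + mass (tree {0}) (subtree [1, 0] u) + mass (tree {0}) (subtree [2, 0] u)"
    using s(2) by simp
  show "dirichlet (tree {0}) u = edge_dirichlet (slice u (edge [0])) + dirichlet (tree {0}) (subtree [1, 0] u) + dirichlet (tree {0}) (subtree [2, 0] u)"
    using s(3) by simp
qed

text \<open>
  The quadratic part of a root edge together with one branch is nonnegative and controls the supremum on both.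
  If that supremum is small, the power part is absorbed: by the term \<open>\<kappa>\<close> times mass if \<open>\<kappa> > 0\<close>, and by the
  quadratic part if \<open>p > 4\<close>.
\<close>

lemma root_and_branch_nonneg:
  assumes \<kappa>p: "0 < \<kappa> \<or> 4 < p"
  shows "\<exists>c>0. \<forall>v w. sobolev v \<and> w \<in> H1 (tree {0}) \<and> w (edge [0], 0) = v 1 \<and> edge_mass v + mass (tree {0}) w \<le> \<mu> \<and>
    (\<forall>t\<in>{0..1}. \<bar>v t\<bar> \<le> c) \<and> (\<forall>y\<in>words {0}. \<forall>t\<in>{0..1}. \<bar>w (edge y, t)\<bar> \<le> c) \<longrightarrow>
    0 \<le> edge_action \<kappa> p v + penalized \<kappa> p (tree {0}) w"
proof -
  define c0 where "c0 = min (5 / 8) (sqrt 2 / 8 * \<omega>)"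
  have c0: "0 < c0" using omega_pos by (simp add: c0_def)
  define K where "K = 2 / c0 + 50"
  have K: "0 < K" using c0 by (simp add: K_def add_pos_pos)
  define c where "c = (if 0 < \<kappa> then (p * \<kappa>) powr (1 / (p - 2)) else (p / (2 * K * \<mu>)) powr (1 / (p - 4)))"
  have c: "0 < c" using p K \<mu> \<kappa>p by (auto simp: c_def)
  have "0 \<le> edge_action \<kappa> p v + penalized \<kappa> p (tree {0}) w"
    if v: "sobolev v" and w: "w \<in> H1 (tree {0})" and vw: "w (edge [0], 0) = v 1"
      and m: "edge_mass v + mass (tree {0}) w \<le> \<mu>" and vc: "\<And>t. t \<in> {0..1} \<Longrightarrow> \<bar>v t\<bar> \<le> c"
      and wc: "\<And>y t. y \<in> words {0} \<Longrightarrow> t \<in> {0..1} \<Longrightarrow> \<bar>w (edge y, t)\<bar> \<le> c" for v w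
  proof -
    let ?R = "tree {0}"
    have A0: "{0} \<subseteq> {0, 1, 2 :: nat}" by simp
    note T = countable_tree[of "{0}"]
    obtain f where f: "vertex_values ?R w f" using vertex_values_exist[OF w] by blast
    have w0: "[0] \<in> words {0}" by (simp add: words_def)
    have f0: "f [] = v 1" using vertex_values_edge[OF f w0] vw by simp
    define H where "H = gap ?R w - \<omega> / sqrt 2 * (v 1)\<^sup>2"
    have H: "0 \<le> H" using tree_sup_bound(1)[OF A0 w f w0, of 0] unfolding f0 H_def by simp
    have wH: "\<bar>w (edge y, t)\<bar> \<le> \<bar>v 1\<bar> + 5 * sqrt H" if "y \<in> words {0}" "t \<in> {0..1}" for y t
      using tree_sup_bound(2)[OF A0 w f that] unfolding f0 H_def by simp
    define Q where "Q = (edge_dirichlet v - \<omega>\<^sup>2 * edge_mass v) + gap ?R w"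
    have Q: "c0 * (edge_dirichlet v + (v 1)\<^sup>2) + H \<le> Q"
      using root_edge_inequality(1)[OF v] unfolding Q_def H_def c0_def by simp
    have n: "0 \<le> c0 * (edge_dirichlet v + (v 1)\<^sup>2)" using c0 edge_dirichlet_nonneg[of v] by (intro mult_nonneg_nonneg) auto
    then have Q0: "0 \<le> Q" using Q H by linarith
    have part: "2 * (edge_dirichlet v + (v 1)\<^sup>2) \<le> 2 / c0 * Q" "H \<le> Q"
    proof -
      show "H \<le> Q" using Q n by linarith
      have "c0 * (edge_dirichlet v + (v 1)\<^sup>2) \<le> Q" using Q H by linarith
      then show "2 * (edge_dirichlet v + (v 1)\<^sup>2) \<le> 2 / c0 * Q" using c0 by (simp add: field_simps)
    qed
    have vS: "(v t)\<^sup>2 \<le> K * Q" if "t \<in> {0..1}" for t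
    proof -
      have "(v t)\<^sup>2 \<le> 2 / c0 * Q" using root_edge_inequality(2)[OF v that] part(1) by linarith
      also have "\<dots> \<le> K * Q" unfolding K_def using Q0 by (intro mult_right_mono) auto
      finally show ?thesis .
    qed
    have wS: "(w (edge y, t))\<^sup>2 \<le> K * Q" if "y \<in> words {0}" "t \<in> {0..1}" for y t
    proof -
      have "\<bar>w (edge y, t)\<bar>\<^sup>2 \<le> (\<bar>v 1\<bar> + 5 * sqrt H)\<^sup>2" by (rule power_mono[OF wH[OF that]]) simp
      moreover have "(\<bar>v 1\<bar> + 5 * sqrt H)\<^sup>2 + (\<bar>v 1\<bar> - 5 * sqrt H)\<^sup>2 = 2 * \<bar>v 1\<bar>\<^sup>2 + 50 * (sqrt H)\<^sup>2"
        by (simp add: power2_eq_square algebra_simps)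
      moreover have "0 \<le> (\<bar>v 1\<bar> - 5 * sqrt H)\<^sup>2" by simp
      moreover have "(sqrt H)\<^sup>2 = H" "\<bar>v 1\<bar>\<^sup>2 = (v 1)\<^sup>2" "\<bar>w (edge y, t)\<bar>\<^sup>2 = (w (edge y, t))\<^sup>2" using H by simp_all
      ultimately have "(w (edge y, t))\<^sup>2 \<le> 2 * (v 1)\<^sup>2 + 50 * H" by linarith
      also have "\<dots> \<le> 2 / c0 * Q + 50 * Q" using part edge_dirichlet_nonneg[of v]
        by (intro add_mono) (simp_all add: distrib_left)
      also have "\<dots> = K * Q" by (simp add: K_def distrib_right)
      finally show ?thesis .
    qed
    define mm where "mm = edge_mass v + mass ?R w"
    have mm: "0 \<le> mm" "mm \<le> \<mu>" using m edge_mass_nonneg[of v] mass_nonneg[of ?R w] by (auto simp: mm_def)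
    have PS: "edge_power p v + power_integral p ?R w \<le> S powr (p - 2) * mm"
      if "\<And>t. t \<in> {0..1} \<Longrightarrow> \<bar>v t\<bar> \<le> S" "\<And>y t. y \<in> words {0} \<Longrightarrow> t \<in> {0..1} \<Longrightarrow> \<bar>w (edge y, t)\<bar> \<le> S" for S
    proof -
      have "power_integral p ?R w \<le> S powr (p - 2) * mass ?R w"
        by (rule power_bound(2)[OF T w p(1)]) (use that(2) in \<open>auto simp: tree_eq_image\<close>)
      moreover have "edge_power p v \<le> S powr (p - 2) * edge_mass v" by (rule edge_power_le[OF v p(1) that(1)])
      ultimately show ?thesis unfolding mm_def distrib_left by linarith
    qed
    have "(edge_power p v + power_integral p ?R w) / p \<le> Q / 2 + \<kappa> * mm"
    proof (cases "0 < \<kappa>")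
      case True
      have "c powr (p - 2) = p * \<kappa>" using True p unfolding c_def by (simp add: powr_powr)
      then have "(edge_power p v + power_integral p ?R w) / p \<le> \<kappa> * mm"
        using PS[OF vc wc] p by (simp add: field_simps)
      then show ?thesis using Q0 by simp
    next
      case False
      then have p4: "4 < p" and k0: "\<kappa> = 0" using \<kappa>p \<kappa> by auto
      define S where "S = min c (sqrt (K * Q))"
      have S0: "0 \<le> S" using c K Q0 by (simp add: S_def)
      have "\<bar>v t\<bar> \<le> S" if "t \<in> {0..1}" for t
        using vc[OF that] real_le_rsqrt[of "\<bar>v t\<bar>" "K * Q"] vS[OF that] by (simp add: S_def)
      moreover have "\<bar>w (edge y, t)\<bar> \<le> S" if "y \<in> words {0}" "t \<in> {0..1}" for y t
        using wc[OF that] real_le_rsqrt[of "\<bar>w (edge y, t)\<bar>" "K * Q"] wS[OF that] by (simp add: S_def)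
      ultimately have "edge_power p v + power_integral p ?R w \<le> S powr (p - 2) * mm" by (rule PS)
      also have "S powr (p - 2) = S powr (p - 4) * S\<^sup>2"
      proof (cases "S = 0")
        case False
        then have "S powr (p - 4) * S powr 2 = S powr (p - 4 + 2)" by (simp only: powr_add)
        then show ?thesis using S0 False by (simp add: powr_numeral)
      qed simp
      also have "S powr (p - 4) * S\<^sup>2 * mm \<le> (c powr (p - 4) * (K * Q)) * \<mu>"
      proof (intro mult_mono)
        show "S powr (p - 4) \<le> c powr (p - 4)" using S0 p4 by (intro powr_mono2) (auto simp: S_def)
        have "S\<^sup>2 \<le> (sqrt (K * Q))\<^sup>2" using S0 by (intro power_mono) (auto simp: S_def)
        then show "S\<^sup>2 \<le> K * Q" using K Q0 by simp
      qed (use mm K Q0 in auto)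
      also have "c powr (p - 4) = p / (2 * K * \<mu>)" using k0 p4 K \<mu> unfolding c_def by (simp add: powr_powr)
      also have "p / (2 * K * \<mu>) * (K * Q) * \<mu> = p * (Q / 2)" using K \<mu> by (simp add: field_simps)
      finally show ?thesis using p k0 by (simp add: field_simps)
    qed
    then show ?thesis
      unfolding edge_action_def penalized_def excess_def Q_def mm_def by (simp add: add_divide_distrib distrib_left)
  qed
  then show ?thesis using c by blast
qed

text \<open>
  The rooted tree has no automorphism that moves the root. But as long as the function is small on the root
  edge, the lighter of the two branches behind it is small as well, by \<open>penalized_gain\<close>. So root edge and lighter
  branch may be thrown away without increasing the functional, and the heavier branch is planted at the root.
  Each step brings a point where the function is large closer to the root.
\<close>

lemma rooted_recentre:
  assumes A0: "A = {0}" and \<kappa>p: "0 < \<kappa> \<or> 4 < p" and B: "0 < B" and c: "0 < c"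
  shows "\<exists>\<epsilon>>0. \<exists>d>0. \<forall>u. u \<in> H1 T \<and> mass T u \<le> \<mu> \<and> dirichlet T u \<le> B \<and> penalized \<kappa> p T u < \<epsilon> \<and>
      (\<exists>y\<in>words A. \<exists>t\<in>{0..1}. c \<le> \<bar>u (edge y, t)\<bar>) \<longrightarrow>
    (\<exists>v\<in>H1 T. mass T v \<le> \<mu> \<and> dirichlet T v \<le> B \<and> penalized \<kappa> p T v \<le> penalized \<kappa> p T u \<and>
      (\<exists>a\<in>A. \<exists>t\<in>{0..1}. d \<le> \<bar>v (edge [a], t)\<bar>))"
proof -
  obtain c1 where c1: "0 < c1" and small: "\<And>v w. sobolev v \<Longrightarrow> w \<in> H1 (tree {0}) \<Longrightarrow> w (edge [0], 0) = v 1 \<Longrightarrow>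
    edge_mass v + mass (tree {0}) w \<le> \<mu> \<Longrightarrow> (\<forall>t\<in>{0..1}. \<bar>v t\<bar> \<le> c1) \<Longrightarrow> (\<forall>y\<in>words {0}. \<forall>t\<in>{0..1}. \<bar>w (edge y, t)\<bar> \<le> c1) \<Longrightarrow>
    0 \<le> edge_action \<kappa> p v + penalized \<kappa> p (tree {0}) w"
    using root_and_branch_nonneg[OF \<kappa>p] by blast
  define c2 where "c2 = min c c1"
  have c2: "0 < c2" "c2 \<le> c" "c2 \<le> c1" using c c1 by (auto simp: c2_def)
  obtain \<eta> where \<eta>: "0 < \<eta>" "\<And>v. sobolev v \<Longrightarrow> edge_dirichlet v \<le> B \<Longrightarrow> (\<exists>t\<in>{0..1}. c2 \<le> \<bar>v t\<bar>) \<Longrightarrow> \<eta> \<le> edge_power p v \<and> \<eta> \<le> edge_mass v"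
    using sobolev_not_concentrated[OF c2(1) B, of p] p by auto
  \<comment> \<open>half of the gain of a function that is large somewhere and has at most half of the mass\<close>
  define \<epsilon> where "\<epsilon> = (2 powr ((p - 2) / 2) - 1) * \<eta> / p / 2"
  have "1 < (2 :: real) powr ((p - 2) / 2)" using p by simp
  then have \<epsilon>: "0 < \<epsilon>" using \<eta>(1) p by (simp add: \<epsilon>_def)
  have "((\<lambda>d. (\<omega>\<^sup>2 / 2) * d\<^sup>2 + d powr p / p) \<longlongrightarrow> (\<omega>\<^sup>2 / 2) * 0\<^sup>2 + 0 powr p / p) (at_right 0)"
    using p by (intro tendsto_intros tendsto_powr') (auto simp: eventually_at_filter)
  then have "\<forall>\<^sub>F d in at_right 0. (\<omega>\<^sup>2 / 2) * d\<^sup>2 + d powr p / p < \<epsilon>"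
    using \<epsilon> by (intro order_tendstoD(2)) auto
  moreover have "\<forall>\<^sub>F d in at_right (0::real). d \<in> {0<..<c2}" by (rule eventually_at_right_real[OF c2(1)])
  ultimately have "\<forall>\<^sub>F d in at_right 0. (\<omega>\<^sup>2 / 2) * d\<^sup>2 + d powr p / p < \<epsilon> \<and> d \<in> {0<..<c2}" by (rule eventually_conj)
  then obtain d where d: "(\<omega>\<^sup>2 / 2) * d\<^sup>2 + d powr p / p < \<epsilon>" "0 < d" "d < c2"
    using eventually_happens[of _ "at_right (0::real)"] by (auto simp: trivial_limit_at_right_real)
  have big: "2 * \<epsilon> \<le> penalized \<kappa> p T v"
    if v: "v \<in> H1 T" "mass T v \<le> \<mu> / 2" "dirichlet T v \<le> B" "y \<in> words A" "t \<in> {0..1}" "c2 \<le> \<bar>v (edge y, t)\<bar>" for v y t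
  proof -
    have e: "edge y \<in> T" using v(4) by (simp add: edge_mem)
    have "edge_dirichlet (slice v (edge y)) \<le> B" using H1_term_le(1)[OF cT v(1) e] v(3) by simp
    moreover have "\<exists>t\<in>{0..1}. c2 \<le> \<bar>slice v (edge y) t\<bar>" using v(5,6) by (intro bexI[of _ t])
    ultimately have ep: "\<eta> \<le> edge_power p (slice v (edge y))" "\<eta> \<le> edge_mass (slice v (edge y))"
      using \<eta>(2)[OF H1_sobolev[OF v(1) e]] by blast+
    have "edge_power p (slice v (edge y)) \<le> power_integral p T v"
      using finite_sum_le_infsum[OF power_summable[OF cT v(1) p(1)], of "{edge y}"] e edge_power_nonneg
      unfolding power_integral_def by auto
    then have P: "\<eta> \<le> power_integral p T v" using ep by simp
    have m0: "0 < mass T v" using ep(2) \<eta>(1) H1_term_le(2)[OF cT v(1) e] by linarith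
    have "2 \<le> \<mu> / mass T v" using v(2) m0 by (simp add: field_simps)
    then have "2 powr ((p - 2) / 2) \<le> (\<mu> / mass T v) powr ((p - 2) / 2)" using p by (intro powr_mono2) auto
    then have "(2 powr ((p - 2) / 2) - 1) * \<eta> \<le> ((\<mu> / mass T v) powr ((p - 2) / 2) - 1) * power_integral p T v"
      using P \<eta>(1) \<open>1 < (2 :: real) powr ((p - 2) / 2)\<close> by (intro mult_mono) auto
    then have "(2 powr ((p - 2) / 2) - 1) * \<eta> / p \<le> ((\<mu> / mass T v) powr ((p - 2) / 2) - 1) * power_integral p T v / p"
      using p by (intro divide_right_mono) auto
    also have "\<dots> \<le> penalized \<kappa> p T v" by (rule penalized_gain[OF v(1) m0]) (use v(2) \<mu> in simp)
    finally show ?thesis by (simp add: \<epsilon>_def)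
  qed
  have main: "\<exists>v\<in>H1 T. mass T v \<le> \<mu> \<and> dirichlet T v \<le> B \<and> penalized \<kappa> p T v \<le> penalized \<kappa> p T u \<and>
      (\<exists>a\<in>A. \<exists>t\<in>{0..1}. d \<le> \<bar>v (edge [a], t)\<bar>)"
    if "u \<in> H1 T" "mass T u \<le> \<mu>" "dirichlet T u \<le> B" "penalized \<kappa> p T u < \<epsilon>"
      "y \<in> words A" "t \<in> {0..1}" "c2 \<le> \<bar>u (edge y, t)\<bar>" for u y t
    using that
  proof (induction "length y" arbitrary: u y rule: less_induct)
    case less
    note u = less.prems(1)
    have u': "u \<in> H1 (tree {0})" using u A0 by simp
    have w0: "[0] \<in> words {0}" and w1: "[1, 0] \<in> words {0}" and w2: "[2, 0] \<in> words {0}" by (auto simp: words_def)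
    show ?case
    proof (cases "\<exists>t\<in>{0..1}. d \<le> \<bar>u (edge [0], t)\<bar>")
      case True
      then show ?thesis using less.prems A0 by (intro bexI[of _ u]) auto
    next
      case False
      then have ud: "\<And>t. t \<in> {0..1} \<Longrightarrow> \<bar>u (edge [0], t)\<bar> < d" by force
      have sob: "sobolev (slice u (edge [0]))" by (rule H1_sobolev[OF u']) (simp add: edge_mem w0)
      have y0: "y \<noteq> [0]" using ud[OF less.prems(6)] less.prems(7) d(3) by auto
      have act: "- \<epsilon> < edge_action \<kappa> p (slice u (edge [0]))"
      proof -
        have "edge_mass (slice u (edge [0])) \<le> (\<integral>t. d\<^sup>2 \<partial>\<II>)"
          unfolding edge_mass_def
        proof (rule integral_mono[OF edge_mass_integrable[OF sob]])
          fix t assume "t \<in> space \<II>"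
          then have "\<bar>u (edge [0], t)\<bar> \<le> \<bar>d\<bar>" using ud[of t] d(2) by simp
          then show "(u (edge [0], t))\<^sup>2 \<le> d\<^sup>2" by (simp only: abs_le_square_iff)
        qed simp
        then have M: "edge_mass (slice u (edge [0])) \<le> d\<^sup>2" by (simp add: measure_unit)
        have "edge_power p (slice u (edge [0])) \<le> d powr (p - 2) * edge_mass (slice u (edge [0]))"
          by (rule edge_power_le[OF sob p(1)]) (use ud in \<open>auto intro: less_imp_le\<close>)
        also have "\<dots> \<le> d powr (p - 2) * d\<^sup>2" using M by (intro mult_left_mono) auto
        also have "\<dots> = d powr (p - 2) * d powr 2" using d(2) by (simp add: powr_numeral)
        also have "\<dots> = d powr p" by (simp add: powr_add[symmetric])
        finally have "edge_power p (slice u (edge [0])) / p \<le> d powr p / p" using p by (intro divide_right_mono) auto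
        moreover have "\<omega>\<^sup>2 * edge_mass (slice u (edge [0])) \<le> \<omega>\<^sup>2 * d\<^sup>2" using M by (intro mult_left_mono) auto
        moreover have "0 \<le> \<kappa> * edge_mass (slice u (edge [0]))" using \<kappa> edge_mass_nonneg by simp
        ultimately show ?thesis unfolding edge_action_def using d(1) edge_dirichlet_nonneg[of "slice u (edge [0])"] by argo
      qed
      note s = rooted_split[OF u']
      define u1 where "u1 = subtree [1, 0] u"
      define u2 where "u2 = subtree [2, 0] u"
      note s' = s[folded u1_def u2_def A0]
      have H: "u1 \<in> H1 T" "u2 \<in> H1 T"
        unfolding u1_def u2_def A0 by (rule subtree_H1(1)[OF w1 u'], rule subtree_H1(1)[OF w2 u'])
      have nn: "0 \<le> edge_mass (slice u (edge [0]))" "0 \<le> edge_dirichlet (slice u (edge [0]))" "0 \<le> mass T u1" "0 \<le> mass T u2"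
        "0 \<le> dirichlet T u1" "0 \<le> dirichlet T u2"
        using edge_mass_nonneg edge_dirichlet_nonneg mass_nonneg dirichlet_nonneg by auto
      have bds: "mass T u1 \<le> \<mu>" "mass T u2 \<le> \<mu>" "dirichlet T u1 \<le> B" "dirichlet T u2 \<le> B"
        "mass T u1 + mass T u2 \<le> \<mu>"
        using s'(2,3) less.prems(2,3) nn by linarith+
      have pos: "0 \<le> penalized \<kappa> p T u1" "0 \<le> penalized \<kappa> p T u2"
        using penalized_nonneg H bds by auto
      have root: "u1 (edge [0], 0) = u (edge [0], 1)" "u2 (edge [0], 0) = u (edge [0], 1)"
      proof -
        obtain f where f: "vertex_values (tree {0}) u f" using vertex_values_exist[OF u'] by blast
        show "u1 (edge [0], 0) = u (edge [0], 1)" "u2 (edge [0], 0) = u (edge [0], 1)"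
          using vertex_values_edge[OF f w0] vertex_values_edge[OF f w1] vertex_values_edge[OF f w2]
          unfolding u1_def u2_def subtree_root_value[OF w1] subtree_root_value[OF w2] by simp_all
      qed
      \<comment> \<open>\<open>w\<close> is the lighter branch, which is thrown away, and \<open>v\<close> the heavier one\<close>
      have step: ?thesis
        if v: "v \<in> H1 T" "mass T v \<le> \<mu>" "dirichlet T v \<le> B" and w: "w \<in> H1 T" "mass T w \<le> \<mu> / 2" "dirichlet T w \<le> B"
          and posv: "0 \<le> penalized \<kappa> p T v"
          and sp: "penalized \<kappa> p T u = edge_action \<kappa> p (slice u (edge [0])) + penalized \<kappa> p T v + penalized \<kappa> p T w"
          and sm: "mass T u = edge_mass (slice u (edge [0])) + mass T v + mass T w"
          and rw: "w (edge [0], 0) = u (edge [0], 1)"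
          and yv: "(\<exists>z\<in>words {0}. length z < length y \<and> (\<forall>t. v (edge z, t) = u (edge y, t))) \<or>
            (\<exists>z\<in>words {0}. length z < length y \<and> (\<forall>t. w (edge z, t) = u (edge y, t)))" for v w
      proof -
        have wsm: "\<bar>w (edge z, t)\<bar> < c2" if z: "z \<in> words {0}" "t \<in> {0..1}" for z t
        proof (rule ccontr)
          assume "\<not> ?thesis"
          then have "2 * \<epsilon> \<le> penalized \<kappa> p T w" using big[OF w _ z(2), of z] z(1) A0 by simp
          then show False using sp act posv less.prems(4) by linarith
        qed
        have "0 \<le> edge_action \<kappa> p (slice u (edge [0])) + penalized \<kappa> p (tree {0}) w"
        proof (rule small[OF sob])
          show "w \<in> H1 (tree {0})" using w(1) A0 by simp
          show "edge_mass (slice u (edge [0])) + mass (tree {0}) w \<le> \<mu>" using sm less.prems(2) mass_nonneg[of T v] A0 by simp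
          show "\<forall>t\<in>{0..1}. \<bar>slice u (edge [0]) t\<bar> \<le> c1"
          proof
            fix t :: real assume "t \<in> {0..1}"
            from ud[OF this] show "\<bar>slice u (edge [0]) t\<bar> \<le> c1" using d(3) c2(3) by linarith
          qed
          show "\<forall>y\<in>words {0}. \<forall>t\<in>{0..1}. \<bar>w (edge y, t)\<bar> \<le> c1"
          proof (intro ballI)
            fix y and t :: real assume "y \<in> words {0}" "t \<in> {0..1}"
            from wsm[OF this] show "\<bar>w (edge y, t)\<bar> \<le> c1" using c2(3) by linarith
          qed
        qed (rule rw)
        then have le: "penalized \<kappa> p T v \<le> penalized \<kappa> p T u" unfolding sp using A0 by simp
        have "\<exists>z\<in>words {0}. length z < length y \<and> (\<forall>t. v (edge z, t) = u (edge y, t))"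
          using yv wsm[OF _ less.prems(6)] less.prems(7) by (metis not_le)
        then obtain z where z: "z \<in> words A" "length z < length y" "\<And>t. v (edge z, t) = u (edge y, t)" using A0 by blast
        have "\<exists>v'\<in>H1 T. mass T v' \<le> \<mu> \<and> dirichlet T v' \<le> B \<and> penalized \<kappa> p T v' \<le> penalized \<kappa> p T v \<and>
            (\<exists>a\<in>A. \<exists>t\<in>{0..1}. d \<le> \<bar>v' (edge [a], t)\<bar>)"
          by (rule less.hyps[OF z(2) v _ z(1) less.prems(6)]) (use le less.prems(4,7) z(3) in auto)
        then show ?thesis using le by (meson order_trans)
      qed
      obtain r where r: "y = r @ [1, 0] \<or> y = r @ [2, 0]" using rooted_word_root[of y] less.prems(5) A0 y0 by auto
      have loc: "(\<exists>z\<in>words {0}. length z < length y \<and> (\<forall>t. u1 (edge z, t) = u (edge y, t))) \<or>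
            (\<exists>z\<in>words {0}. length z < length y \<and> (\<forall>t. u2 (edge z, t) = u (edge y, t)))"
      proof -
        have yw: "y \<in> words {0}" using less.prems(5) A0 by simp
        from r show ?thesis
        proof
          assume y1: "y = r @ [1, 0]"
          obtain z where "z \<in> words {0}" "length z = Suc (length r)" "\<forall>t. u1 (edge z, t) = u (edge y, t)"
            using subtree_value[OF w1 yw[unfolded y1], of u] unfolding u1_def y1 by blast
          then show ?thesis unfolding y1 by (intro disjI1 bexI[of _ z]) auto
        next
          assume y2: "y = r @ [2, 0]"
          obtain z where "z \<in> words {0}" "length z = Suc (length r)" "\<forall>t. u2 (edge z, t) = u (edge y, t)"
            using subtree_value[OF w2 yw[unfolded y2], of u] unfolding u2_def y2 by blast
          then show ?thesis unfolding y2 by (intro disjI2 bexI[of _ z]) auto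
        qed
      qed
      show ?thesis
      proof (cases "mass T u2 \<le> \<mu> / 2")
        case True
        show ?thesis
          by (rule step[OF H(1) bds(1,3) H(2) True bds(4) pos(1) s'(1,2) root(2) loc])
      next
        case False
        then have "mass T u1 \<le> \<mu> / 2" using bds(5) by argo
        then show ?thesis
          by (rule step[OF H(2) bds(2,4) H(1) _ bds(3) pos(2) _ _ root(1) disj_commute[THEN iffD1, OF loc]])
            (use s'(1,2) in simp_all)
      qed
    qed
  qed
  show ?thesis
  proof (intro exI conjI allI impI)
    show "0 < \<epsilon>" "0 < d" by fact+
    fix u assume "u \<in> H1 T \<and> mass T u \<le> \<mu> \<and> dirichlet T u \<le> B \<and> penalized \<kappa> p T u < \<epsilon> \<and>
      (\<exists>y\<in>words A. \<exists>t\<in>{0..1}. c \<le> \<bar>u (edge y, t)\<bar>)"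
    then obtain y t where "u \<in> H1 T" "mass T u \<le> \<mu>" "dirichlet T u \<le> B" "penalized \<kappa> p T u < \<epsilon>"
      "y \<in> words A" "t \<in> {0..1}" "c \<le> \<bar>u (edge y, t)\<bar>" by blast
    then show "\<exists>v\<in>H1 T. mass T v \<le> \<mu> \<and> dirichlet T v \<le> B \<and> penalized \<kappa> p T v \<le> penalized \<kappa> p T u \<and>
      (\<exists>a\<in>A. \<exists>t\<in>{0..1}. d \<le> \<bar>v (edge [a], t)\<bar>)"
      using c2(2) by (intro main) auto
  qed
qed

text \<open>
  Recentred sequences have a limit whose functional is at most \<open>0\<close>, and by \<open>penalized_gain\<close> such a function has
  the full mass.
\<close>

theorem minimizer_exists:
  assumes \<kappa>p: "0 < \<kappa> \<or> 4 < p"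
    and U: "\<And>n. U n \<in> H1 T" and mU: "\<And>n. mass T (U n) \<le> \<mu>" and B: "0 < B" "\<And>n. dirichlet T (U n) \<le> B"
    and pen: "(\<lambda>n. penalized \<kappa> p T (U n)) \<longlonglongrightarrow> 0"
    and c: "0 < c" and vis: "\<And>n. \<exists>y\<in>words A. \<exists>t\<in>{0..1}. c \<le> \<bar>U n (edge y, t)\<bar>"
  shows "\<exists>u\<in>H1 T. mass T u = \<mu> \<and> excess p T u = - \<kappa> * \<mu>"
proof -
  have "\<exists>d>0. \<exists>N. \<forall>n\<ge>N. \<exists>v\<in>H1 T. mass T v \<le> \<mu> \<and> dirichlet T v \<le> B \<and> penalized \<kappa> p T v \<le> penalized \<kappa> p T (U n) \<and>
      (\<exists>a\<in>A. \<exists>t\<in>{0..1}. d \<le> \<bar>v (edge [a], t)\<bar>)"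
    using A_cases
  proof
    assume A0: "A = {0}"
    obtain \<epsilon> d where \<epsilon>d: "0 < \<epsilon>" "0 < d" "\<And>u. u \<in> H1 T \<and> mass T u \<le> \<mu> \<and> dirichlet T u \<le> B \<and> penalized \<kappa> p T u < \<epsilon> \<and>
      (\<exists>y\<in>words A. \<exists>t\<in>{0..1}. c \<le> \<bar>u (edge y, t)\<bar>) \<longrightarrow>
      (\<exists>v\<in>H1 T. mass T v \<le> \<mu> \<and> dirichlet T v \<le> B \<and> penalized \<kappa> p T v \<le> penalized \<kappa> p T u \<and>
        (\<exists>a\<in>A. \<exists>t\<in>{0..1}. d \<le> \<bar>v (edge [a], t)\<bar>))"
      using rooted_recentre[OF A0 \<kappa>p B(1) c] by blast
    have "\<forall>\<^sub>F n in sequentially. penalized \<kappa> p T (U n) < \<epsilon>" by (rule order_tendstoD(2)[OF pen \<epsilon>d(1)])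
    then obtain N where N: "\<And>n. N \<le> n \<Longrightarrow> penalized \<kappa> p T (U n) < \<epsilon>" unfolding eventually_sequentially by blast
    show ?thesis
      by (intro exI[of _ d] exI[of _ N] conjI allI impI \<epsilon>d(2) \<epsilon>d(3)[THEN mp] U mU B(2) N vis)
  next
    assume A3: "A = {0, 1, 2}"
    have "\<exists>v\<in>H1 T. mass T v \<le> \<mu> \<and> dirichlet T v \<le> B \<and> penalized \<kappa> p T v \<le> penalized \<kappa> p T (U n) \<and>
      (\<exists>a\<in>A. \<exists>t\<in>{0..1}. c \<le> \<bar>v (edge [a], t)\<bar>)" for n
    proof -
      obtain y t where y: "y \<in> words A" "t \<in> {0..1}" "c \<le> \<bar>U n (edge y, t)\<bar>" using vis by blast
      obtain v a where v: "v \<in> H1 T" "a \<in> A" "\<And>t. v (edge [a], t) = U n (edge y, t)"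
        "dirichlet T v = dirichlet T (U n)" "mass T v = mass T (U n)" "power_integral p T v = power_integral p T (U n)"
        using recentre[of "U n" y p] U[of n] y(1) p(1) unfolding A3 by blast
      have "penalized \<kappa> p T v = penalized \<kappa> p T (U n)"
        using v(4-6) by (simp add: penalized_def excess_def gap_def)
      moreover have "\<exists>a\<in>A. \<exists>t\<in>{0..1}. c \<le> \<bar>v (edge [a], t)\<bar>"
        using v(2,3) y(2,3) by (intro bexI[of _ a] bexI[of _ t]) simp_all
      ultimately show ?thesis using v(1,4,5) mU[of n] B(2)[of n] by (intro bexI[of _ v]) simp_all
    qed
    then show ?thesis by (intro exI[of _ c] exI[of _ 0] conjI allI impI c)
  qed
  then obtain d N where d: "0 < d" and "\<forall>n\<ge>N. \<exists>v\<in>H1 T. mass T v \<le> \<mu> \<and> dirichlet T v \<le> B \<and>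
      penalized \<kappa> p T v \<le> penalized \<kappa> p T (U n) \<and> (\<exists>a\<in>A. \<exists>t\<in>{0..1}. d \<le> \<bar>v (edge [a], t)\<bar>)" by (elim exE conjE)
  then have "\<forall>n. \<exists>v. v \<in> H1 T \<and> mass T v \<le> \<mu> \<and> dirichlet T v \<le> B \<and>
      penalized \<kappa> p T v \<le> penalized \<kappa> p T (U (n + N)) \<and> (\<exists>a\<in>A. \<exists>t\<in>{0..1}. d \<le> \<bar>v (edge [a], t)\<bar>)"
    by (metis le_add2)
  then obtain V where V: "\<And>n. V n \<in> H1 T" "\<And>n. mass T (V n) \<le> \<mu>" "\<And>n. dirichlet T (V n) \<le> B"
    "\<And>n. penalized \<kappa> p T (V n) \<le> penalized \<kappa> p T (U (n + N))" "\<And>n. \<exists>a\<in>A. \<exists>t\<in>{0..1}. d \<le> \<bar>V n (edge [a], t)\<bar>"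
    by metis
  have "(\<lambda>n. penalized \<kappa> p T (V n)) \<longlonglongrightarrow> 0"
    by (rule tendsto_sandwich[OF _ _ tendsto_const LIMSEQ_ignore_initial_segment[OF pen, of N]])
      (use V penalized_nonneg in auto)
  from limit_theorem[OF V(1,2) B(1) V(3) this d V(5)]
  obtain u where u: "u \<in> H1 T" "0 < mass T u" "mass T u \<le> \<mu>" "penalized \<kappa> p T u \<le> 0" by blast
  have P: "0 < power_integral p T u" by (rule power_integral_pos[OF cT u(1,2) p(1)])
  have "mass T u = \<mu>"
  proof (rule ccontr)
    assume "mass T u \<noteq> \<mu>"
    then have "1 < \<mu> / mass T u" using u(2,3) by simp
    then have "1 powr ((p - 2) / 2) < (\<mu> / mass T u) powr ((p - 2) / 2)" using p by (intro powr_less_mono2) auto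
    then have "0 < ((\<mu> / mass T u) powr ((p - 2) / 2) - 1) * power_integral p T u / p" using P p by simp
    then show False using penalized_gain[OF u(1-3)] u(4) by linarith
  qed
  moreover from this have "excess p T u = - \<kappa> * \<mu>"
    using level_bound[OF u(1)] u(4) unfolding penalized_def by simp
  ultimately show ?thesis using u(1) by blast
qed

end

section \<open>Ground states\<close>

lemma powr_root_cancel: "0 < x \<Longrightarrow> q \<noteq> 0 \<Longrightarrow> (x powr (1 / q)) powr q = x" for x q :: real
  by (simp add: powr_powr)

context binary_tree begin

text \<open>
  Along a minimizing sequence the excess is bounded away from \<open>0\<close>, so the power integral and with it the
  supremum is bounded below.
\<close>

lemma ground_state_above:
  assumes AC: "A = {0} \<or> A = {0, 1, 2}" and \<mu>: "\<mu>c < \<mu>"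
  shows "\<exists>u. ground_state p T \<mu> u"
proof -
  have \<mu>0: "0 < \<mu>" using \<mu> \<mu>c_nonneg by simp
  define E where "E = {excess p T u | u. u \<in> H1 T \<and> mass T u = \<mu>}"
  define J where "J = Inf E"
  obtain b where b: "\<And>u. u \<in> H1 T \<Longrightarrow> mass T u \<le> \<mu> \<Longrightarrow> b \<le> excess p T u"
    using excess_bounded_below[of \<mu>] \<mu>0 by auto
  have bdd: "bdd_below E" unfolding E_def by (rule bdd_belowI[of _ b]) (use b in auto)
  have low: "J \<le> excess p T u" if "u \<in> H1 T" "mass T u = \<mu>" for u
    unfolding J_def by (rule cInf_lower[OF _ bdd]) (use that in \<open>auto simp: E_def\<close>)
  obtain u0 where u0: "u0 \<in> H1 T" "mass T u0 = \<mu>" "excess p T u0 < 0"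
    using \<mu> unfolding negative_excess_iff[symmetric] negative_excess_def by blast
  have J: "J < 0" using low[OF u0(1,2)] u0(3) by simp
  have ne: "E \<noteq> {}" unfolding E_def using u0 by blast
  define \<kappa> where "\<kappa> = - J / \<mu>"
  have \<kappa>J: "0 < \<kappa>" "- \<kappa> * \<mu> = J" using J \<mu>0 by (simp_all add: \<kappa>_def divide_neg_pos)
  interpret penalized_problem A p \<kappa> \<mu>
    by unfold_locales (use AC \<kappa>J \<mu>0 low in auto)
  have "\<exists>u. u \<in> H1 T \<and> mass T u = \<mu> \<and> excess p T u < J + min (1 / real (Suc n)) (- J / 2)" for n
  proof -
    have "Inf E < J + min (1 / real (Suc n)) (- J / 2)" unfolding J_def[symmetric] using J by simp
    then show ?thesis using cInf_lessD[OF ne] unfolding E_def by blast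
  qed
  then obtain U where U: "\<And>n. U n \<in> H1 T" "\<And>n. mass T (U n) = \<mu>"
    "\<And>n. excess p T (U n) < J + min (1 / real (Suc n)) (- J / 2)" by metis
  have neg: "excess p T (U n) < J / 2" for n using U(3)[of n] by (simp add: min_def split: if_splits)
  obtain B where B: "0 < B" "\<And>u. u \<in> H1 T \<Longrightarrow> mass T u \<le> \<mu> \<Longrightarrow> excess p T u \<le> 0 \<Longrightarrow> dirichlet T u \<le> B"
    using coercive[of \<mu> 0] \<mu>0 by auto
  have BU: "dirichlet T (U n) \<le> B" for n using B(2)[OF U(1)] U(2) neg[of n] J by simp
  have pen: "(\<lambda>n. penalized \<kappa> p T (U n)) \<longlonglongrightarrow> 0"
  proof (rule tendsto_sandwich[OF _ _ tendsto_const])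
    show "\<forall>\<^sub>F n in sequentially. 0 \<le> penalized \<kappa> p T (U n)" using penalized_nonneg U(1,2) by simp
    show "(\<lambda>n. 1 / real (Suc n)) \<longlonglongrightarrow> 0" by (rule LIMSEQ_inverse_real_of_nat[unfolded inverse_eq_divide])
    have "penalized \<kappa> p T (U n) \<le> 1 / real (Suc n)" for n
    proof -
      have "excess p T (U n) < J + 1 / real (Suc n)" using U(3)[of n] by (rule less_le_trans) simp
      then show ?thesis unfolding penalized_def U(2) using \<kappa>J(2) by simp
    qed
    then show "\<forall>\<^sub>F n in sequentially. penalized \<kappa> p T (U n) \<le> 1 / real (Suc n)" by simp
  qed
  define c where "c = (p * (- J) / (4 * \<mu>)) powr (1 / (p - 2))"
  have c: "0 < c" using p J \<mu>0 by (simp add: c_def divide_neg_pos mult_pos_neg)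
  have cp: "c powr (p - 2) * \<mu> = p * (- J) / 4"
  proof -
    have "0 < p * (- J) / (4 * \<mu>)" using p J \<mu>0 by (intro divide_pos_pos mult_pos_pos) auto
    then have "c powr (p - 2) = p * (- J) / (4 * \<mu>)" unfolding c_def using p by (intro powr_root_cancel) auto
    then show ?thesis using \<mu>0 by simp
  qed
  have vis: "\<exists>y\<in>words A. \<exists>t\<in>{0..1}. c \<le> \<bar>U n (edge y, t)\<bar>" for n
  proof (rule ccontr)
    assume "\<not> ?thesis"
    then have "\<bar>U n (e, t)\<bar> \<le> c" if "e \<in> T" "t \<in> {0..1}" for e t
      using that unfolding tree_eq_image by force
    then have "power_integral p T (U n) \<le> c powr (p - 2) * mass T (U n)" by (rule power_bound(2)[OF cT U(1) p(1)])
    then have "power_integral p T (U n) / p \<le> - J / 4" unfolding U(2) cp using p by (simp add: field_simps)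
    moreover have "0 \<le> gap T (U n)" by (rule gap_nonneg[OF A(1) U(1)])
    ultimately show False using neg[of n] J unfolding excess_def by argo
  qed
  have mU: "mass T (U n) \<le> \<mu>" for n using U(2) by simp
  obtain u where u: "u \<in> H1 T" "mass T u = \<mu>" "excess p T u = - \<kappa> * \<mu>"
    using minimizer_exists[OF disjI1[OF \<kappa>J(1)] U(1) mU B(1) BU pen c vis] by blast
  have "ground_state p T \<mu> u" unfolding ground_state_iff using u low \<kappa>J(2) by auto
  then show ?thesis by blast
qed

text \<open>
  Functions of negative excess with masses decreasing to the critical mass are scaled down to it; their excess
  tends to \<open>0\<close>. They do not vanish: negative excess means that the gap is less than \<open>2 / p\<close> times the power
  integral, which is at most a multiple of the power \<open>p - 4\<close> of the supremum times the gap.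
\<close>

lemma ground_state_critical:
  assumes AC: "A = {0} \<or> A = {0, 1, 2}" and p4: "4 < p"
  shows "\<exists>u. ground_state p T \<mu>c u"
proof -
  have \<mu>0: "0 < \<mu>c" using \<mu>c_pos p4 by simp
  have low: "0 \<le> excess p T u" if "u \<in> H1 T" "mass T u = \<mu>c" for u
    using negative_excess_iff[of \<mu>c] that unfolding negative_excess_def by force
  interpret penalized_problem A p 0 \<mu>c
    by unfold_locales (use AC \<mu>0 low in auto)
  define m where "m = (\<lambda>n. \<mu>c + 1 / real (Suc n))"
  have m: "\<mu>c < m n" "m n \<le> \<mu>c + 1" for n by (auto simp: m_def)
  have "\<exists>u. u \<in> H1 T \<and> mass T u = m n \<and> excess p T u < 0" for n
    using m(1)[of n] unfolding negative_excess_iff[symmetric] negative_excess_def by blast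
  then obtain u where u: "\<And>n. u n \<in> H1 T" "\<And>n. mass T (u n) = m n" "\<And>n. excess p T (u n) < 0" by metis
  obtain B where B: "0 < B" "\<And>u. u \<in> H1 T \<Longrightarrow> mass T u \<le> \<mu>c + 1 \<Longrightarrow> excess p T u \<le> 0 \<Longrightarrow> dirichlet T u \<le> B"
    using coercive[of "\<mu>c + 1" 0] \<mu>0 by auto
  have Bu: "dirichlet T (u n) \<le> B" for n using B(2)[OF u(1)] u(2,3) m(2) by (simp add: less_imp_le)
  define s where "s = (\<lambda>n. sqrt (\<mu>c / m n))"
  have mpos: "0 < m n" for n using m(1)[of n] \<mu>0 by simp
  have s: "0 < s n" "s n \<le> 1" "(s n)\<^sup>2 = \<mu>c / m n" for n
    using m(1)[of n] \<mu>0 mpos[of n] by (auto simp: s_def)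
  define U where "U = (\<lambda>n z. s n * u n z)"
  have U: "U n \<in> H1 T" for n unfolding U_def by (rule H1_scale(1)[OF cT u(1) p(1)])
  have mU: "mass T (U n) = \<mu>c" for n
    unfolding U_def s_def u(2)[symmetric] by (rule mass_normalize[OF cT u(1)]) (use mpos \<mu>0 in \<open>auto simp: u(2)\<close>)
  have BU: "dirichlet T (U n) \<le> B" for n
  proof -
    have "dirichlet T (U n) = (s n)\<^sup>2 * dirichlet T (u n)" unfolding U_def by (rule H1_scale(2)[OF cT u(1) p(1)])
    also have "\<dots> \<le> 1 * dirichlet T (u n)"
      using s[of n] dirichlet_nonneg[of T "u n"] by (intro mult_right_mono power_le_one) auto
    finally show ?thesis using Bu[of n] by simp
  qed
  define S where "S = sqrt ((\<mu>c + 1) + 2 * sqrt ((\<mu>c + 1) * B))"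
  define C where "C = S powr (p - 2) * (\<mu>c + 1)"
  have PC: "power_integral p T (u n) \<le> C" for n
  proof -
    have "\<bar>u n (e, t)\<bar> \<le> S" if "e \<in> T" "t \<in> {0..1}" for e t
      unfolding S_def
    proof (rule real_le_rsqrt)
      have "mass T (u n) + 2 * sqrt (mass T (u n) * dirichlet T (u n)) \<le> (\<mu>c + 1) + 2 * sqrt ((\<mu>c + 1) * B)"
        using m(2)[of n] Bu[of n] \<mu>0 mpos[of n] dirichlet_nonneg[of T "u n"] unfolding u(2)
        by (intro add_mono mult_left_mono real_sqrt_le_mono mult_mono) auto
      then show "\<bar>u n (e, t)\<bar>\<^sup>2 \<le> (\<mu>c + 1) + 2 * sqrt ((\<mu>c + 1) * B)" using H1_bounded[OF cT u(1) that, of n] by simp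
    qed
    then have "power_integral p T (u n) \<le> S powr (p - 2) * mass T (u n)" by (rule power_bound(2)[OF cT u(1) p(1)])
    also have "\<dots> \<le> C" unfolding C_def u(2) using m(2) by (intro mult_left_mono) auto
    finally show ?thesis .
  qed
  have pen: "(\<lambda>n. penalized 0 p T (U n)) \<longlonglongrightarrow> 0"
  proof (rule tendsto_sandwich[OF _ _ tendsto_const])
    show "\<forall>\<^sub>F n in sequentially. 0 \<le> penalized 0 p T (U n)" using penalized_nonneg U mU by simp
    have "(\<lambda>n. 1 / real (Suc n)) \<longlonglongrightarrow> 0" by (rule LIMSEQ_inverse_real_of_nat[unfolded inverse_eq_divide])
    then have "(\<lambda>n. sqrt (\<mu>c / m n)) \<longlonglongrightarrow> sqrt (\<mu>c / (\<mu>c + 0))" unfolding m_def using \<mu>0 by (intro tendsto_intros) auto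
    then have s1: "s \<longlonglongrightarrow> 1" using \<mu>0 by (simp add: s_def[abs_def])
    have "(\<lambda>n. ((s n)\<^sup>2 - s n powr p) * (C / p)) \<longlonglongrightarrow> (1\<^sup>2 - 1 powr p) * (C / p)"
      by (intro tendsto_intros s1) simp
    then show "(\<lambda>n. ((s n)\<^sup>2 - s n powr p) * (C / p)) \<longlonglongrightarrow> 0" by simp
    have "penalized 0 p T (U n) \<le> ((s n)\<^sup>2 - s n powr p) * (C / p)" for n
    proof -
      define P where "P = power_integral p T (u n)"
      have "penalized 0 p T (U n) = (s n)\<^sup>2 * gap T (u n) / 2 - s n powr p * P / p"
        unfolding penalized_def U_def excess_scale[OF cT u(1) p(1)] P_def using s(1)[of n] by simp
      also have "(s n)\<^sup>2 * gap T (u n) / 2 \<le> (s n)\<^sup>2 * (P / p)"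
        using u(3)[of n] mult_left_mono[of "gap T (u n) / 2" "P / p" "(s n)\<^sup>2"] unfolding excess_def P_def by simp
      finally have "penalized 0 p T (U n) \<le> ((s n)\<^sup>2 - s n powr p) * (P / p)" by (simp add: left_diff_distrib diff_divide_distrib)
      also have "\<dots> \<le> ((s n)\<^sup>2 - s n powr p) * (C / p)"
      proof (rule mult_left_mono)
        show "P / p \<le> C / p" using PC[of n] p unfolding P_def by (intro divide_right_mono) auto
        have "s n powr p \<le> s n powr 2" using s[of n] p by (intro powr_mono') auto
        then show "0 \<le> (s n)\<^sup>2 - s n powr p" using s(1)[of n] by (simp add: powr_numeral)
      qed
      finally show ?thesis .
    qed
    then show "\<forall>\<^sub>F n in sequentially. penalized 0 p T (U n) \<le> ((s n)\<^sup>2 - s n powr p) * (C / p)" by simp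
  qed
  define c' where "c' = (p / (4 * Ksup * (\<mu>c + 1))) powr (1 / (p - 4))"
  have q0: "0 < p / (4 * Ksup * (\<mu>c + 1))" using p Ksup_pos \<mu>0 by simp
  have c': "0 < c'" "c' powr (p - 4) * (Ksup * (\<mu>c + 1)) = p / 4"
  proof -
    show "0 < c'" unfolding c'_def powr_gt_zero using q0 by (metis less_irrefl)
    have "c' powr (p - 4) = p / (4 * Ksup * (\<mu>c + 1))" unfolding c'_def by (rule powr_root_cancel[OF q0]) (use p4 in simp)
    moreover have "p / (4 * X) * X = p / 4" if "0 < X" for X using that by simp
    moreover have "0 < Ksup * (\<mu>c + 1)" using Ksup_pos \<mu>0 by simp
    ultimately show "c' powr (p - 4) * (Ksup * (\<mu>c + 1)) = p / 4" by (simp only: mult.assoc)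
  qed
  have visu: "\<exists>y\<in>words A. \<exists>t\<in>{0..1}. c' \<le> \<bar>u n (edge y, t)\<bar>" for n
  proof (rule ccontr)
    assume "\<not> ?thesis"
    then have c1: "\<bar>u n (e, t)\<bar> \<le> c'" if "e \<in> T" "t \<in> {0..1}" for e t
      using that unfolding tree_eq_image by force
    define Q where "Q = gap T (u n)"
    have Q0: "0 \<le> Q" unfolding Q_def by (rule gap_nonneg[OF A(1) u(1)])
    define r where "r = min c' (sqrt (Ksup * Q))"
    have r0: "0 \<le> r" using c'(1) Ksup_pos Q0 by (simp add: r_def)
    have "\<bar>u n (e, t)\<bar> \<le> r" if "e \<in> T" "t \<in> {0..1}" for e t
      using c1[OF that] sup_le_sqrt_gap[OF u(1)[of n] that] by (simp add: r_def Q_def)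
    then have "power_integral p T (u n) \<le> r powr (p - 2) * mass T (u n)" by (rule power_bound(2)[OF cT u(1) p(1)])
    also have "r powr (p - 2) = r powr (p - 4) * r\<^sup>2"
    proof (cases "r = 0")
      case False
      then have "r powr (p - 4) * r powr 2 = r powr (p - 4 + 2)" by (simp only: powr_add)
      then show ?thesis using r0 False by (simp add: powr_numeral)
    qed simp
    also have "r powr (p - 4) * r\<^sup>2 * mass T (u n) \<le> c' powr (p - 4) * (Ksup * Q) * (\<mu>c + 1)"
    proof (intro mult_mono)
      show "r powr (p - 4) \<le> c' powr (p - 4)" using r0 p4 by (intro powr_mono2) (auto simp: r_def)
      have "r\<^sup>2 \<le> (sqrt (Ksup * Q))\<^sup>2" using r0 by (intro power_mono) (auto simp: r_def)
      then show "r\<^sup>2 \<le> Ksup * Q" using Ksup_pos Q0 by simp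
    qed (use m(2)[of n] mpos[of n] Ksup_pos Q0 in \<open>auto simp: u(2)\<close>)
    also have "\<dots> = c' powr (p - 4) * (Ksup * (\<mu>c + 1)) * Q" by (simp add: ac_simps)
    also have "\<dots> = p / 4 * Q" unfolding c'(2) ..
    finally have "power_integral p T (u n) / p \<le> Q / 4" using p by (simp add: field_simps)
    then show False using u(3)[of n] Q0 unfolding excess_def Q_def[symmetric] by argo
  qed
  \<comment> \<open>a lower bound for all scaling factors\<close>
  define s0 where "s0 = sqrt (\<mu>c / (\<mu>c + 1))"
  have s0: "0 < s0" "s0 \<le> s n" for n
    using m(2)[of n] mpos[of n] \<mu>0 by (auto simp: s0_def s_def intro!: divide_left_mono)
  have vis: "\<exists>y\<in>words A. \<exists>t\<in>{0..1}. s0 * c' \<le> \<bar>U n (edge y, t)\<bar>" for n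
  proof -
    obtain y t where y: "y \<in> words A" "t \<in> {0..1}" "c' \<le> \<bar>u n (edge y, t)\<bar>" using visu by blast
    have "s0 * c' \<le> s n * \<bar>u n (edge y, t)\<bar>" using y(3) s0(1) s0(2)[of n] c'(1) s(1)[of n] by (intro mult_mono) auto
    also have "\<dots> = \<bar>U n (edge y, t)\<bar>" using s(1)[of n] by (simp add: U_def abs_mult)
    finally show ?thesis using y(1,2) by blast
  qed
  have mU': "mass T (U n) \<le> \<mu>c" for n using mU by simp
  have "0 < s0 * c'" using s0(1) c'(1) by simp
  from minimizer_exists[OF disjI2[OF p4] U mU' B(1) BU pen this vis]
  obtain v where v: "v \<in> H1 T" "mass T v = \<mu>c" "excess p T v = - 0 * \<mu>c" by blast
  have "ground_state p T \<mu>c v" unfolding ground_state_iff using v low by auto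
  then show ?thesis by blast
qed

end

theorem theorem1p2:
  fixes p :: real and G :: "nat list mgraph"
  assumes "G = unrooted_tree \<or> G = rooted_tree"
    and "2 < p" and "p < 6"
  shows "critical_mass p G (mu_star p G) \<and>
    (\<forall>\<mu>. critical_mass p G \<mu> \<longrightarrow> \<mu> \<le> mu_star p G) \<and>
    (\<forall>\<mu>. 0 \<le> \<mu> \<and> \<mu> \<le> mu_star p G \<longrightarrow> ground_level p G \<mu> = ereal (1 / 2 * lambda1 * \<mu>)) \<and>
    (\<forall>\<mu>. mu_star p G < \<mu> \<longrightarrow> ground_level p G \<mu> < ereal (1 / 2 * lambda1 * \<mu>)) \<and>
    (\<forall>\<mu>. mu_star p G < \<mu> \<longrightarrow> (\<exists>u. ground_state p G \<mu> u)) \<and>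
    (\<forall>\<mu>. 0 < \<mu> \<and> \<mu> < mu_star p G \<longrightarrow> \<not> (\<exists>u. ground_state p G \<mu> u)) \<and>
    (4 \<le> p \<longrightarrow> 0 < mu_star p G) \<and>
    (4 < p \<longrightarrow> (\<exists>u. ground_state p G (mu_star p G) u))"
proof -
  obtain A where AG: "A = {0} \<or> A = {0, 1, 2}" "G = tree A"
    using assms(1) unrooted_tree_eq rooted_tree_eq by blast
  interpret binary_tree A p
    by unfold_locales (use AG assms in auto)
  have crit: "ground_level p T \<mu> = ereal (1 / 2 * lambda1 * \<mu>)" if "0 \<le> \<mu>" "\<mu> \<le> \<mu>c" for \<mu>
    using critical_mass_\<mu>c[of \<mu>] that unfolding critical_mass_def by blast
  have sup: "ground_level p T \<mu> < ereal (1 / 2 * lambda1 * \<mu>)" if "\<mu>c < \<mu>" for \<mu>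
    using ground_level_less_iff[of \<mu>] negative_excess_iff[of \<mu>] that \<mu>c_nonneg by simp
  show ?thesis
    unfolding AG(2) mu_star_eq
    using critical_mass_\<mu>c \<mu>c_nonneg crit sup ground_state_above[OF AG(1)] no_ground_state \<mu>c_pos
      ground_state_critical[OF AG(1)] by blast
qed

end
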